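(* In the two-group random mixture model, suppose that $f_0(x)=\mathbf 1\{0<x<1\}$, that $f_1$ is a density on $(0,1)$ which is strictly decreasing on $(0,1)$, and that $W_i=\pi_0f_0(X_i)/f(X_i)$ is a continuous random variable. Let $f(0+)=\lim_{x\to0^+}f(x)$. Then for any $\alpha\in\big(\frac{\pi_0}{f(0+)},\pi_0\big)$, the oracle Benjamini-Hochberg rule $\delta^n_{\rm BH}(\alpha)$ satisfies, as $n\to\infty$, $\mathrm{mFDR}(\delta^n_{\rm BH}(\alpha))\to\alpha$, $\mathrm{mFNR}(\delta^n_{\rm BH}(\alpha))\to\mathsf{mFNR}^*(\alpha)$, and $\mathrm{FDP}(\delta^n_{\rm BH}(\alpha))\to\alpha$, $\mathrm{FNP}(\delta^n_{\rm BH}(\alpha))\to\mathsf{mFNR}^*(\alpha)$ in probability.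
   Context: Two-group random mixture model: $\pi_0,\pi_1\in(0,1)$ with $\pi_0+\pi_1=1$; $f_0,f_1$ probability densities, $f=\pi_0f_0+\pi_1f_1$. The labels $\theta_1,\dots,\theta_n$ are iid $\mathrm{Bern}(\pi_1)$ and, conditionally on $\theta^n$, the observations $X_1,\dots,X_n$ are independent with $X_i\sim f_{\theta_i}$ (here the $X_i$ are $p$-values). Oracle BH rule: with order statistics $X_{(1)}\le\dots\le X_{(n)}$ and $X_{(0)}=0$, let $i^*=\max\{i\in\{0,1,\dots,n\}:X_{(i)}\le\frac{i\alpha}{n\pi_0}\}$ and $\delta^n_{\rm BH}(\alpha)=(\mathbf 1\{X_i\le X_{(i^* )}\})_{i=1,\dots,n}$. For a (possibly randomized) decision rule $\delta^n\in\{0,1\}^n$ (a Markov kernel applied to $X^n$): $\mathrm{FDP}(\delta^n)=\frac{\sum_i\delta_i(1-\theta_i)}{1\vee\sum_i\delta_i}$, $\mathrm{FNP}(\delta^n)=\frac{\sum_i(1-\delta_i)\theta_i}{1\vee\sum_i(1-\delta_i)}$, $\mathrm{mFDR}(\delta^n)=\frac{\mathbb E[\sum_i\delta_i(1-\theta_i)]}{\mathbb E[\sum_i\delta_i]}$, $\mathrm{mFNR}(\delta^n)=\frac{\mathbb E[\sum_i(1-\delta_i)\theta_i]}{\mathbb E[\sum_i(1-\delta_i)]}$ with $0/0=0$. $\mathsf{mFNR}^*(\alpha)=\inf\{\mathrm{mFNR}(\delta^n):\mathrm{mFDR}(\delta^n)\le\alpha\}$ over all decision rules; its value does not depend on $n$.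 *)

theory Defs
  imports "HOL-Probability.Probability"
begin

definition is_density :: "(real \<Rightarrow> real) \<Rightarrow> bool" where
  "is_density g \<longleftrightarrow>
     g \<in> borel_measurable borel \<and> (\<forall>x. 0 \<le> g x) \<and> (\<integral>\<^sup>+x. ennreal (g x) \<partial>lborel) = 1"

text \<open>
  Labels, observations and decisions are functions on \<open>{..<n}\<close>; the label \<open>\<theta>\<^sub>i = 1\<close> is \<open>\<theta> i = True\<close>,
  and \<open>\<delta>\<^sub>i = 1\<close> is \<open>d i = True\<close>. Label vectors take the value \<open>False\<close> outside \<open>{..<n}\<close>.
\<close>

definition labels :: "real \<Rightarrow> nat \<Rightarrow> (nat \<Rightarrow> bool) pmf" where
  "labels \<pi>1 n = Pi_pmf {..<n} False (\<lambda>_. bernoulli_pmf \<pi>1)"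

abbreviation obs_space :: "nat \<Rightarrow> (nat \<Rightarrow> real) measure" where
  "obs_space n \<equiv> PiM {..<n} (\<lambda>_. borel)"

abbreviation decision_space :: "nat \<Rightarrow> (nat \<Rightarrow> bool) measure" where
  "decision_space n \<equiv> count_space ({..<n} \<rightarrow>\<^sub>E UNIV)"

definition two_group ::
  "real \<Rightarrow> (real \<Rightarrow> real) \<Rightarrow> (real \<Rightarrow> real) \<Rightarrow> nat \<Rightarrow> ((nat \<Rightarrow> bool) \<times> (nat \<Rightarrow> real)) measure" where
  "two_group \<pi>1 f0 f1 n =
     do {
       \<theta> \<leftarrow> measure_pmf (labels \<pi>1 n);
       x \<leftarrow> PiM {..<n} (\<lambda>i. density lborel (if \<theta> i then f1 else f0));
       return (count_space UNIV \<Otimes>\<^sub>M obs_space n) (\<theta>, x)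
     }"

type_synonym rule = "(nat \<Rightarrow> real) \<Rightarrow> (nat \<Rightarrow> bool) measure"

definition decision_rules :: "nat \<Rightarrow> rule set" where
  "decision_rules n = measurable (obs_space n) (prob_algebra (decision_space n))"

text \<open>Joint law of labels, observations and decisions when the rule \<open>K\<close> is applied to the
  observations.\<close>

definition decision_law ::
  "real \<Rightarrow> (real \<Rightarrow> real) \<Rightarrow> (real \<Rightarrow> real) \<Rightarrow> nat \<Rightarrow> rule
     \<Rightarrow> ((nat \<Rightarrow> bool) \<times> (nat \<Rightarrow> real) \<times> (nat \<Rightarrow> bool)) measure" where
  "decision_law \<pi>1 f0 f1 n K =
     do {
       (\<theta>, x) \<leftarrow> two_group \<pi>1 f0 f1 n;
       d \<leftarrow> K x;
       return (count_space UNIV \<Otimes>\<^sub>M obs_space n \<Otimes>\<^sub>M decision_space n) (\<theta>, x, d)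
     }"

definition FDP :: "nat \<Rightarrow> (nat \<Rightarrow> bool) \<Rightarrow> (nat \<Rightarrow> bool) \<Rightarrow> real" where
  "FDP n \<theta> d = (\<Sum>i<n. of_bool (d i) * (1 - of_bool (\<theta> i))) / max 1 (\<Sum>i<n. of_bool (d i))"

definition FNP :: "nat \<Rightarrow> (nat \<Rightarrow> bool) \<Rightarrow> (nat \<Rightarrow> bool) \<Rightarrow> real" where
  "FNP n \<theta> d = (\<Sum>i<n. (1 - of_bool (d i)) * of_bool (\<theta> i)) / max 1 (\<Sum>i<n. 1 - of_bool (d i))"

text \<open>The convention \<open>0 / 0 = 0\<close> is that of real division in HOL.\<close>

definition mFDR :: "real \<Rightarrow> (real \<Rightarrow> real) \<Rightarrow> (real \<Rightarrow> real) \<Rightarrow> nat \<Rightarrow> rule \<Rightarrow> real" where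
  "mFDR \<pi>1 f0 f1 n K =
     (\<integral>(\<theta>, x, d). (\<Sum>i<n. of_bool (d i) * (1 - of_bool (\<theta> i))) \<partial>decision_law \<pi>1 f0 f1 n K) /
     (\<integral>(\<theta>, x, d). (\<Sum>i<n. of_bool (d i)) \<partial>decision_law \<pi>1 f0 f1 n K)"

definition mFNR :: "real \<Rightarrow> (real \<Rightarrow> real) \<Rightarrow> (real \<Rightarrow> real) \<Rightarrow> nat \<Rightarrow> rule \<Rightarrow> real" where
  "mFNR \<pi>1 f0 f1 n K =
     (\<integral>(\<theta>, x, d). (\<Sum>i<n. (1 - of_bool (d i)) * of_bool (\<theta> i)) \<partial>decision_law \<pi>1 f0 f1 n K) /
     (\<integral>(\<theta>, x, d). (\<Sum>i<n. 1 - of_bool (d i)) \<partial>decision_law \<pi>1 f0 f1 n K)"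

text \<open>Optimal value over all rules for \<open>m\<close> observations; it is the same for all \<open>m \<ge> 1\<close>.\<close>

definition mFNR_opt :: "real \<Rightarrow> (real \<Rightarrow> real) \<Rightarrow> (real \<Rightarrow> real) \<Rightarrow> nat \<Rightarrow> real \<Rightarrow> real" where
  "mFNR_opt \<pi>1 f0 f1 m \<alpha> =
     (INF K\<in>{K \<in> decision_rules m. mFDR \<pi>1 f0 f1 m K \<le> \<alpha>}. mFNR \<pi>1 f0 f1 m K)"

definition order_stat :: "nat \<Rightarrow> (nat \<Rightarrow> real) \<Rightarrow> nat \<Rightarrow> real" where
  "order_stat n x k = (if k = 0 then 0 else sort (map x [0..<n]) ! (k - 1))"

definition BH_index :: "real \<Rightarrow> real \<Rightarrow> nat \<Rightarrow> (nat \<Rightarrow> real) \<Rightarrow> nat" where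
  "BH_index \<pi>0 \<alpha> n x = Max {i \<in> {0..n}. order_stat n x i \<le> (real i * \<alpha>) / (real n * \<pi>0)}"

definition BH_decision :: "real \<Rightarrow> real \<Rightarrow> nat \<Rightarrow> (nat \<Rightarrow> real) \<Rightarrow> nat \<Rightarrow> bool" where
  "BH_decision \<pi>0 \<alpha> n x = (\<lambda>i\<in>{..<n}. x i \<le> order_stat n x (BH_index \<pi>0 \<alpha> n x))"

definition BH :: "real \<Rightarrow> real \<Rightarrow> nat \<Rightarrow> rule" where
  "BH \<pi>0 \<alpha> n x = return (decision_space n) (BH_decision \<pi>0 \<alpha> n x)"

text \<open>Convergence in probability to a constant for random variables \<open>Y n\<close> living on probability
  spaces \<open>N n\<close> that may vary with \<open>n\<close>.\<close>

definition conv_in_prob :: "(nat \<Rightarrow> 'a measure) \<Rightarrow> (nat \<Rightarrow> 'a \<Rightarrow> real) \<Rightarrow> real \<Rightarrow> bool" where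
  "conv_in_prob N Y c \<longleftrightarrow>
     (\<forall>\<epsilon>>0. (\<lambda>n. measure (N n) {\<omega> \<in> space (N n). \<bar>Y n \<omega> - c\<bar> > \<epsilon>}) \<longlonglongrightarrow> 0)"

end

theory Submission
  imports Defs
begin

text \<open>
  Let \<open>F\<close> be the distribution function of the mixture and \<open>\<rho> = \<pi>0 / \<alpha>\<close>. Since \<open>f1\<close> is decreasing, \<open>F t / t\<close>
  decreases strictly and continuously from \<open>f(0+) > \<rho>\<close> to \<open>1 < \<rho>\<close>, so it crosses \<open>\<rho>\<close> at a unique \<open>t\<close>. By the
  law of large numbers, used on a finite grid, the Benjamini-Hochberg rejection set lies, with probability tending to one, between
  \<open>{i. X i \<le> s}\<close> and \<open>{i. X i \<le> u}\<close> for any fixed \<open>s < t < u\<close>; hence all four error rates converge to those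
  of the rule rejecting when \<open>X i \<le> t\<close>, whose mFDR is exactly \<open>\<alpha>\<close>. That this rule attains the infimum of the
  mFNR is the Neyman-Pearson lemma with likelihood ratio threshold \<open>\<kappa> = \<pi>1 f1(t) / \<pi>0\<close>: every rule with null
  and alternative rejection rates \<open>a\<close>, \<open>c\<close> satisfies \<open>c - \<kappa> a \<le> q1 - \<kappa> q0\<close>, where \<open>q0\<close>, \<open>q1\<close> are the rates of
  the threshold rule.
\<close>

section \<open>The Benjamini-Hochberg rule without order statistics\<close>

text \<open>An observation is rejected exactly when it lies at or below some critical value
  \<open>k * \<alpha> / (n * \<pi>0)\<close> with at least \<open>k\<close> observations up to it,
  that is, at or below a point where the empirical distribution function is at least \<rho> times
  the argument. The lower inclusion needs one such point \<open>s\<close>. The upper one needs the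
  failure of this at every point beyond \<open>u\<close> at once, hence the grid: empirical and true
  distribution functions are monotone, and right of \<open>u\<close> the gap between
  \<open>F\<close> and \<rho> times the argument stays away from zero. The lower bound on \<alpha>
  says that the mixture density exceeds \<rho> somewhere, the upper bound that \<rho> exceeds one;
  together they produce the crossing. For optimality the obstacle is that a competing rule may be
  randomized and may use all observations to decide on one index. Given the whole vector, the label
  \<open>i\<close> depends on entry \<open>i\<close> only, so the inequality is proved per
  coordinate with the posterior probability in place of the label. As mFNR is a quotient, this
  linear inequality is turned into a minimum by the level constraint and two slope comparisons at
  \<open>t\<close>.\<close>

definition count_le :: "nat \<Rightarrow> (nat \<Rightarrow> real) \<Rightarrow> real \<Rightarrow> nat" where
  "count_le n x t = card {i. i < n \<and> x i \<le> t}"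

text \<open>Sorting does not change how many entries are at most \<open>t\<close>, and in the sorted
  list these form an initial segment; position \<open>k\<close>, counted from 0, lies in it exactly
  when its length exceeds \<open>k\<close>.\<close>

lemma sort_nth_le_iff:
  fixes xs :: "'a::linorder list"
  assumes "k < length xs"
  shows "sort xs ! k \<le> t \<longleftrightarrow> k < length (filter (\<lambda>y. y \<le> t) xs)"
proof -
  define ys where "ys = sort xs"
  have k: "k < length ys" using assms by (simp add: ys_def)
  have mono: "ys ! i \<le> ys ! j" if "i \<le> j" "j < length ys" for i j
    using that unfolding ys_def by (intro sorted_nth_mono) auto
  have "length (filter (\<lambda>y. y \<le> t) xs) = length (filter (\<lambda>y. y \<le> t) ys)"
    by (simp add: ys_def filter_sort)
  also have "\<dots> = card {i. i < length ys \<and> ys ! i \<le> t}"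
    by (rule length_filter_conv_card)
  finally have len: "length (filter (\<lambda>y. y \<le> t) xs) = card {i. i < length ys \<and> ys ! i \<le> t}" .
  have "k < card {i. i < length ys \<and> ys ! i \<le> t}" if "ys ! k \<le> t"
  proof -
    have "card {..k} \<le> card {i. i < length ys \<and> ys ! i \<le> t}"
      by (rule card_mono) (use mono k that in \<open>auto intro: order_trans\<close>)
    then show ?thesis by simp
  qed
  moreover have "card {i. i < length ys \<and> ys ! i \<le> t} \<le> k" if "\<not> ys ! k \<le> t"
  proof -
    have "card {i. i < length ys \<and> ys ! i \<le> t} \<le> card {..<k}"
    proof (rule card_mono)
      show "{i. i < length ys \<and> ys ! i \<le> t} \<subseteq> {..<k}"
        using mono that by (auto, meson linorder_not_le order_trans)
    qed simp
    then show ?thesis by simp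
  qed
  ultimately show ?thesis unfolding len ys_def[symmetric] by linarith
qed

lemma count_le_mono: "s \<le> t \<Longrightarrow> count_le n x s \<le> count_le n x t"
  unfolding count_le_def by (rule card_mono) auto

lemma count_le_le: "count_le n x t \<le> n"
  using card_mono[of "{..<n}" "{i. i < n \<and> x i \<le> t}"] by (auto simp: count_le_def)

text \<open>The order statistic with index \<open>k\<close> sits at list position
  \<open>k - 1\<close>, which turns the strict comparison for positions into a weak one. Index 0 is
  excluded because its value 0 is a convention.\<close>

lemma order_stat_le_iff:
  assumes "0 < k" "k \<le> n"
  shows "order_stat n x k \<le> t \<longleftrightarrow> k \<le> count_le n x t"
proof -
  have "length (filter (\<lambda>y. y \<le> t) (map x [0..<n])) = count_le n x t"
    unfolding length_filter_conv_card count_le_def by (rule arg_cong[where f=card]) auto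
  then show ?thesis
    using sort_nth_le_iff[of "k - 1" "map x [0..<n]" t] assms by (auto simp: order_stat_def)
qed

text \<open>By maximality of the BH index \<open>i\<close>, exactly \<open>i\<close> of the observations lie below the \<open>i\<close>-th
  critical value, so that comparison with it is equivalent to comparison with the order statistic.\<close>

lemma BH_decision_iff:
  assumes "0 < \<pi>0" "0 \<le> \<alpha>" "j < n"
  shows "BH_decision \<pi>0 \<alpha> n x j \<longleftrightarrow>
    (\<exists>k\<le>n. k \<le> count_le n x (real k * \<alpha> / (real n * \<pi>0)) \<and> x j \<le> real k * \<alpha> / (real n * \<pi>0))"
proof -
  define T where "T k = real k * \<alpha> / (real n * \<pi>0)" for k
  have T_mono: "T k \<le> T l" if "k \<le> l" for k l
    using that assms unfolding T_def by (intro divide_right_mono mult_right_mono) auto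
  define S where "S = {i \<in> {0..n}. order_stat n x i \<le> T i}"
  \<comment> \<open>Index 0 qualifies on both sides: its order statistic and its critical value are
    both 0.\<close>
  have S_iff: "i \<in> S \<longleftrightarrow> i \<le> n \<and> i \<le> count_le n x (T i)" for i
    using order_stat_le_iff[of i n x "T i"]
    by (cases "i = 0") (auto simp: S_def order_stat_def T_def)
  define m where "m = BH_index \<pi>0 \<alpha> n x"
  have m: "m = Max S" by (simp add: m_def BH_index_def S_def T_def)
  have fin: "finite S" by (simp add: S_def)
  moreover have "0 \<in> S" by (simp add: S_iff)
  ultimately have mS: "m \<in> S" unfolding m using Max_in by blast
  have le_m: "k \<le> m" if "k \<in> S" for k unfolding m using that fin by simp
  \<comment> \<open>More than \<open>m\<close> observations up to \<open>T m\<close> would make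
    \<open>Suc m\<close> qualify too; it is at most \<open>n\<close> since no count exceeds
    \<open>n\<close>.\<close>
  have m_eq: "count_le n x (T m) = m"
  proof (rule ccontr)
    assume "count_le n x (T m) \<noteq> m"
    with mS have *: "Suc m \<le> count_le n x (T m)" by (simp add: S_iff)
    also have "\<dots> \<le> count_le n x (T (Suc m))" by (intro count_le_mono T_mono) simp
    finally have "Suc m \<in> S" using * count_le_le[of n x "T m"] by (simp add: S_iff)
    then show False using le_m by fastforce
  qed
  have "x j \<le> order_stat n x m \<longleftrightarrow> x j \<le> T m"
  proof (cases "m = 0")
    case True
    then show ?thesis by (simp add: order_stat_def T_def)
  next
    case False
    have le: "order_stat n x m \<le> T m" using mS by (simp add: S_def)
    \<comment> \<open>An observation between the order statistic and \<open>T m\<close> would be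
      counted at \<open>T m\<close> in addition to the \<open>m\<close> observations up to the order
      statistic, against \<open>m_eq\<close>.\<close>
    have "x j \<le> order_stat n x m" if "x j \<le> T m"
    proof (rule ccontr)
      assume *: "\<not> ?thesis"
      have "m \<le> count_le n x (order_stat n x m)"
        using order_stat_le_iff[of m n x "order_stat n x m"] False mS by (simp add: S_iff)
      also have "\<dots> < count_le n x (T m)"
        unfolding count_le_def
        by (rule psubset_card_mono) (use * le that assms in \<open>auto intro: order_trans\<close>)
      finally show False using m_eq by simp
    qed
    with le show ?thesis by linarith
  qed
  moreover have "x j \<le> T m \<longleftrightarrow> (\<exists>k\<in>S. x j \<le> T k)"
    using mS le_m T_mono by (meson order_trans)
  ultimately have "BH_decision \<pi>0 \<alpha> n x j \<longleftrightarrow> (\<exists>k\<in>S. x j \<le> T k)"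
    using assms by (simp add: BH_decision_def m_def)
  then show ?thesis unfolding Bex_def S_iff by (auto simp: T_def)
qed

text \<open>The witness is the count \<open>k\<close> at \<open>t\<close> itself: the hypothesis
  says that \<open>t\<close> is at most the \<open>k\<close>-th critical value, so at least
  \<open>k\<close> observations lie up to that value, \<open>x j\<close> among them.\<close>

lemma BH_decision_lower:
  assumes "0 < \<pi>0" "0 < \<alpha>" "j < n" "x j \<le> t" "t * (\<pi>0 / \<alpha>) \<le> count_le n x t / n"
  shows "BH_decision \<pi>0 \<alpha> n x j"
proof -
  let ?k = "count_le n x t"
  have *: "t \<le> real ?k * \<alpha> / (real n * \<pi>0)"
    using assms by (simp add: field_simps)
  have "?k \<le> n" by (rule count_le_le)
  moreover have "?k \<le> count_le n x (real ?k * \<alpha> / (real n * \<pi>0))" by (rule count_le_mono[OF *])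
  ultimately show ?thesis
    using assms * by (subst BH_decision_iff) (auto intro!: exI[of _ ?k])
qed

text \<open>A rejected observation beyond \<open>t\<close> would lie at or below a critical value
  \<open>s > t\<close> whose count is at least its index \<open>k\<close>; since
  \<open>s * (\<pi>0 / \<alpha>) = k / n\<close>, this contradicts the hypothesis at
  \<open>s\<close>.\<close>

lemma BH_decision_upper:
  assumes "0 < \<pi>0" "0 < \<alpha>" "j < n" "BH_decision \<pi>0 \<alpha> n x j"
    and "\<And>s. t < s \<Longrightarrow> count_le n x s / n < s * (\<pi>0 / \<alpha>)"
  shows "x j \<le> t"
proof (rule ccontr)
  assume "\<not> ?thesis"
  obtain k where k: "k \<le> n" "k \<le> count_le n x (real k * \<alpha> / (real n * \<pi>0))"
      "x j \<le> real k * \<alpha> / (real n * \<pi>0)"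
    using assms(4) BH_decision_iff[of \<pi>0 \<alpha> j n x] assms(1-3) by auto
  define s where "s = real k * \<alpha> / (real n * \<pi>0)"
  have "count_le n x s / n < s * (\<pi>0 / \<alpha>)"
    using k \<open>\<not> x j \<le> t\<close> by (intro assms) (auto simp: s_def)
  also have "\<dots> = real k / real n" using assms by (simp add: s_def)
  finally show False using k assms(3) by (simp add: s_def[symmetric] divide_less_cancel)
qed

section \<open>The two-group law\<close>

locale two_group_model =
  fixes \<pi>1 :: real and f0 f1 :: "real \<Rightarrow> real"
  assumes \<pi>1: "0 < \<pi>1" "\<pi>1 < 1" and dens0: "is_density f0" and dens1: "is_density f1"
begin

definition obs_law :: "bool \<Rightarrow> real measure" where
  "obs_law b = density lborel (if b then f1 else f0)"

abbreviation TG :: "nat \<Rightarrow> ((nat \<Rightarrow> bool) \<times> (nat \<Rightarrow> real)) measure" where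
  "TG n \<equiv> two_group \<pi>1 f0 f1 n"

abbreviation TG_space :: "nat \<Rightarrow> ((nat \<Rightarrow> bool) \<times> (nat \<Rightarrow> real)) measure" where
  "TG_space n \<equiv> count_space UNIV \<Otimes>\<^sub>M obs_space n"

text \<open>The pairs of label and observation are iid over the indices; this is integration against
  their common law, and \<open>pair_prob\<close> is the same law applied to an event.\<close>

definition pair_expectation :: "(bool \<Rightarrow> real \<Rightarrow> ennreal) \<Rightarrow> ennreal" where
  "pair_expectation u = (\<integral>\<^sup>+b. \<integral>\<^sup>+x. u b x \<partial>obs_law b \<partial>bernoulli_pmf \<pi>1)"

definition pair_prob :: "(bool \<Rightarrow> real \<Rightarrow> bool) \<Rightarrow> real" where
  "pair_prob A = \<pi>1 * measure (obs_law True) {x. A True x} + (1 - \<pi>1) * measure (obs_law False) {x. A False x}"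

lemma sets_obs_law [measurable_cong, simp]: "sets (obs_law b) = sets borel"
  by (simp add: obs_law_def)

lemma space_obs_law [simp]: "space (obs_law b) = UNIV"
  by (simp add: obs_law_def)

lemma measurable_dens [measurable]: "f0 \<in> borel_measurable borel" "f1 \<in> borel_measurable borel"
  using dens0 dens1 by (auto simp: is_density_def)

lemma dens_nonneg: "0 \<le> f0 x" "0 \<le> f1 x"
  using dens0 dens1 by (auto simp: is_density_def)

lemma prob_space_obs_law: "prob_space (obs_law b)"
  using dens0 dens1 by (intro prob_spaceI) (auto simp: obs_law_def is_density_def emeasure_density)

lemma prob_space_PiM_obs_law: "prob_space (PiM {..<n} (\<lambda>i. obs_law (\<theta> i)))"
  by (intro prob_space_PiM prob_space_obs_law)

lemma sets_PiM_obs_law [simp, measurable_cong]: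
  "sets (PiM {..<n} (\<lambda>i. obs_law (\<theta> i))) = sets (obs_space n)"
  by (intro sets_PiM_cong) auto

lemma space_PiM_obs_law [simp]:
  "space (PiM {..<n} (\<lambda>i. obs_law (\<theta> i))) = space (obs_space n)"
  by (rule sets_eq_imp_space_eq) simp

lemma two_group_eq_bind:
  "TG n = measure_pmf (labels \<pi>1 n) \<bind>
     (\<lambda>\<theta>. distr (PiM {..<n} (\<lambda>i. obs_law (\<theta> i))) (TG_space n) (Pair \<theta>))"
proof -
  have "PiM {..<n} (\<lambda>i. obs_law (\<theta> i)) \<bind> (\<lambda>x. return (TG_space n) (\<theta>, x))
      = distr (PiM {..<n} (\<lambda>i. obs_law (\<theta> i))) (TG_space n) (Pair \<theta>)" for \<theta>
    by (rule bind_return_distr') (auto simp: space_PiM)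
  then show ?thesis
    unfolding two_group_def obs_law_def[symmetric] by simp
qed

lemma measurable_two_group_kernel [measurable]:
  "(\<lambda>\<theta>. distr (PiM {..<n} (\<lambda>i. obs_law (\<theta> i))) (TG_space n) (Pair \<theta>))
     \<in> measure_pmf (labels \<pi>1 n) \<rightarrow>\<^sub>M prob_algebra (TG_space n)"
  by (auto simp: space_prob_algebra intro!: prob_space.prob_space_distr prob_space_PiM_obs_law)

lemma two_group_in_prob_algebra: "TG n \<in> space (prob_algebra (TG_space n))"
proof -
  have "measure_pmf (labels \<pi>1 n) \<in> space (prob_algebra (measure_pmf (labels \<pi>1 n)))"
    by (simp add: space_prob_algebra measure_pmf.prob_space_axioms)
  then show ?thesis
    unfolding two_group_eq_bind
    using prob_space_bind'[OF _ measurable_two_group_kernel] sets_bind'[OF _ measurable_two_group_kernel]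
    by (simp add: space_prob_algebra)
qed

lemma prob_space_two_group: "prob_space (TG n)"
  and sets_two_group [simp, measurable_cong]: "sets (TG n) = sets (TG_space n)"
  using two_group_in_prob_algebra[of n] by (auto simp: space_prob_algebra)

lemma space_two_group [simp]: "space (TG n) = UNIV \<times> space (obs_space n)"
  using sets_eq_imp_space_eq[OF sets_two_group[of n]] by (simp add: space_pair_measure)

lemma nn_integral_two_group:
  assumes [measurable]: "g \<in> borel_measurable (TG_space n)"
  shows "(\<integral>\<^sup>+\<omega>. g \<omega> \<partial>TG n) =
    (\<integral>\<^sup>+\<theta>. \<integral>\<^sup>+x. g (\<theta>, x) \<partial>PiM {..<n} (\<lambda>i. obs_law (\<theta> i)) \<partial>labels \<pi>1 n)"
  unfolding two_group_eq_bind
  by (subst nn_integral_bind[OF assms measurable_prob_algebraD[OF measurable_two_group_kernel]])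
     (simp add: nn_integral_distr)

lemma measurable_label [measurable]: "(\<lambda>\<omega>. fst \<omega> i) \<in> TG_space n \<rightarrow>\<^sub>M count_space UNIV"
  by (rule measurable_compose[OF measurable_fst]) simp

lemma measurable_obs [measurable]: "i < n \<Longrightarrow> (\<lambda>\<omega>. snd \<omega> i) \<in> TG_space n \<rightarrow>\<^sub>M borel"
  by (rule measurable_compose[OF measurable_snd]) (simp add: measurable_component_singleton)

text \<open>Given the labels the observations factor, and what remains is a product of functions of
  single labels, which factors again. All later uses of independence go through this
  identity.\<close>

lemma nn_integral_prod_two_group:
  assumes [measurable]: "\<And>i b. i < n \<Longrightarrow> u i b \<in> borel_measurable borel"
  shows "(\<integral>\<^sup>+(\<theta>, x). (\<Prod>i<n. u i (\<theta> i) (x i)) \<partial>TG n) = (\<Prod>i<n. pair_expectation (u i))"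
proof -
  have "(\<lambda>(\<theta>, x). \<Prod>i<n. u i (\<theta> i) (x i)) \<in> borel_measurable (TG_space n)"
  proof -
    \<comment> \<open>The label selects the function to be integrated; a case split on it gives a
      conditional between two measurable functions.\<close>
    have "(\<lambda>(\<theta>, x). \<Prod>i<n. u i (\<theta> i) (x i))
        = (\<lambda>\<omega>. \<Prod>i<n. if fst \<omega> i then u i True (snd \<omega> i) else u i False (snd \<omega> i))"
      by (auto intro!: prod.cong ext)
    also have "\<dots> \<in> borel_measurable (TG_space n)"
      by (intro borel_measurable_prod_ennreal measurable_If) auto
    finally show ?thesis .
  qed
  then have "(\<integral>\<^sup>+(\<theta>, x). (\<Prod>i<n. u i (\<theta> i) (x i)) \<partial>TG n)
      = (\<integral>\<^sup>+\<theta>. \<integral>\<^sup>+x. (\<Prod>i<n. u i (\<theta> i) (x i)) \<partial>PiM {..<n} (\<lambda>i. obs_law (\<theta> i)) \<partial>labels \<pi>1 n)"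
    by (simp add: nn_integral_two_group)
  also have "\<dots> = (\<integral>\<^sup>+\<theta>. (\<Prod>i<n. \<integral>\<^sup>+x. u i (\<theta> i) x \<partial>obs_law (\<theta> i)) \<partial>labels \<pi>1 n)"
  proof (intro nn_integral_cong)
    fix \<theta> :: "nat \<Rightarrow> bool"
    interpret product_sigma_finite "\<lambda>i. obs_law (\<theta> i)"
      unfolding product_sigma_finite_def
      using prob_space_obs_law prob_space_imp_sigma_finite by blast
    show "(\<integral>\<^sup>+x. (\<Prod>i<n. u i (\<theta> i) (x i)) \<partial>PiM {..<n} (\<lambda>i. obs_law (\<theta> i)))
        = (\<Prod>i<n. \<integral>\<^sup>+x. u i (\<theta> i) x \<partial>obs_law (\<theta> i))"
      by (intro product_nn_integral_prod) auto
  qed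
  also have "\<dots> = (\<Prod>i<n. pair_expectation (u i))"
    unfolding labels_def pair_expectation_def by (rule nn_integral_prod_Pi_pmf) simp
  finally show ?thesis .
qed

lemma pair_expectation_eq:
  "pair_expectation u = ennreal \<pi>1 * (\<integral>\<^sup>+x. u True x \<partial>obs_law True)
     + ennreal (1 - \<pi>1) * (\<integral>\<^sup>+x. u False x \<partial>obs_law False)"
  unfolding pair_expectation_def using \<pi>1
  by (simp add: nn_integral_measure_pmf_finite UNIV_bool mult.commute add.commute)

lemma pair_expectation_1 [simp]: "pair_expectation (\<lambda>_ _. 1) = 1"
  using prob_space.emeasure_space_1[OF prob_space_obs_law] \<pi>1
  by (simp add: pair_expectation_eq ennreal_plus[symmetric] del: ennreal_plus)

lemma pair_expectation_indicator:
  assumes [measurable]: "\<And>b. Measurable.pred borel (A b)"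
  shows "pair_expectation (\<lambda>b x. indicator {x. A b x} x) = ennreal (pair_prob A)"
proof -
  interpret prob_space "obs_law b" for b by (rule prob_space_obs_law)
  show ?thesis
    using \<pi>1
    by (simp add: pair_expectation_eq pair_prob_def emeasure_eq_measure ennreal_mult' ennreal_plus)
qed

lemma pair_prob_nonneg: "0 \<le> pair_prob A"
  using \<pi>1 by (simp add: pair_prob_def)

lemma pred_label_obs [measurable]:
  assumes [measurable]: "\<And>b. Measurable.pred borel (A b)" and "i < n"
  shows "Measurable.pred (TG_space n) (\<lambda>\<omega>. A (fst \<omega> i) (snd \<omega> i))"
proof -
  have "(\<lambda>\<omega>. A (fst \<omega> i) (snd \<omega> i)) = (\<lambda>\<omega>. if fst \<omega> i then A True (snd \<omega> i) else A False (snd \<omega> i))"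
    by (auto intro!: ext) (metis (full_types))+
  also have "Measurable.pred (TG_space n) \<dots>"
    using measurable_compose[OF measurable_obs[OF \<open>i < n\<close>] assms(1)] by measurable
  finally show ?thesis .
qed

text \<open>Coordinates outside \<open>J\<close> get the factor 1, of expectation 1. Sets
  \<open>J\<close> with one or two elements will give the first and second moments of
  counts.\<close>

lemma prob_two_group_ball:
  assumes [measurable]: "\<And>b. Measurable.pred borel (A b)" and "J \<subseteq> {..<n}"
  shows "measure (TG n) {\<omega> \<in> space (TG n). \<forall>i\<in>J. A (fst \<omega> i) (snd \<omega> i)} = pair_prob A ^ card J"
proof -
  interpret prob_space "TG n" by (rule prob_space_two_group)
  define u where "u i b x = (if i \<in> J then indicator {x. A b x} x else 1 :: ennreal)" for i b x
  have fin: "finite J" using assms finite_subset by blast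
  have J: "i < n" if "i \<in> J" for i using assms that by auto
  have m: "{\<omega> \<in> space (TG n). \<forall>i\<in>J. A (fst \<omega> i) (snd \<omega> i)} \<in> sets (TG n)"
    using fin J by measurable
  have "emeasure (TG n) {\<omega> \<in> space (TG n). \<forall>i\<in>J. A (fst \<omega> i) (snd \<omega> i)}
      = (\<integral>\<^sup>+\<omega>. indicator {\<omega> \<in> space (TG n). \<forall>i\<in>J. A (fst \<omega> i) (snd \<omega> i)} \<omega> \<partial>TG n)"
    using m by simp
  also have "\<dots> = (\<integral>\<^sup>+(\<theta>, x). (\<Prod>i<n. u i (\<theta> i) (x i)) \<partial>TG n)"
  proof (intro nn_integral_cong)
    fix \<omega> assume \<omega>: "\<omega> \<in> space (TG n)"
    have "(\<Prod>i<n. u i (fst \<omega> i) (snd \<omega> i)) = (\<Prod>i\<in>J. indicator {x. A (fst \<omega> i) x} (snd \<omega> i))"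
      by (rule prod.mono_neutral_cong_right) (use J in \<open>auto simp: u_def\<close>)
    also have "\<dots> = (if \<forall>i\<in>J. A (fst \<omega> i) (snd \<omega> i) then 1 else 0)"
      using fin by (auto simp: indicator_def intro!: prod.neutral prod_zero)
    finally show "indicator {\<omega> \<in> space (TG n). \<forall>i\<in>J. A (fst \<omega> i) (snd \<omega> i)} \<omega>
        = (case \<omega> of (\<theta>, x) \<Rightarrow> \<Prod>i<n. u i (\<theta> i) (x i))"
      using \<omega> by (auto simp: case_prod_unfold indicator_def)
  qed
  also have "\<dots> = (\<Prod>i<n. pair_expectation (u i))"
    by (rule nn_integral_prod_two_group) (auto simp: u_def)
  also have "\<dots> = (\<Prod>i\<in>J. ennreal (pair_prob A))"
  proof (rule prod.mono_neutral_cong_right)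
    show "\<forall>i\<in>{..<n} - J. pair_expectation (u i) = 1"
      by (auto simp: u_def[abs_def])
    show "pair_expectation (u i) = ennreal (pair_prob A)" if "i \<in> J" for i
      using that by (simp add: u_def[abs_def] pair_expectation_indicator)
  qed (use J in auto)
  also have "\<dots> = ennreal (pair_prob A ^ card J)"
    by (simp add: prod_constant ennreal_power pair_prob_nonneg)
  finally show ?thesis
    by (simp add: emeasure_eq_measure pair_prob_nonneg)
qed

end

section \<open>Convergence in probability and the law of large numbers\<close>

text \<open>Measurability is built in because \<open>measure\<close> is 0 on nonmeasurable sets, so
  that the limit alone could hold for want of measurability. The space may change with
  \<open>n\<close>.\<close>

definition whp :: "(nat \<Rightarrow> 'a measure) \<Rightarrow> (nat \<Rightarrow> 'a \<Rightarrow> bool) \<Rightarrow> bool" where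
  "whp N P \<longleftrightarrow> (\<forall>n. Measurable.pred (N n) (P n)) \<and>
     (\<lambda>n. measure (N n) {\<omega> \<in> space (N n). \<not> P n \<omega>}) \<longlonglongrightarrow> 0"

lemma whp_measurable: "whp N P \<Longrightarrow> Measurable.pred (N n) (P n)"
  by (simp add: whp_def)

lemma whp_mono:
  assumes N: "\<And>n. prob_space (N n)" and P: "whp N P"
    and Q: "\<And>n. Measurable.pred (N n) (Q n)"
    and PQ: "eventually (\<lambda>n. \<forall>\<omega>\<in>space (N n). P n \<omega> \<longrightarrow> Q n \<omega>) sequentially"
  shows "whp N Q"
  unfolding whp_def
proof (intro conjI allI Q)
  show "(\<lambda>n. measure (N n) {\<omega> \<in> space (N n). \<not> Q n \<omega>}) \<longlonglongrightarrow> 0"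
  proof (rule tendsto_sandwich[OF _ _ tendsto_const])
    show "eventually (\<lambda>n. measure (N n) {\<omega> \<in> space (N n). \<not> Q n \<omega>}
        \<le> measure (N n) {\<omega> \<in> space (N n). \<not> P n \<omega>}) sequentially"
      using PQ
    proof eventually_elim
      case (elim n)
      interpret prob_space "N n" by (rule N)
      have [measurable]: "Measurable.pred (N n) (P n)" using P by (rule whp_measurable)
      show ?case by (rule finite_measure_mono) (use elim in auto)
    qed
    show "(\<lambda>n. measure (N n) {\<omega> \<in> space (N n). \<not> P n \<omega>}) \<longlonglongrightarrow> 0"
      using P by (simp add: whp_def)
  qed (auto intro!: always_eventually)
qed

lemma whp_conj:
  assumes N: "\<And>n. prob_space (N n)" and P: "whp N P" and Q: "whp N Q"
  shows "whp N (\<lambda>n \<omega>. P n \<omega> \<and> Q n \<omega>)"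
  unfolding whp_def
proof (intro conjI allI)
  fix n
  have [measurable]: "Measurable.pred (N n) (P n)" "Measurable.pred (N n) (Q n)" for n
    using P Q by (auto intro: whp_measurable)
  show "Measurable.pred (N n) (\<lambda>\<omega>. P n \<omega> \<and> Q n \<omega>)" by measurable
  show "(\<lambda>n. measure (N n) {\<omega> \<in> space (N n). \<not> (P n \<omega> \<and> Q n \<omega>)}) \<longlonglongrightarrow> 0"
  proof (rule tendsto_sandwich[OF _ _ tendsto_const])
    show "eventually (\<lambda>n. measure (N n) {\<omega> \<in> space (N n). \<not> (P n \<omega> \<and> Q n \<omega>)}
        \<le> measure (N n) {\<omega> \<in> space (N n). \<not> P n \<omega>} + measure (N n) {\<omega> \<in> space (N n). \<not> Q n \<omega>}) sequentially"
    proof (intro always_eventually allI)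
      fix n
      interpret prob_space "N n" by (rule N)
      have "{\<omega> \<in> space (N n). \<not> (P n \<omega> \<and> Q n \<omega>)}
          = {\<omega> \<in> space (N n). \<not> P n \<omega>} \<union> {\<omega> \<in> space (N n). \<not> Q n \<omega>}" by auto
      then show "measure (N n) {\<omega> \<in> space (N n). \<not> (P n \<omega> \<and> Q n \<omega>)}
        \<le> measure (N n) {\<omega> \<in> space (N n). \<not> P n \<omega>} + measure (N n) {\<omega> \<in> space (N n). \<not> Q n \<omega>}"
        by (simp add: measure_Un_le)
    qed
    show "(\<lambda>n. measure (N n) {\<omega> \<in> space (N n). \<not> P n \<omega>} + measure (N n) {\<omega> \<in> space (N n). \<not> Q n \<omega>}) \<longlonglongrightarrow> 0"
      using P Q by (auto simp: whp_def intro: tendsto_add_zero)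
  qed (auto intro!: always_eventually)
qed

lemma whp_ball_finite:
  assumes N: "\<And>n. prob_space (N n)" and "finite I" and P: "\<And>i. i \<in> I \<Longrightarrow> whp N (P i)"
  shows "whp N (\<lambda>n \<omega>. \<forall>i\<in>I. P i n \<omega>)"
  using assms(2,3)
proof (induction I rule: finite_induct)
  case empty
  then show ?case by (simp add: whp_def)
next
  case (insert i I)
  then have "whp N (\<lambda>n \<omega>. P i n \<omega> \<and> (\<forall>j\<in>I. P j n \<omega>))" by (intro whp_conj N) auto
  then show ?case by simp
qed

lemma conv_in_prob_iff_whp:
  assumes "\<And>n. Y n \<in> borel_measurable (N n)"
  shows "conv_in_prob N Y c \<longleftrightarrow> (\<forall>\<epsilon>>0. whp N (\<lambda>n \<omega>. \<bar>Y n \<omega> - c\<bar> \<le> \<epsilon>))"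
  using assms by (auto simp: conv_in_prob_def whp_def not_le)

text \<open>Off the event of a deviation above \<open>r / 2\<close> the distance to \<open>c\<close>
  is at most \<open>r / 2\<close>, on it at most \<open>B + \<bar>c\<bar>\<close>, and its
  probability tends to 0. This carries limits in probability over to the expectations in mFDR and
  mFNR.\<close>

lemma conv_in_prob_expectation:
  fixes Y :: "nat \<Rightarrow> 'a \<Rightarrow> real"
  assumes N: "\<And>n. prob_space (N n)" and [measurable]: "\<And>n. Y n \<in> borel_measurable (N n)"
    and bound: "\<And>n \<omega>. \<omega> \<in> space (N n) \<Longrightarrow> \<bar>Y n \<omega>\<bar> \<le> B" and conv: "conv_in_prob N Y c"
  shows "(\<lambda>n. \<integral>\<omega>. Y n \<omega> \<partial>N n) \<longlonglongrightarrow> c"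
proof (rule LIMSEQ_I)
  fix r :: real assume "0 < r"
  define p where "p n = measure (N n) {\<omega> \<in> space (N n). \<bar>Y n \<omega> - c\<bar> > r / 2}" for n
  have B: "0 \<le> B" using bound[of _ 0] prob_space.not_empty[OF N[of 0]] by (meson abs_ge_zero ex_in_conv order_trans)
  have le: "\<bar>(\<integral>\<omega>. Y n \<omega> \<partial>N n) - c\<bar> \<le> r / 2 + (B + \<bar>c\<bar>) * p n" for n
  proof -
    interpret prob_space "N n" by (rule N)
    have [simp]: "integrable (N n) (Y n)"
      by (rule integrable_const_bound[where B=B]) (auto simp: bound)
    define S where "S = {\<omega> \<in> space (N n). \<bar>Y n \<omega> - c\<bar> > r / 2}"
    have pS: "p n = prob S" by (simp add: p_def S_def)
    have S: "S \<in> sets (N n)" unfolding S_def by measurable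
    then have [simp]: "integrable (N n) (indicat_real S)"
      by (simp add: less_top[symmetric])
    have "\<bar>(\<integral>\<omega>. Y n \<omega> \<partial>N n) - c\<bar> = \<bar>\<integral>\<omega>. Y n \<omega> - c \<partial>N n\<bar>"
      by (simp add: prob_space)
    also have "\<dots> \<le> (\<integral>\<omega>. \<bar>Y n \<omega> - c\<bar> \<partial>N n)"
      by (rule integral_abs_bound)
    also have "\<dots> \<le> (\<integral>\<omega>. r / 2 + (B + \<bar>c\<bar>) * indicator S \<omega> \<partial>N n)"
    proof (rule integral_mono)
      fix \<omega> assume "\<omega> \<in> space (N n)"
      then show "\<bar>Y n \<omega> - c\<bar> \<le> r / 2 + (B + \<bar>c\<bar>) * indicator S \<omega>"
        using bound[of \<omega> n] \<open>0 < r\<close> by (auto simp: S_def indicator_def)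
    qed auto
    also have "\<dots> = r / 2 + (B + \<bar>c\<bar>) * p n"
      using S sets.sets_into_space[OF S]
      by (subst Bochner_Integration.integral_add) (auto simp: pS prob_space Int_absorb2)
    finally show ?thesis .
  qed
  have "p \<longlonglongrightarrow> 0" using conv half_gt_zero[OF \<open>0 < r\<close>] unfolding conv_in_prob_def p_def by blast
  then have "(\<lambda>n. r / 2 + (B + \<bar>c\<bar>) * p n) \<longlonglongrightarrow> r / 2 + (B + \<bar>c\<bar>) * 0"
    by (intro tendsto_intros)
  then have "eventually (\<lambda>n. r / 2 + (B + \<bar>c\<bar>) * p n < r) sequentially"
    using \<open>0 < r\<close> by (auto elim: order_tendstoD)
  then obtain n0 where n0: "\<And>n. n \<ge> n0 \<Longrightarrow> r / 2 + (B + \<bar>c\<bar>) * p n < r"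
    by (auto simp: eventually_sequentially)
  show "\<exists>n0. \<forall>n\<ge>n0. norm ((\<integral>\<omega>. Y n \<omega> \<partial>N n) - c) < r"
  proof (intro exI allI impI)
    fix n assume "n \<ge> n0"
    from le[of n] n0[OF this] show "norm ((\<integral>\<omega>. Y n \<omega> \<partial>N n) - c) < r" by simp
  qed
qed

section \<open>Moments of counts and the weak law of large numbers\<close>

context two_group_model
begin

definition count_pairs :: "nat \<Rightarrow> (bool \<Rightarrow> real \<Rightarrow> bool) \<Rightarrow> (nat \<Rightarrow> bool) \<times> (nat \<Rightarrow> real) \<Rightarrow> real" where
  "count_pairs n A \<omega> = (\<Sum>i<n. of_bool (A (fst \<omega> i) (snd \<omega> i)))"

lemma measurable_count_pairs [measurable]:
  assumes [measurable]: "\<And>b. Measurable.pred borel (A b)"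
  shows "count_pairs n A \<in> borel_measurable (TG_space n)"
  unfolding count_pairs_def[abs_def] of_bool_def
  by (intro borel_measurable_sum measurable_If pred_label_obs) auto

lemma expectation_of_bool_ball:
  assumes [measurable]: "\<And>b. Measurable.pred borel (A b)" and "J \<subseteq> {..<n}"
  shows "(\<integral>\<omega>. of_bool (\<forall>i\<in>J. A (fst \<omega> i) (snd \<omega> i)) \<partial>TG n) = pair_prob A ^ card J"
proof -
  interpret prob_space "TG n" by (rule prob_space_two_group)
  have fin: "finite J" and J: "\<And>i. i \<in> J \<Longrightarrow> i < n" using assms finite_subset by auto
  have pred_measurable: "{\<omega> \<in> space (TG n). \<forall>i\<in>J. A (fst \<omega> i) (snd \<omega> i)} \<in> sets (TG n)"
    using fin J by measurable
  have "(\<integral>\<omega>. of_bool (\<forall>i\<in>J. A (fst \<omega> i) (snd \<omega> i)) \<partial>TG n)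
     = (\<integral>\<omega>. indicator {\<omega> \<in> space (TG n). \<forall>i\<in>J. A (fst \<omega> i) (snd \<omega> i)} \<omega> \<partial>TG n)"
    by (rule Bochner_Integration.integral_cong) (auto simp: indicator_def)
  also have "\<dots> = measure (TG n) {\<omega> \<in> space (TG n). \<forall>i\<in>J. A (fst \<omega> i) (snd \<omega> i)}"
    by (subst Bochner_Integration.integral_indicator) (use pred_measurable in \<open>auto simp del: space_two_group simp: Int_absorb1 emeasure_eq_measure sets.sets_into_space intro!: arg_cong[where f=prob]\<close>)
  finally show ?thesis using prob_two_group_ball[OF assms] by simp
qed

lemma integrable_of_bool:
  assumes [measurable]: "\<And>b. Measurable.pred borel (A b)" "\<And>b. Measurable.pred borel (B b)"
     and "i < n" "j < n"
  shows "integrable (TG n) (\<lambda>\<omega>. of_bool (A (fst \<omega> i) (snd \<omega> i)) * of_bool (B (fst \<omega> j) (snd \<omega> j)) :: real)"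
proof -
  interpret prob_space "TG n" by (rule prob_space_two_group)
  have [measurable]: "Measurable.pred (TG_space n) (\<lambda>\<omega>. A (fst \<omega> i) (snd \<omega> i))"
     "Measurable.pred (TG_space n) (\<lambda>\<omega>. B (fst \<omega> j) (snd \<omega> j))"
    using assms by (auto intro!: pred_label_obs)
  show ?thesis
    by (rule integrable_const_bound[where B=1]) (auto simp: of_bool_def)
qed

lemma expectation_count_pairs:
  assumes [measurable]: "\<And>b. Measurable.pred borel (A b)"
  shows "(\<integral>\<omega>. count_pairs n A \<omega> \<partial>TG n) = n * pair_prob A"
proof -
  have "integrable (TG n) (\<lambda>\<omega>. of_bool (A (fst \<omega> i) (snd \<omega> i)) :: real)" if "i < n" for i
    using integrable_of_bool[of A "\<lambda>_ _. True" i n i] that by simp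
  moreover have "(\<integral>\<omega>. of_bool (A (fst \<omega> i) (snd \<omega> i)) \<partial>TG n) = pair_prob A" if "i < n" for i
    using expectation_of_bool_ball[of A "{i}" n] that by simp
  ultimately show ?thesis
    unfolding count_pairs_def by (simp add: Bochner_Integration.integral_sum del: sum_of_bool_eq)
qed

lemma pair_prob_le_1:
  assumes [measurable]: "\<And>b. Measurable.pred borel (A b)"
  shows "pair_prob A \<le> 1"
proof -
  interpret prob_space "TG 1" by (rule prob_space_two_group)
  show ?thesis
    using prob_two_group_ball[of A "{0}" 1] prob_le_1[of "{\<omega> \<in> space (TG 1). \<forall>i\<in>{0}. A (fst \<omega> i) (snd \<omega> i)}"]
    by simp
qed

text \<open>Expanding the square gives \<open>p\<close> for equal and \<open>p\<^sup>2\<close> for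
  distinct indices, hence variance \<open>n * (p - p\<^sup>2)\<close>; the cruder bound
  \<open>n\<close> is enough for Chebyshev.\<close>

lemma variance_count_pairs:
  assumes [measurable]: "\<And>b. Measurable.pred borel (A b)"
  shows "(\<integral>\<omega>. (count_pairs n A \<omega> - n * pair_prob A)\<^sup>2 \<partial>TG n) \<le> n"
    and "integrable (TG n) (\<lambda>\<omega>. (count_pairs n A \<omega>)\<^sup>2)"
proof -
  interpret prob_space "TG n" by (rule prob_space_two_group)
  define p where "p = pair_prob A"
  have p: "0 \<le> p" "p \<le> 1" using pair_prob_nonneg pair_prob_le_1 assms by (auto simp: p_def)
  have sq: "(count_pairs n A \<omega>)\<^sup>2 = (\<Sum>i<n. \<Sum>j<n. of_bool (A (fst \<omega> i) (snd \<omega> i)) * of_bool (A (fst \<omega> j) (snd \<omega> j)))" for \<omega>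
    unfolding count_pairs_def power2_eq_square by (rule sum_product)
  have int_ij: "integrable (TG n) (\<lambda>\<omega>. of_bool (A (fst \<omega> i) (snd \<omega> i)) * of_bool (A (fst \<omega> j) (snd \<omega> j)) :: real)"
    if "i < n" "j < n" for i j
    using that by (intro integrable_of_bool) auto
  have int_i: "integrable (TG n) (\<lambda>\<omega>. of_bool (A (fst \<omega> i) (snd \<omega> i)) :: real)" if "i < n" for i
    using int_ij[OF that that] by (simp add: of_bool_conj[symmetric])
  have int1: "integrable (TG n) (count_pairs n A)"
    unfolding count_pairs_def[abs_def]
    by (intro Bochner_Integration.integrable_sum int_i) (simp_all only: lessThan_iff)
  show int2: "integrable (TG n) (\<lambda>\<omega>. (count_pairs n A \<omega>)\<^sup>2)"
    unfolding sq by (intro Bochner_Integration.integrable_sum int_ij) (simp_all only: lessThan_iff)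
  have E: "(\<integral>\<omega>. of_bool (A (fst \<omega> i) (snd \<omega> i)) * of_bool (A (fst \<omega> j) (snd \<omega> j)) \<partial>TG n)
      = (if i = j then p else p\<^sup>2)" if "i < n" "j < n" for i j
    using expectation_of_bool_ball[of A "{i, j}" n] that by (auto simp: p_def of_bool_conj power2_eq_square)
  have "(\<integral>\<omega>. (count_pairs n A \<omega>)\<^sup>2 \<partial>TG n) = (\<Sum>i<n. \<Sum>j<n. if i = j then p else p\<^sup>2)"
  proof -
    have "(\<integral>\<omega>. (count_pairs n A \<omega>)\<^sup>2 \<partial>TG n) = (\<Sum>i<n.
       \<integral>\<omega>. (\<Sum>j<n. of_bool (A (fst \<omega> i) (snd \<omega> i)) * of_bool (A (fst \<omega> j) (snd \<omega> j))) \<partial>TG n)"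
      unfolding sq
      by (intro Bochner_Integration.integral_sum Bochner_Integration.integrable_sum int_ij) (simp_all only: lessThan_iff)
    also have "\<dots> = (\<Sum>i<n. \<Sum>j<n.
       \<integral>\<omega>. of_bool (A (fst \<omega> i) (snd \<omega> i)) * of_bool (A (fst \<omega> j) (snd \<omega> j)) \<partial>TG n)"
      by (intro sum.cong refl Bochner_Integration.integral_sum int_ij) (simp_all only: lessThan_iff)
    also have "\<dots> = (\<Sum>i<n. \<Sum>j<n. if i = j then p else p\<^sup>2)"
      by (intro sum.cong refl E) auto
    finally show ?thesis .
  qed
  also have "\<dots> = (\<Sum>i<n. \<Sum>j<n. p\<^sup>2 + (if i = j then p - p\<^sup>2 else 0))"
    by (intro sum.cong) auto
  also have "\<dots> = (\<Sum>i<n. n * p\<^sup>2 + (p - p\<^sup>2))"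
    by (intro sum.cong) (auto simp: sum.distrib)
  also have "\<dots> = (n * p)\<^sup>2 + n * (p - p\<^sup>2)"
    by (simp add: power2_eq_square algebra_simps)
  finally have "variance (count_pairs n A) = n * (p - p\<^sup>2)"
    using variance_eq[OF int1 int2] by (simp add: expectation_count_pairs p_def)
  also have "\<dots> \<le> real n * 1"
    using p zero_le_power2[of p] by (intro mult_left_mono) linarith+
  finally show "(\<integral>\<omega>. (count_pairs n A \<omega> - n * pair_prob A)\<^sup>2 \<partial>TG n) \<le> n"
    by (simp add: expectation_count_pairs)
qed

text \<open>Chebyshev at distance \<open>\<epsilon> * n\<close> with variance at most
  \<open>n\<close> bounds the probability of a deviation by
  \<open>1 / (\<epsilon>\<^sup>2 * n)\<close>.\<close>

lemma count_pairs_lln: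
  assumes [measurable]: "\<And>b. Measurable.pred borel (A b)"
  shows "conv_in_prob TG (\<lambda>n \<omega>. count_pairs n A \<omega> / n) (pair_prob A)"
  unfolding conv_in_prob_def
proof (intro allI impI)
  fix \<epsilon> :: real assume "0 < \<epsilon>"
  show "(\<lambda>n. measure (TG n) {\<omega> \<in> space (TG n). \<bar>count_pairs n A \<omega> / n - pair_prob A\<bar> > \<epsilon>}) \<longlonglongrightarrow> 0"
  proof (rule tendsto_sandwich[OF _ _ tendsto_const])
    show "eventually (\<lambda>n. measure (TG n) {\<omega> \<in> space (TG n). \<bar>count_pairs n A \<omega> / n - pair_prob A\<bar> > \<epsilon>}
       \<le> 1 / \<epsilon>\<^sup>2 * (1 / n)) sequentially"
      using eventually_gt_at_top[of "0::nat"]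
    proof eventually_elim
      case (elim n)
      interpret prob_space "TG n" by (rule prob_space_two_group)
      have "measure (TG n) {\<omega> \<in> space (TG n). \<bar>count_pairs n A \<omega> / n - pair_prob A\<bar> > \<epsilon>}
         \<le> measure (TG n) {\<omega> \<in> space (TG n). \<bar>count_pairs n A \<omega> - n * pair_prob A\<bar> \<ge> \<epsilon> * n}"
      proof (rule finite_measure_mono)
        have "\<bar>count_pairs n A \<omega> / n - pair_prob A\<bar> = \<bar>count_pairs n A \<omega> - n * pair_prob A\<bar> / n" for \<omega>
        proof -
          have "count_pairs n A \<omega> / n - pair_prob A = (count_pairs n A \<omega> - n * pair_prob A) / n"
            using elim by (simp add: field_simps)
          then show ?thesis by simp
        qed
        then show "{\<omega> \<in> space (TG n). \<bar>count_pairs n A \<omega> / n - pair_prob A\<bar> > \<epsilon>}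
           \<subseteq> {\<omega> \<in> space (TG n). \<bar>count_pairs n A \<omega> - n * pair_prob A\<bar> \<ge> \<epsilon> * n}"
          using elim by (auto simp: field_simps)
      qed measurable
      also have "\<dots> \<le> (\<integral>\<omega>. (count_pairs n A \<omega> - n * pair_prob A)\<^sup>2 \<partial>TG n) / (\<epsilon> * n)\<^sup>2"
        using Chebyshev_inequality[of "count_pairs n A" "\<epsilon> * n"] variance_count_pairs(2)[of A n] elim \<open>0 < \<epsilon>\<close>
        by (simp add: expectation_count_pairs)
      also have "\<dots> \<le> n / (\<epsilon> * n)\<^sup>2"
        by (intro divide_right_mono variance_count_pairs) auto
      also have "\<dots> = 1 / \<epsilon>\<^sup>2 * (1 / n)"
        using elim \<open>0 < \<epsilon>\<close> by (simp add: power2_eq_square field_simps)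
      finally show ?case .
    qed
    show "(\<lambda>n. 1 / \<epsilon>\<^sup>2 * (1 / real n)) \<longlonglongrightarrow> 0"
      by (intro tendsto_mult_right_zero lim_1_over_n)
  qed (auto intro!: always_eventually)
qed

end

section \<open>Posterior probabilities and the Neyman-Pearson inequality\<close>

text \<open>Here \<open>x\<close> and \<open>y\<close> will be the probabilities of a missed
  alternative and of an accepted null, so that the quotient is the mFNR. Right of \<open>y0\<close>
  the line of slope \<kappa> through \<open>(y0, x0)\<close> is at least as steep as the ray from
  the origin, because \<open>x0 \<le> \<kappa> * y0\<close>; left of it \<open>x0 \<le> x\<close> is
  enough. Both cases give \<open>x0 * y \<le> x * y0\<close>.\<close>

lemma ratio_mono_of_slope:
  fixes x y x0 y0 \<kappa> :: real
  assumes "0 \<le> x" "0 \<le> y" "0 < x + y" "0 \<le> x0" "0 \<le> y0" "0 < x0 + y0" "x0 \<le> \<kappa> * y0"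
    and "y0 \<le> y \<Longrightarrow> x0 + \<kappa> * (y - y0) \<le> x" "y < y0 \<Longrightarrow> x0 \<le> x"
  shows "x0 / (x0 + y0) \<le> x / (x + y)"
proof -
  have "x0 * y \<le> x * y0"
  proof (cases "y0 \<le> y")
    case True
    have "x0 * y = x0 * y0 + x0 * (y - y0)" by (simp add: algebra_simps)
    also have "\<dots> \<le> x0 * y0 + (\<kappa> * y0) * (y - y0)"
      using True assms by (intro add_left_mono mult_right_mono) auto
    also have "\<dots> = (x0 + \<kappa> * (y - y0)) * y0" by (simp add: algebra_simps)
    also have "\<dots> \<le> x * y0" using True assms by (intro mult_right_mono) auto
    finally show ?thesis .
  next
    case False
    then have "x0 * y \<le> x0 * y0" using assms by (intro mult_left_mono) auto
    also have "\<dots> \<le> x * y0" using False assms by (intro mult_right_mono) auto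
    finally show ?thesis .
  qed
  then have "x0 * (x + y) \<le> x * (x0 + y0)" by (simp add: algebra_simps)
  then show ?thesis using assms by (simp add: field_simps)
qed

text \<open>The decision space is finite and discrete, so singletons suffice, and equality with a
  fixed vector is a conjunction over \<open>i < n\<close> because both sides are
  extensional.\<close>

lemma measurable_decision:
  assumes [measurable]: "\<And>i. i < n \<Longrightarrow> Measurable.pred M (\<lambda>x. \<delta> x i)"
    and ext: "\<And>x. \<delta> x \<in> {..<n} \<rightarrow>\<^sub>E UNIV"
  shows "\<delta> \<in> M \<rightarrow>\<^sub>M decision_space n"
proof (subst measurable_count_space_eq2)
  show "finite ({..<n} \<rightarrow>\<^sub>E (UNIV :: bool set))" by (intro finite_PiE) auto
  show "\<delta> \<in> space M \<rightarrow> {..<n} \<rightarrow>\<^sub>E UNIV \<and> (\<forall>a\<in>{..<n} \<rightarrow>\<^sub>E UNIV. \<delta> -` {a} \<inter> space M \<in> sets M)"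
  proof (intro conjI ballI)
    show "\<delta> \<in> space M \<rightarrow> {..<n} \<rightarrow>\<^sub>E UNIV" using ext by blast
    fix a :: "nat \<Rightarrow> bool" assume a: "a \<in> {..<n} \<rightarrow>\<^sub>E UNIV"
    have "\<delta> x = a \<longleftrightarrow> (\<forall>i\<in>{..<n}. \<delta> x i = a i)" for x
      using PiE_ext[OF ext a, of x] by auto
    then have "\<delta> -` {a} \<inter> space M = {x \<in> space M. \<forall>i\<in>{..<n}. \<delta> x i = a i}"
      by auto
    also have "\<dots> \<in> sets M" by measurable
    finally show "\<delta> -` {a} \<inter> space M \<in> sets M" .
  qed
qed

section \<open>Bayes' rule and the pointwise optimal rejection region\<close>

context two_group_model
begin

text \<open>Conditional probability of label 1 given the observation \<open>x\<close>, with value 0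
  where the mixture density vanishes; elsewhere \<open>1 - posterior x\<close> is the share of the
  null term in the mixture density.\<close>

definition posterior :: "real \<Rightarrow> real" where
  "posterior x = \<pi>1 * f1 x / (\<pi>1 * f1 x + (1 - \<pi>1) * f0 x)"

lemma posterior_measurable [measurable]: "posterior \<in> borel_measurable borel"
  unfolding posterior_def[abs_def] by measurable

lemma posterior_nonneg: "0 \<le> posterior x" and posterior_le_1: "posterior x \<le> 1"
proof -
  have "0 \<le> \<pi>1 * f1 x" "0 \<le> (1 - \<pi>1) * f0 x" using \<pi>1 dens_nonneg[of x] by auto
  then show "0 \<le> posterior x" "posterior x \<le> 1" by (auto simp: posterior_def divide_le_eq_1)
qed

text \<open>Where the mixture density vanishes both of its nonnegative terms do, so the identity
  survives the division by zero.\<close>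

lemma posterior_mult: "posterior x * (\<pi>1 * f1 x + (1 - \<pi>1) * f0 x) = \<pi>1 * f1 x"
proof -
  have "0 \<le> \<pi>1 * f1 x" "0 \<le> (1 - \<pi>1) * f0 x" using \<pi>1 dens_nonneg[of x] by auto
  then show ?thesis by (auto simp: posterior_def add_nonneg_eq_0_iff)
qed

text \<open>Bayes' rule for one pair: summing over the label leaves the mixture density, and the
  posterior times that density is \<open>\<pi>1 * f1\<close>.\<close>

lemma pair_expectation_posterior:
  assumes [measurable]: "h \<in> borel_measurable borel"
  shows "pair_expectation (\<lambda>b x. h x * (if b then 1 else 0)) = pair_expectation (\<lambda>b x. h x * ennreal (posterior x))"
proof -
  have *: "h x * ennreal (posterior x) * (ennreal \<pi>1 * ennreal (f1 x) + ennreal (1 - \<pi>1) * ennreal (f0 x))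
      = h x * (ennreal \<pi>1 * ennreal (f1 x))" for x
  proof -
    have "ennreal (posterior x) * (ennreal \<pi>1 * ennreal (f1 x) + ennreal (1 - \<pi>1) * ennreal (f0 x))
        = ennreal (posterior x * (\<pi>1 * f1 x + (1 - \<pi>1) * f0 x))"
      using \<pi>1 dens_nonneg[of x] posterior_nonneg[of x]
      by (simp add: ennreal_mult[symmetric] ennreal_plus[symmetric] del: ennreal_plus)
    also have "\<dots> = ennreal \<pi>1 * ennreal (f1 x)"
      using \<pi>1 dens_nonneg[of x] by (simp add: posterior_mult ennreal_mult)
    finally show ?thesis by (simp add: mult.assoc)
  qed
  have "pair_expectation (\<lambda>b x. h x * ennreal (posterior x))
      = (\<integral>\<^sup>+x. ennreal \<pi>1 * (ennreal (f1 x) * (h x * ennreal (posterior x)))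
          + ennreal (1 - \<pi>1) * (ennreal (f0 x) * (h x * ennreal (posterior x))) \<partial>lborel)"
    by (simp add: pair_expectation_eq obs_law_def nn_integral_density nn_integral_add nn_integral_cmult)
  also have "\<dots> = (\<integral>\<^sup>+x. h x * (ennreal \<pi>1 * ennreal (f1 x)) \<partial>lborel)"
    by (intro nn_integral_cong, subst *[symmetric]) (simp add: algebra_simps)
  also have "\<dots> = (\<integral>\<^sup>+x. ennreal \<pi>1 * (ennreal (f1 x) * h x) \<partial>lborel)"
    by (simp add: mult_ac)
  also have "\<dots> = pair_expectation (\<lambda>b x. h x * (if b then 1 else 0))"
    by (simp add: pair_expectation_eq obs_law_def nn_integral_density nn_integral_cmult)
  finally show ?thesis by simp
qed

text \<open>A weight depending on the \<open>i\<close>-th pair alone changes only the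
  \<open>i\<close>-th factor, so the weighted law of the observations is still a product on
  boxes.\<close>

lemma emeasure_weighted_obs:
  assumes [measurable]: "\<And>b. w b \<in> borel_measurable borel" and i: "i < n"
    and A: "\<And>j. j \<in> {..<n} \<Longrightarrow> A j \<in> sets borel"
  shows "emeasure (distr (density (TG n) (\<lambda>\<omega>. w (fst \<omega> i) (snd \<omega> i))) (obs_space n) snd) (Pi\<^sub>E {..<n} A)
    = (\<Prod>j<n. pair_expectation (\<lambda>b x. indicator (A j) x * (if j = i then w b x else 1)))"
proof -
  have [measurable]: "(\<lambda>\<omega>. w (fst \<omega> i) (snd \<omega> i)) \<in> borel_measurable (TG_space n)"
  proof -
    have "(\<lambda>\<omega>. w (fst \<omega> i) (snd \<omega> i)) = (\<lambda>\<omega>. if fst \<omega> i then w True (snd \<omega> i) else w False (snd \<omega> i))"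
      by auto
    also have "\<dots> \<in> borel_measurable (TG_space n)"
      using i by (intro measurable_If) auto
    finally show ?thesis .
  qed
  have PiE [measurable]: "Pi\<^sub>E {..<n} A \<in> sets (obs_space n)"
    using A by (intro sets_PiM_I_finite) auto
  have snd: "snd \<in> density (TG n) (\<lambda>\<omega>. w (fst \<omega> i) (snd \<omega> i)) \<rightarrow>\<^sub>M obs_space n"
    by measurable
  have "emeasure (distr (density (TG n) (\<lambda>\<omega>. w (fst \<omega> i) (snd \<omega> i))) (obs_space n) snd) (Pi\<^sub>E {..<n} A)
     = (\<integral>\<^sup>+\<omega>. w (fst \<omega> i) (snd \<omega> i) * indicator (snd -` Pi\<^sub>E {..<n} A \<inter> space (TG n)) \<omega> \<partial>TG n)"
    by (subst emeasure_distr[OF snd PiE], subst emeasure_density) measurable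
  also have "\<dots> = (\<integral>\<^sup>+(\<theta>, x). (\<Prod>j<n. indicator (A j) (x j) * (if j = i then w (\<theta> j) (x j) else 1)) \<partial>TG n)"
  proof (intro nn_integral_cong)
    fix \<omega> assume \<omega>: "\<omega> \<in> space (TG n)"
    have "(\<Prod>j<n. indicator (A j) (snd \<omega> j) * (if j = i then w (fst \<omega> j) (snd \<omega> j) else 1))
      = (\<Prod>j<n. indicator (A j) (snd \<omega> j)) * w (fst \<omega> i) (snd \<omega> i)"
      using i by (simp add: prod.distrib prod.delta)
    also have "(\<Prod>j<n. indicator (A j) (snd \<omega> j)) = (if \<forall>j<n. snd \<omega> j \<in> A j then 1 else 0 :: ennreal)"
      by (auto simp: indicator_def intro!: prod.neutral prod_zero)
    finally show "w (fst \<omega> i) (snd \<omega> i) * indicator (snd -` Pi\<^sub>E {..<n} A \<inter> space (TG n)) \<omega>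
      = (case \<omega> of (\<theta>, x) \<Rightarrow> \<Prod>j<n. indicator (A j) (x j) * (if j = i then w (\<theta> j) (x j) else 1))"
      using \<omega> by (auto simp: case_prod_unfold indicator_def space_PiM PiE_iff)
  qed
  also have "\<dots> = (\<Prod>j<n. pair_expectation (\<lambda>b x. indicator (A j) x * (if j = i then w b x else 1)))"
    using A by (intro nn_integral_prod_two_group) auto
  finally show ?thesis .
qed

text \<open>A decision about \<open>i\<close> may use the whole observation vector, so
  \<open>h\<close> is a function of all of it. By independence the conditional probability of label
  \<open>i\<close> given the vector depends on entry \<open>i\<close> only; this is shown by
  identifying two weighted laws of the vector, one with the label and one with the posterior as
  weight.\<close>

lemma nn_integral_label:
  assumes i: "i < n" and [measurable]: "h \<in> borel_measurable (obs_space n)"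
  shows "(\<integral>\<^sup>+\<omega>. (if fst \<omega> i then 1 else 0) * h (snd \<omega>) \<partial>TG n)
    = (\<integral>\<^sup>+\<omega>. ennreal (posterior (snd \<omega> i)) * h (snd \<omega>) \<partial>TG n)"
proof -
  define \<mu> where "\<mu> w = distr (density (TG n) (\<lambda>\<omega>. w (fst \<omega> i) (snd \<omega> i))) (obs_space n) snd"
    for w :: "bool \<Rightarrow> real \<Rightarrow> ennreal"
  define w1 :: "bool \<Rightarrow> real \<Rightarrow> ennreal" where "w1 b x = (if b then 1 else 0)" for b x
  define w2 :: "bool \<Rightarrow> real \<Rightarrow> ennreal" where "w2 b x = ennreal (posterior x)" for b x
  note obs_i [measurable] = measurable_obs[OF i]
  have w [measurable]: "w1 b \<in> borel_measurable borel" "w2 b \<in> borel_measurable borel" for b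
    by (auto simp: w1_def[abs_def] w2_def[abs_def])
  \<comment> \<open>By independence both measures are products on boxes, so they agree there by Bayes' rule in one coordinate.\<close>
  have eq: "\<mu> w1 = \<mu> w2"
  proof (rule measure_eqI_PiM_finite[where I="{..<n}" and M="\<lambda>_. borel"
        and A="\<lambda>_. Pi\<^sub>E {..<n} (\<lambda>_. UNIV)"])
    fix A :: "nat \<Rightarrow> real set" assume A: "\<And>j. j \<in> {..<n} \<Longrightarrow> A j \<in> sets borel"
    have "pair_expectation (\<lambda>b x. indicator (A j) x * (if j = i then w1 b x else 1))
        = pair_expectation (\<lambda>b x. indicator (A j) x * (if j = i then w2 b x else 1))" if "j < n" for j
    proof (cases "j = i")
      case True
      then show ?thesis
        using pair_expectation_posterior[of "indicator (A j)"] A that by (simp add: w1_def w2_def)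
    qed simp
    then have "(\<Prod>j<n. pair_expectation (\<lambda>b x. indicator (A j) x * (if j = i then w1 b x else 1)))
        = (\<Prod>j<n. pair_expectation (\<lambda>b x. indicator (A j) x * (if j = i then w2 b x else 1)))"
      by (intro prod.cong refl) (simp only: lessThan_iff)
    then show "\<mu> w1 (Pi\<^sub>E {..<n} A) = \<mu> w2 (Pi\<^sub>E {..<n} A)"
      using emeasure_weighted_obs[of w1 i n A, OF w(1) i A] emeasure_weighted_obs[of w2 i n A, OF w(2) i A]
      unfolding \<mu>_def by (simp only:)
  next
    \<comment> \<open>Uniqueness from the values on boxes needs a cover by boxes of finite mass; the
      full box, of mass at most 1, serves.\<close>
    show "\<mu> w1 (Pi\<^sub>E {..<n} (\<lambda>_. UNIV)) \<noteq> \<infinity>"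
    proof -
      interpret prob_space "TG n" by (rule prob_space_two_group)
      have "\<mu> w1 (Pi\<^sub>E {..<n} (\<lambda>_. UNIV)) = (\<integral>\<^sup>+\<omega>. (if fst \<omega> i then 1 else 0) \<partial>TG n)"
      proof -
        have "\<mu> w1 (Pi\<^sub>E {..<n} (\<lambda>_. UNIV)) = emeasure (density (TG n) (\<lambda>\<omega>. w1 (fst \<omega> i) (snd \<omega> i))) (space (TG n))"
          unfolding \<mu>_def by (subst emeasure_distr) (auto simp: space_PiM intro!: arg_cong2[where f=emeasure])
        also have "\<dots> = (\<integral>\<^sup>+\<omega>. (if fst \<omega> i then 1 else 0) \<partial>TG n)"
          by (subst emeasure_density) (auto simp: w1_def intro!: nn_integral_cong simp del: space_two_group sets_two_group)
        finally show ?thesis .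
      qed
      also have "\<dots> \<le> (\<integral>\<^sup>+\<omega>. 1 \<partial>TG n)" by (intro nn_integral_mono) auto
      also have "\<dots> = 1" using emeasure_space_1 by simp
      finally show ?thesis by (auto simp: top_unique)
    qed
    show "range (\<lambda>_::nat. Pi\<^sub>E {..<n} (\<lambda>_. UNIV :: real set)) \<subseteq> prod_algebra {..<n} (\<lambda>_. borel)"
      by (intro image_subsetI prod_algebraI_finite) simp_all
    show "(\<Union>i::nat. Pi\<^sub>E {..<n} (\<lambda>_. UNIV :: real set)) = space (obs_space n)"
      by (simp add: space_PiM)
  qed (simp_all add: \<mu>_def)
  have tr: "(\<integral>\<^sup>+x. h x \<partial>\<mu> w) = (\<integral>\<^sup>+\<omega>. w (fst \<omega> i) (snd \<omega> i) * h (snd \<omega>) \<partial>TG n)"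
    if m: "(\<lambda>\<omega>. w (fst \<omega> i) (snd \<omega> i)) \<in> borel_measurable (TG n)" for w
  proof -
    have snd: "snd \<in> TG n \<rightarrow>\<^sub>M obs_space n" by measurable
    then have "(\<integral>\<^sup>+x. h x \<partial>\<mu> w)
        = (\<integral>\<^sup>+\<omega>. h (snd \<omega>) \<partial>density (TG n) (\<lambda>\<omega>. w (fst \<omega> i) (snd \<omega> i)))"
      unfolding \<mu>_def by (intro nn_integral_distr) simp_all
    also have "\<dots> = (\<integral>\<^sup>+\<omega>. w (fst \<omega> i) (snd \<omega> i) * h (snd \<omega>) \<partial>TG n)"
      by (rule nn_integral_density[OF m measurable_compose[OF snd assms(2)]])
    finally show ?thesis .
  qed
  have m1: "(\<lambda>\<omega>. w1 (fst \<omega> i) (snd \<omega> i)) \<in> borel_measurable (TG n)"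
    unfolding w1_def by measurable
  have m2: "(\<lambda>\<omega>. w2 (fst \<omega> i) (snd \<omega> i)) \<in> borel_measurable (TG n)"
    unfolding w2_def by measurable
  from eq have "(\<integral>\<^sup>+\<omega>. w1 (fst \<omega> i) (snd \<omega> i) * h (snd \<omega>) \<partial>TG n)
      = (\<integral>\<^sup>+\<omega>. w2 (fst \<omega> i) (snd \<omega> i) * h (snd \<omega>) \<partial>TG n)"
    by (simp only: tr[of w1, OF m1, symmetric] tr[of w2, OF m2, symmetric])
  then show ?thesis unfolding w1_def w2_def .
qed

lemma expectation_label:
  assumes i: "i < n" and [measurable]: "h \<in> borel_measurable (obs_space n)"
    and h: "\<And>x. 0 \<le> h x"
  shows "(\<integral>\<omega>. h (snd \<omega>) * of_bool (fst \<omega> i) \<partial>TG n) = (\<integral>\<omega>. h (snd \<omega>) * posterior (snd \<omega> i) \<partial>TG n)"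
proof -
  note obs_i [measurable] = measurable_obs[OF i]
  have "(\<integral>\<^sup>+\<omega>. ennreal (h (snd \<omega>) * of_bool (fst \<omega> i)) \<partial>TG n)
      = (\<integral>\<^sup>+\<omega>. (if fst \<omega> i then 1 else 0) * ennreal (h (snd \<omega>)) \<partial>TG n)"
    by (intro nn_integral_cong) auto
  also have "\<dots> = (\<integral>\<^sup>+\<omega>. ennreal (h (snd \<omega>) * posterior (snd \<omega> i)) \<partial>TG n)"
    using h posterior_nonneg nn_integral_label[OF i, of "\<lambda>x. ennreal (h x)"]
    by (simp add: ennreal_mult mult.commute)
  finally show ?thesis
    using h posterior_nonneg
    by (subst (1 2) integral_eq_nn_integral) (auto simp: of_bool_def)
qed

text \<open>With the posterior in place of the label both sides are integrals of a function with
  values between 0 and 1 times \<open>posterior - \<kappa> * (1 - posterior)\<close>. This factor is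
  nonnegative on \<open>S\<close> and nonpositive off it, so the indicator of \<open>S\<close> is
  the pointwise best choice, even against functions of all observations.\<close>

lemma neyman_pearson:
  assumes i: "i < n" and [measurable]: "h \<in> borel_measurable (obs_space n)"
    and h: "\<And>x. 0 \<le> h x" "\<And>x. h x \<le> 1"
    and [measurable]: "S \<in> sets borel"
    and S: "\<And>x. x \<in> S \<Longrightarrow> \<kappa> * (1 - posterior x) \<le> posterior x"
      "\<And>x. x \<notin> S \<Longrightarrow> posterior x \<le> \<kappa> * (1 - posterior x)"
  shows "(\<integral>\<omega>. h (snd \<omega>) * of_bool (fst \<omega> i) \<partial>TG n) - \<kappa> * (\<integral>\<omega>. h (snd \<omega>) * of_bool (\<not> fst \<omega> i) \<partial>TG n)
    \<le> pair_prob (\<lambda>b x. b \<and> x \<in> S) - \<kappa> * pair_prob (\<lambda>b x. \<not> b \<and> x \<in> S)"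
proof -
  interpret prob_space "TG n" by (rule prob_space_two_group)
  note obs_i [measurable] = measurable_obs[OF i]
  \<comment> \<open>Stated for a general \<open>g\<close>, since it is applied both to
    \<open>h\<close> and to the indicator of \<open>S\<close>.\<close>
  have eq: "(\<integral>\<omega>. g (snd \<omega>) * of_bool (fst \<omega> i) \<partial>TG n) - \<kappa> * (\<integral>\<omega>. g (snd \<omega>) * of_bool (\<not> fst \<omega> i) \<partial>TG n)
      = (\<integral>\<omega>. g (snd \<omega>) * (posterior (snd \<omega> i) - \<kappa> * (1 - posterior (snd \<omega> i))) \<partial>TG n)"
    and int: "integrable (TG n) (\<lambda>\<omega>. g (snd \<omega>) * (posterior (snd \<omega> i) - \<kappa> * (1 - posterior (snd \<omega> i))))"
    if gm [measurable]: "g \<in> borel_measurable (obs_space n)" and g: "\<And>x. 0 \<le> g x" "\<And>x. g x \<le> 1" for g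
  proof -
    have i1: "integrable (TG n) (\<lambda>\<omega>. g (snd \<omega>))"
      by (rule integrable_const_bound[where B=1]) (use g in \<open>auto simp: abs_of_nonneg\<close>)
    have i2: "integrable (TG n) (\<lambda>\<omega>. g (snd \<omega>) * of_bool (fst \<omega> i))"
      by (rule integrable_const_bound[where B=1]) (use g in \<open>auto simp: abs_of_nonneg of_bool_def\<close>)
    have i3: "integrable (TG n) (\<lambda>\<omega>. g (snd \<omega>) * posterior (snd \<omega> i))"
      by (rule integrable_const_bound[where B=1])
        (use g posterior_nonneg posterior_le_1 in \<open>auto simp: abs_of_nonneg intro!: mult_le_one\<close>)
    have "(\<integral>\<omega>. g (snd \<omega>) * of_bool (\<not> fst \<omega> i) \<partial>TG n)
        = (\<integral>\<omega>. g (snd \<omega>) - g (snd \<omega>) * of_bool (fst \<omega> i) \<partial>TG n)"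
      by (rule Bochner_Integration.integral_cong) (auto simp: of_bool_def)
    also have "\<dots> = (\<integral>\<omega>. g (snd \<omega>) \<partial>TG n) - (\<integral>\<omega>. g (snd \<omega>) * posterior (snd \<omega> i) \<partial>TG n)"
      using i1 i2 by (simp add: expectation_label[OF i gm g(1)])
    finally have n: "(\<integral>\<omega>. g (snd \<omega>) * of_bool (\<not> fst \<omega> i) \<partial>TG n) = \<dots>" .
    have f: "g (snd \<omega>) * (posterior (snd \<omega> i) - \<kappa> * (1 - posterior (snd \<omega> i)))
        = g (snd \<omega>) * posterior (snd \<omega> i) - \<kappa> * (g (snd \<omega>) - g (snd \<omega>) * posterior (snd \<omega> i))" for \<omega>
      by (simp add: algebra_simps)
    show "integrable (TG n) (\<lambda>\<omega>. g (snd \<omega>) * (posterior (snd \<omega> i) - \<kappa> * (1 - posterior (snd \<omega> i))))"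
      unfolding f using i1 i3 by simp
    show "(\<integral>\<omega>. g (snd \<omega>) * of_bool (fst \<omega> i) \<partial>TG n) - \<kappa> * (\<integral>\<omega>. g (snd \<omega>) * of_bool (\<not> fst \<omega> i) \<partial>TG n)
      = (\<integral>\<omega>. g (snd \<omega>) * (posterior (snd \<omega> i) - \<kappa> * (1 - posterior (snd \<omega> i))) \<partial>TG n)"
      unfolding f n using i1 i3 by (simp add: expectation_label[OF i gm g(1)])
  qed
  define g where "g x = (indicator S (x i) :: real)" for x :: "nat \<Rightarrow> real"
  have gm [measurable]: "g \<in> borel_measurable (obs_space n)"
  proof -
    have [measurable]: "(\<lambda>x. x i) \<in> obs_space n \<rightarrow>\<^sub>M borel"
      using i by (intro measurable_component_singleton) simp
    show ?thesis unfolding g_def[abs_def] by measurable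
  qed
  have g01: "0 \<le> g x" "g x \<le> 1" for x by (auto simp: g_def indicator_def)
  have "(\<integral>\<omega>. h (snd \<omega>) * of_bool (fst \<omega> i) \<partial>TG n) - \<kappa> * (\<integral>\<omega>. h (snd \<omega>) * of_bool (\<not> fst \<omega> i) \<partial>TG n)
     \<le> (\<integral>\<omega>. g (snd \<omega>) * of_bool (fst \<omega> i) \<partial>TG n) - \<kappa> * (\<integral>\<omega>. g (snd \<omega>) * of_bool (\<not> fst \<omega> i) \<partial>TG n)"
    unfolding eq[OF assms(2) h] eq[OF gm g01]
  proof (rule integral_mono[OF int[OF assms(2) h] int[OF gm g01]])
    fix \<omega>
    let ?p = "posterior (snd \<omega> i) - \<kappa> * (1 - posterior (snd \<omega> i))"
    show "h (snd \<omega>) * ?p \<le> g (snd \<omega>) * ?p"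
    proof (cases "snd \<omega> i \<in> S")
      case True
      then have "0 \<le> ?p" using S(1) by simp
      then show ?thesis using True h by (intro mult_right_mono) (auto simp: g_def)
    next
      case False
      then have "?p \<le> 0" using S(2) by simp
      then show ?thesis using False h[of "snd \<omega>"] by (auto simp: g_def mult_nonneg_nonpos)
    qed
  qed
  also have "(\<integral>\<omega>. g (snd \<omega>) * of_bool (fst \<omega> i) \<partial>TG n) = pair_prob (\<lambda>b x. b \<and> x \<in> S)"
  proof -
    have "(\<integral>\<omega>. g (snd \<omega>) * of_bool (fst \<omega> i) \<partial>TG n) = (\<integral>\<omega>. of_bool (\<forall>j\<in>{i}. fst \<omega> j \<and> snd \<omega> j \<in> S) \<partial>TG n)"
      by (rule Bochner_Integration.integral_cong) (auto simp: g_def)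
    also have "\<dots> = pair_prob (\<lambda>b x. b \<and> x \<in> S)"
      using i by (subst expectation_of_bool_ball) auto
    finally show ?thesis .
  qed
  also have "(\<integral>\<omega>. g (snd \<omega>) * of_bool (\<not> fst \<omega> i) \<partial>TG n) = pair_prob (\<lambda>b x. \<not> b \<and> x \<in> S)"
  proof -
    have "(\<integral>\<omega>. g (snd \<omega>) * of_bool (\<not> fst \<omega> i) \<partial>TG n) = (\<integral>\<omega>. of_bool (\<forall>j\<in>{i}. \<not> fst \<omega> j \<and> snd \<omega> j \<in> S) \<partial>TG n)"
      by (rule Bochner_Integration.integral_cong) (auto simp: g_def)
    also have "\<dots> = pair_prob (\<lambda>b x. \<not> b \<and> x \<in> S)"
      using i by (subst expectation_of_bool_ball) auto
    finally show ?thesis .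
  qed
  finally show ?thesis .
qed

end

section \<open>Decision rules\<close>

context two_group_model
begin

abbreviation law_space :: "nat \<Rightarrow> ((nat \<Rightarrow> bool) \<times> (nat \<Rightarrow> real) \<times> (nat \<Rightarrow> bool)) measure" where
  "law_space n \<equiv> count_space UNIV \<Otimes>\<^sub>M obs_space n \<Otimes>\<^sub>M decision_space n"

abbreviation law :: "nat \<Rightarrow> rule \<Rightarrow> ((nat \<Rightarrow> bool) \<times> (nat \<Rightarrow> real) \<times> (nat \<Rightarrow> bool)) measure" where
  "law \<equiv> decision_law \<pi>1 f0 f1"

definition rej_prob :: "nat \<Rightarrow> rule \<Rightarrow> nat \<Rightarrow> (nat \<Rightarrow> real) \<Rightarrow> real" where
  "rej_prob n K i x = measure (K x) {d \<in> {..<n} \<rightarrow>\<^sub>E UNIV. d i}"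

text \<open>Expected number of rejected true nulls; \<open>alt_rej\<close> is its counterpart for
  alternatives. Numerators and denominators of mFDR and mFNR are linear in the decisions, so a rule
  enters them through these two numbers only.\<close>

definition null_rej :: "nat \<Rightarrow> rule \<Rightarrow> real" where
  "null_rej n K = (\<Sum>i<n. \<integral>\<omega>. rej_prob n K i (snd \<omega>) * of_bool (\<not> fst \<omega> i) \<partial>TG n)"

definition alt_rej :: "nat \<Rightarrow> rule \<Rightarrow> real" where
  "alt_rej n K = (\<Sum>i<n. \<integral>\<omega>. rej_prob n K i (snd \<omega>) * of_bool (fst \<omega> i) \<partial>TG n)"

lemma decision_law_eq_bind:
  "law n K = TG n \<bind> (\<lambda>\<omega>. K (snd \<omega>) \<bind> (\<lambda>d. return (law_space n) (fst \<omega>, snd \<omega>, d)))"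
  unfolding decision_law_def by (simp add: case_prod_unfold)

lemma measurable_law_kernel:
  assumes "K \<in> decision_rules n"
  shows "(\<lambda>\<omega>. K (snd \<omega>) \<bind> (\<lambda>d. return (law_space n) (fst \<omega>, snd \<omega>, d))) \<in> TG n \<rightarrow>\<^sub>M prob_algebra (law_space n)"
proof (rule measurable_bind_prob_space2[where N="decision_space n"])
  have "snd \<in> TG n \<rightarrow>\<^sub>M obs_space n" by measurable
  then show "(\<lambda>\<omega>. K (snd \<omega>)) \<in> TG n \<rightarrow>\<^sub>M prob_algebra (decision_space n)"
    using assms unfolding decision_rules_def by (rule measurable_compose)
  have "(\<lambda>p. (fst (fst p), snd (fst p), snd p)) \<in> TG n \<Otimes>\<^sub>M decision_space n \<rightarrow>\<^sub>M law_space n"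
    by measurable
  from measurable_compose[OF this measurable_return_prob_space]
  show "(\<lambda>(\<omega>, d). return (law_space n) (fst \<omega>, snd \<omega>, d)) \<in> TG n \<Otimes>\<^sub>M decision_space n \<rightarrow>\<^sub>M prob_algebra (law_space n)"
    by (simp add: case_prod_unfold)
qed

lemma rule_kernel:
  assumes "K \<in> decision_rules n" "x \<in> space (obs_space n)"
  shows "prob_space (K x)" "sets (K x) = Pow ({..<n} \<rightarrow>\<^sub>E UNIV)" "space (K x) = {..<n} \<rightarrow>\<^sub>E UNIV"
proof -
  have "K x \<in> space (prob_algebra (decision_space n))"
    using assms unfolding decision_rules_def by (auto intro: measurable_space)
  then show "prob_space (K x)" "sets (K x) = Pow ({..<n} \<rightarrow>\<^sub>E UNIV)"
    by (auto simp: space_prob_algebra)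
  with sets_eq_imp_space_eq[of "K x" "decision_space n"]
  show "space (K x) = {..<n} \<rightarrow>\<^sub>E UNIV" by simp
qed

lemma law_expectation:
  fixes g :: "_ \<Rightarrow> real"
  assumes K: "K \<in> decision_rules n" and g: "g \<in> borel_measurable (law_space n)"
    and B: "\<And>z. \<bar>g z\<bar> \<le> B"
  shows "(\<integral>z. g z \<partial>law n K) = (\<integral>\<omega>. \<integral>d. g (fst \<omega>, snd \<omega>, d) \<partial>K (snd \<omega>) \<partial>TG n)"
proof -
  interpret prob_space "TG n" by (rule prob_space_two_group)
  let ?N = "\<lambda>\<omega>. K (snd \<omega>) \<bind> (\<lambda>d. return (law_space n) (fst \<omega>, snd \<omega>, d))"
  have N: "?N \<in> TG n \<rightarrow>\<^sub>M prob_algebra (law_space n)" by (rule measurable_law_kernel[OF K])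
  have "AE \<omega> in TG n. emeasure (?N \<omega>) (space (?N \<omega>)) \<le> ennreal 1"
  proof (rule AE_I2)
    fix \<omega> assume "\<omega> \<in> space (TG n)"
    then have "?N \<omega> \<in> space (prob_algebra (law_space n))" using N by (rule measurable_space[rotated])
    then have "prob_space (?N \<omega>)" by (simp add: space_prob_algebra)
    then show "emeasure (?N \<omega>) (space (?N \<omega>)) \<le> ennreal 1"
      by (simp add: prob_space.emeasure_space_1)
  qed
  then have "(\<integral>z. g z \<partial>law n K) = (\<integral>\<omega>. \<integral>z. g z \<partial>?N \<omega> \<partial>TG n)"
    unfolding decision_law_eq_bind
    by (intro integral_bind[where B'=1 and B=B, OF g B measurable_prob_algebraD[OF N]]) unfold_locales
  also have "\<dots> = (\<integral>\<omega>. \<integral>d. g (fst \<omega>, snd \<omega>, d) \<partial>K (snd \<omega>) \<partial>TG n)"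
  proof (rule Bochner_Integration.integral_cong[OF refl])
    fix \<omega> assume "\<omega> \<in> space (TG n)"
    then have \<omega>: "snd \<omega> \<in> space (obs_space n)" by auto
    note Kx = rule_kernel[OF K \<omega>]
    interpret K: prob_space "K (snd \<omega>)" by (rule Kx)
    have m: "(\<lambda>d. (fst \<omega>, snd \<omega>, d)) \<in> K (snd \<omega>) \<rightarrow>\<^sub>M law_space n"
    proof -
      have "(\<lambda>d. (fst \<omega>, snd \<omega>, d)) \<in> decision_space n \<rightarrow>\<^sub>M law_space n"
        using \<omega> by (intro measurable_Pair) auto
      moreover have "sets (K (snd \<omega>)) = sets (decision_space n)" using Kx by simp
      ultimately show ?thesis using measurable_cong_sets by blast
    qed
    have "?N \<omega> = distr (K (snd \<omega>)) (law_space n) (\<lambda>d. (fst \<omega>, snd \<omega>, d))"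
      by (rule bind_return_distr'[OF K.not_empty m])
    then show "(\<integral>z. g z \<partial>?N \<omega>) = (\<integral>d. g (fst \<omega>, snd \<omega>, d) \<partial>K (snd \<omega>))"
      by (simp add: integral_distr[OF m g])
  qed
  finally show ?thesis .
qed

lemma measurable_rej_prob:
  assumes "K \<in> decision_rules n"
  shows "rej_prob n K i \<in> borel_measurable (obs_space n)"
  unfolding rej_prob_def[abs_def]
  by (rule measurable_compose[OF assms[unfolded decision_rules_def] measurable_measure_prob_algebra]) auto

lemma rej_prob_bounds:
  assumes "K \<in> decision_rules n" "x \<in> space (obs_space n)"
  shows "0 \<le> rej_prob n K i x" "rej_prob n K i x \<le> 1"
  using prob_space.prob_le_1[OF rule_kernel(1)[OF assms]] by (auto simp: rej_prob_def)

text \<open>\<open>G (d i) b\<close> is affine in the indicator of rejection, so its mean over the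
  randomization is a mixture of \<open>G True b\<close> and \<open>G False b\<close>. A general
  \<open>G\<close> covers the four sums in mFDR and mFNR at once.\<close>

lemma expectation_decisions:
  fixes G :: "bool \<Rightarrow> bool \<Rightarrow> real"
  assumes K: "K \<in> decision_rules n"
  shows "(\<integral>(\<theta>, x, d). (\<Sum>i<n. G (d i) (\<theta> i)) \<partial>law n K) =
    (\<Sum>i<n. \<integral>\<omega>. rej_prob n K i (snd \<omega>) * G True (fst \<omega> i)
       + (1 - rej_prob n K i (snd \<omega>)) * G False (fst \<omega> i) \<partial>TG n)"
proof -
  interpret prob_space "TG n" by (rule prob_space_two_group)
  define M where "M = \<bar>G True True\<bar> + \<bar>G True False\<bar> + \<bar>G False True\<bar> + \<bar>G False False\<bar>"
  have M: "\<bar>G a b\<bar> \<le> M" for a b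
    unfolding M_def by (cases a; cases b) auto
  define g where "g z = (\<Sum>i<n. G (snd (snd z) i) (fst z i))" for z :: "(nat \<Rightarrow> bool) \<times> (nat \<Rightarrow> real) \<times> (nat \<Rightarrow> bool)"
  have lab [measurable]: "(\<lambda>z. fst z i) \<in> law_space n \<rightarrow>\<^sub>M count_space UNIV" for i
    by (rule measurable_compose[OF measurable_fst]) simp
  have dec [measurable]: "(\<lambda>z. snd (snd z) i) \<in> law_space n \<rightarrow>\<^sub>M count_space UNIV" for i
    by (rule measurable_compose[OF measurable_compose[OF measurable_snd measurable_snd]]) simp
  have gm: "g \<in> borel_measurable (law_space n)"
  proof -
    have eq: "(\<lambda>z. G (snd (snd z) i) (fst z i)) = (\<lambda>z. if snd (snd z) i then (if fst z i then G True True else G True False)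
      else (if fst z i then G False True else G False False))" for i
      by (rule ext) simp
    have "(\<lambda>z. G (snd (snd z) i) (fst z i)) \<in> borel_measurable (law_space n)" for i
      unfolding eq by (intro measurable_If measurable_const) measurable
    then show ?thesis unfolding g_def[abs_def] by (intro borel_measurable_sum)
  qed
  have gB: "\<bar>g z\<bar> \<le> real n * M" for z
  proof -
    have "\<bar>g z\<bar> \<le> (\<Sum>i<n. \<bar>G (snd (snd z) i) (fst z i)\<bar>)" unfolding g_def by (rule sum_abs)
    also have "\<dots> \<le> (\<Sum>i<n. M)" by (intro sum_mono M)
    finally show ?thesis by simp
  qed
  let ?r = "\<lambda>i \<omega>. rej_prob n K i (snd \<omega>)"
  have inner: "(\<integral>d. g (fst \<omega>, snd \<omega>, d) \<partial>K (snd \<omega>))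
     = (\<Sum>i<n. ?r i \<omega> * G True (fst \<omega> i) + (1 - ?r i \<omega>) * G False (fst \<omega> i))"
    if "\<omega> \<in> space (TG n)" for \<omega>
  proof -
    have \<omega>: "snd \<omega> \<in> space (obs_space n)" using that by auto
    note Kx = rule_kernel[OF K \<omega>]
    interpret K: prob_space "K (snd \<omega>)" by (rule Kx)
    let ?S = "\<lambda>i. {d \<in> {..<n} \<rightarrow>\<^sub>E UNIV. d i}"
    have S: "?S i \<in> sets (K (snd \<omega>))" "?S i \<inter> space (K (snd \<omega>)) = ?S i" for i unfolding Kx by auto
    have int: "integrable (K (snd \<omega>)) (indicat_real (?S i))" for i
      using S by (simp add: less_top[symmetric])
    have "(\<integral>d. g (fst \<omega>, snd \<omega>, d) \<partial>K (snd \<omega>))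
      = (\<integral>d. (\<Sum>i<n. G False (fst \<omega> i) + (G True (fst \<omega> i) - G False (fst \<omega> i)) * indicat_real (?S i) d) \<partial>K (snd \<omega>))"
      by (rule Bochner_Integration.integral_cong[OF refl])
        (simp add: g_def Kx indicator_def; intro sum.cong refl; simp)
    also have "\<dots> = (\<Sum>i<n. \<integral>d. G False (fst \<omega> i) + (G True (fst \<omega> i) - G False (fst \<omega> i)) * indicat_real (?S i) d \<partial>K (snd \<omega>))"
      by (intro Bochner_Integration.integral_sum Bochner_Integration.integrable_add integrable_mult_right int) simp
    also have "\<dots> = (\<Sum>i<n. G False (fst \<omega> i) + (G True (fst \<omega> i) - G False (fst \<omega> i)) * ?r i \<omega>)"
    proof (intro sum.cong refl)
      fix i
      show "(\<integral>d. G False (fst \<omega> i) + (G True (fst \<omega> i) - G False (fst \<omega> i)) * indicat_real (?S i) d \<partial>K (snd \<omega>))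
        = G False (fst \<omega> i) + (G True (fst \<omega> i) - G False (fst \<omega> i)) * ?r i \<omega>"
        using int[of i] S(2)[of i]
        by (subst Bochner_Integration.integral_add) (simp_all add: K.prob_space rej_prob_def)
    qed
    also have "\<dots> = (\<Sum>i<n. ?r i \<omega> * G True (fst \<omega> i) + (1 - ?r i \<omega>) * G False (fst \<omega> i))"
      by (intro sum.cong) (auto simp: algebra_simps)
    finally show ?thesis .
  qed
  have "(\<integral>(\<theta>, x, d). (\<Sum>i<n. G (d i) (\<theta> i)) \<partial>law n K) = (\<integral>z. g z \<partial>law n K)"
    by (rule Bochner_Integration.integral_cong) (auto simp: g_def)
  also have "\<dots> = (\<integral>\<omega>. (\<Sum>i<n. ?r i \<omega> * G True (fst \<omega> i) + (1 - ?r i \<omega>) * G False (fst \<omega> i)) \<partial>TG n)"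
    unfolding law_expectation[OF K gm gB] by (rule Bochner_Integration.integral_cong[OF refl inner])
  also have "\<dots> = (\<Sum>i<n. \<integral>\<omega>. ?r i \<omega> * G True (fst \<omega> i) + (1 - ?r i \<omega>) * G False (fst \<omega> i) \<partial>TG n)"
  proof (rule Bochner_Integration.integral_sum)
    fix i
    have [measurable]: "?r i \<in> borel_measurable (TG_space n)"
      by (rule measurable_compose[OF measurable_snd measurable_rej_prob[OF K]])
    have [measurable]: "(\<lambda>\<omega>. G a (fst \<omega> i)) \<in> borel_measurable (TG_space n)" for a
    proof -
      have eq: "(\<lambda>\<omega>. G a (fst \<omega> i)) = (\<lambda>\<omega>. if fst \<omega> i then G a True else G a False)"
        by (rule ext) simp
      show ?thesis unfolding eq by measurable
    qed
    show "integrable (TG n) (\<lambda>\<omega>. ?r i \<omega> * G True (fst \<omega> i) + (1 - ?r i \<omega>) * G False (fst \<omega> i))"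
    proof (rule integrable_const_bound[where B=M])
      show "AE \<omega> in TG n. norm (?r i \<omega> * G True (fst \<omega> i) + (1 - ?r i \<omega>) * G False (fst \<omega> i)) \<le> M"
      proof (rule AE_I2)
        fix \<omega> assume "\<omega> \<in> space (TG n)"
        then have r: "0 \<le> ?r i \<omega>" "?r i \<omega> \<le> 1" using rej_prob_bounds[OF K] by auto
        have "\<bar>?r i \<omega> * G True (fst \<omega> i) + (1 - ?r i \<omega>) * G False (fst \<omega> i)\<bar>
          \<le> ?r i \<omega> * \<bar>G True (fst \<omega> i)\<bar> + (1 - ?r i \<omega>) * \<bar>G False (fst \<omega> i)\<bar>"
          using r by (intro order_trans[OF abs_triangle_ineq]) (simp add: abs_mult)
        also have "\<dots> \<le> M"
          using r by (intro convex_bound_le M) simp_all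
        finally show "norm (?r i \<omega> * G True (fst \<omega> i) + (1 - ?r i \<omega>) * G False (fst \<omega> i)) \<le> M" by simp
      qed
    qed measurable
  qed
  finally show ?thesis .
qed

lemma integrable_rej_prob:
  assumes K: "K \<in> decision_rules n"
  shows "integrable (TG n) (\<lambda>\<omega>. rej_prob n K i (snd \<omega>) * of_bool (fst \<omega> i))"
    and "integrable (TG n) (\<lambda>\<omega>. rej_prob n K i (snd \<omega>) * of_bool (\<not> fst \<omega> i))"
proof -
  interpret prob_space "TG n" by (rule prob_space_two_group)
  have [measurable]: "(\<lambda>\<omega>. rej_prob n K i (snd \<omega>)) \<in> borel_measurable (TG_space n)"
    by (rule measurable_compose[OF measurable_snd measurable_rej_prob[OF K]])
  show "integrable (TG n) (\<lambda>\<omega>. rej_prob n K i (snd \<omega>) * of_bool (fst \<omega> i))"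
    "integrable (TG n) (\<lambda>\<omega>. rej_prob n K i (snd \<omega>) * of_bool (\<not> fst \<omega> i))"
    using rej_prob_bounds[OF K]
    by (intro integrable_const_bound[where B=1]; auto simp: of_bool_def)+
qed

lemma pair_prob_label: "pair_prob (\<lambda>b x. b) = \<pi>1" "pair_prob (\<lambda>b x. \<not> b) = 1 - \<pi>1"
  using prob_space.prob_space[OF prob_space_obs_law] by (auto simp: pair_prob_def)

lemma expectation_label_indicator:
  assumes i: "i < n"
  shows "(\<integral>\<omega>. of_bool (fst \<omega> i) \<partial>TG n) = \<pi>1" "(\<integral>\<omega>. of_bool (\<not> fst \<omega> i) \<partial>TG n) = 1 - \<pi>1"
    and "integrable (TG n) (\<lambda>\<omega>. of_bool (fst \<omega> i) :: real)" "integrable (TG n) (\<lambda>\<omega>. of_bool (\<not> fst \<omega> i) :: real)"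
  using expectation_of_bool_ball[of "\<lambda>b x. b" "{i}" n] expectation_of_bool_ball[of "\<lambda>b x. \<not> b" "{i}" n]
    integrable_of_bool[of "\<lambda>b x. b" "\<lambda>b x. True" i n i] integrable_of_bool[of "\<lambda>b x. \<not> b" "\<lambda>b x. True" i n i] i
  by (simp_all add: pair_prob_label)

lemma rej_bounds:
  assumes K: "K \<in> decision_rules n"
  shows "0 \<le> null_rej n K" "0 \<le> alt_rej n K"
    and "null_rej n K \<le> n * (1 - \<pi>1)" "alt_rej n K \<le> n * \<pi>1"
proof -
  note b = rej_prob_bounds[OF K]
  show "0 \<le> null_rej n K" "0 \<le> alt_rej n K"
    unfolding null_rej_def alt_rej_def using b by (auto intro!: sum_nonneg Bochner_Integration.integral_nonneg)
  have "null_rej n K \<le> (\<Sum>i<n. 1 - \<pi>1)"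
    unfolding null_rej_def
  proof (rule sum_mono)
    fix i assume "i \<in> {..<n}"
    then have i: "i < n" by simp
    have "(\<integral>\<omega>. rej_prob n K i (snd \<omega>) * of_bool (\<not> fst \<omega> i) \<partial>TG n) \<le> (\<integral>\<omega>. of_bool (\<not> fst \<omega> i) \<partial>TG n)"
      by (rule integral_mono[OF integrable_rej_prob(2)[OF K] expectation_label_indicator(4)[OF i]])
        (use b in \<open>auto simp: of_bool_def\<close>)
    then show "(\<integral>\<omega>. rej_prob n K i (snd \<omega>) * of_bool (\<not> fst \<omega> i) \<partial>TG n) \<le> 1 - \<pi>1"
      using expectation_label_indicator[OF i] by simp
  qed
  then show "null_rej n K \<le> n * (1 - \<pi>1)" by simp
  have "alt_rej n K \<le> (\<Sum>i<n. \<pi>1)"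
    unfolding alt_rej_def
  proof (rule sum_mono)
    fix i assume "i \<in> {..<n}"
    then have i: "i < n" by simp
    have "(\<integral>\<omega>. rej_prob n K i (snd \<omega>) * of_bool (fst \<omega> i) \<partial>TG n) \<le> (\<integral>\<omega>. of_bool (fst \<omega> i) \<partial>TG n)"
      by (rule integral_mono[OF integrable_rej_prob(1)[OF K] expectation_label_indicator(3)[OF i]])
        (use b in \<open>auto simp: of_bool_def\<close>)
    then show "(\<integral>\<omega>. rej_prob n K i (snd \<omega>) * of_bool (fst \<omega> i) \<partial>TG n) \<le> \<pi>1"
      using expectation_label_indicator[OF i] by simp
  qed
  then show "alt_rej n K \<le> n * \<pi>1" by simp
qed

lemma expectation_rej_prob:
  assumes K: "K \<in> decision_rules n"
  shows "(\<Sum>i<n. \<integral>\<omega>. rej_prob n K i (snd \<omega>) \<partial>TG n) = null_rej n K + alt_rej n K"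
  unfolding null_rej_def alt_rej_def sum.distrib[symmetric]
proof (intro sum.cong refl)
  fix i
  have "(\<integral>\<omega>. rej_prob n K i (snd \<omega>) \<partial>TG n) = (\<integral>\<omega>. rej_prob n K i (snd \<omega>) * of_bool (\<not> fst \<omega> i)
      + rej_prob n K i (snd \<omega>) * of_bool (fst \<omega> i) \<partial>TG n)"
    by (rule Bochner_Integration.integral_cong) auto
  then show "(\<integral>\<omega>. rej_prob n K i (snd \<omega>) \<partial>TG n) = (\<integral>\<omega>. rej_prob n K i (snd \<omega>) * of_bool (\<not> fst \<omega> i) \<partial>TG n)
      + (\<integral>\<omega>. rej_prob n K i (snd \<omega>) * of_bool (fst \<omega> i) \<partial>TG n)"
    by (simp add: Bochner_Integration.integral_add[OF integrable_rej_prob(2)[OF K] integrable_rej_prob(1)[OF K]])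
qed

lemma mFDR_eq:
  assumes K: "K \<in> decision_rules n"
  shows "mFDR \<pi>1 f0 f1 n K = null_rej n K / (null_rej n K + alt_rej n K)"
proof -
  have "(\<integral>(\<theta>, x, d). (\<Sum>i<n. of_bool (d i) * (1 - of_bool (\<theta> i))) \<partial>law n K) = null_rej n K"
    unfolding expectation_decisions[OF K, of "\<lambda>a b. of_bool a * (1 - of_bool b)"] null_rej_def
    by (intro sum.cong refl Bochner_Integration.integral_cong) auto
  moreover have "(\<integral>(\<theta>, x, d). (\<Sum>i<n. of_bool (d i)) \<partial>law n K) = null_rej n K + alt_rej n K"
    unfolding expectation_decisions[OF K, of "\<lambda>a b. of_bool a"] expectation_rej_prob[OF K, symmetric]
    by (intro sum.cong refl Bochner_Integration.integral_cong) auto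
  ultimately show ?thesis unfolding mFDR_def by (simp only:)
qed

text \<open>Accepted is total minus rejected, the totals being on average \<open>n * \<pi>1\<close>
  alternatives among \<open>n\<close> hypotheses.\<close>

lemma mFNR_eq:
  assumes K: "K \<in> decision_rules n"
  shows "mFNR \<pi>1 f0 f1 n K = (n * \<pi>1 - alt_rej n K) / (n - (null_rej n K + alt_rej n K))"
proof -
  interpret prob_space "TG n" by (rule prob_space_two_group)
  have "(\<integral>(\<theta>, x, d). (\<Sum>i<n. (1 - of_bool (d i)) * of_bool (\<theta> i)) \<partial>law n K)
     = (\<Sum>i<n. \<pi>1 - (\<integral>\<omega>. rej_prob n K i (snd \<omega>) * of_bool (fst \<omega> i) \<partial>TG n))"
    unfolding expectation_decisions[OF K, of "\<lambda>a b. (1 - of_bool a) * of_bool b"]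
  proof (intro sum.cong refl)
    fix i assume "i \<in> {..<n}"
    then have i: "i < n" by simp
    have "(\<integral>\<omega>. rej_prob n K i (snd \<omega>) * ((1 - of_bool True) * of_bool (fst \<omega> i)) +
          (1 - rej_prob n K i (snd \<omega>)) * ((1 - of_bool False) * of_bool (fst \<omega> i)) \<partial>TG n)
      = (\<integral>\<omega>. of_bool (fst \<omega> i) - rej_prob n K i (snd \<omega>) * of_bool (fst \<omega> i) \<partial>TG n)"
      by (rule Bochner_Integration.integral_cong) (auto simp: algebra_simps)
    then show "(\<integral>\<omega>. rej_prob n K i (snd \<omega>) * ((1 - of_bool True) * of_bool (fst \<omega> i)) +
          (1 - rej_prob n K i (snd \<omega>)) * ((1 - of_bool False) * of_bool (fst \<omega> i)) \<partial>TG n)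
      = \<pi>1 - (\<integral>\<omega>. rej_prob n K i (snd \<omega>) * of_bool (fst \<omega> i) \<partial>TG n)"
      by (simp only: Bochner_Integration.integral_diff[OF expectation_label_indicator(3)[OF i] integrable_rej_prob(1)[OF K]]
          expectation_label_indicator(1)[OF i])
  qed
  then have num: "(\<integral>(\<theta>, x, d). (\<Sum>i<n. (1 - of_bool (d i)) * of_bool (\<theta> i)) \<partial>law n K) = n * \<pi>1 - alt_rej n K"
    by (simp add: sum_subtractf alt_rej_def)
  have rint: "integrable (TG n) (\<lambda>\<omega>. rej_prob n K i (snd \<omega>))" for i
  proof -
    have "rej_prob n K i (snd \<omega>) = rej_prob n K i (snd \<omega>) * of_bool (fst \<omega> i) + rej_prob n K i (snd \<omega>) * of_bool (\<not> fst \<omega> i)" for \<omega> :: "(nat \<Rightarrow> bool) \<times> (nat \<Rightarrow> real)"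
      by (cases "fst \<omega> i") auto
    then show ?thesis
      using Bochner_Integration.integrable_add[OF integrable_rej_prob(1)[OF K, of i] integrable_rej_prob(2)[OF K, of i]] by simp
  qed
  have "(\<integral>(\<theta>, x, d). (\<Sum>i<n. 1 - of_bool (d i)) \<partial>law n K) = (\<Sum>i<n. 1 - (\<integral>\<omega>. rej_prob n K i (snd \<omega>) \<partial>TG n))"
    unfolding expectation_decisions[OF K, of "\<lambda>a b. 1 - of_bool a"]
    by (intro sum.cong refl) (simp add: rint prob_space del: space_two_group)
  then have den: "(\<integral>(\<theta>, x, d). (\<Sum>i<n. 1 - of_bool (d i)) \<partial>law n K) = n - (null_rej n K + alt_rej n K)"
    by (simp add: sum_subtractf expectation_rej_prob[OF K])
  show ?thesis unfolding mFNR_def num den ..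
qed

end

section \<open>The optimal marginal false non-discovery rate\<close>

context two_group_model
begin

lemma return_in_decision_rules:
  assumes "\<delta> \<in> obs_space n \<rightarrow>\<^sub>M decision_space n"
  shows "(\<lambda>x. return (decision_space n) (\<delta> x)) \<in> decision_rules n"
  unfolding decision_rules_def by (rule measurable_compose[OF assms measurable_return_prob_space])

lemma rej_prob_return:
  assumes "\<delta> \<in> obs_space n \<rightarrow>\<^sub>M decision_space n" "x \<in> space (obs_space n)"
  shows "rej_prob n (\<lambda>x. return (decision_space n) (\<delta> x)) i x = of_bool (\<delta> x i)"
  using measurable_space[OF assms] by (simp add: rej_prob_def measure_return indicator_def)

lemma decision_law_return:
  assumes \<delta>: "\<delta> \<in> obs_space n \<rightarrow>\<^sub>M decision_space n"
  shows "law n (\<lambda>x. return (decision_space n) (\<delta> x))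
    = distr (TG n) (law_space n) (\<lambda>\<omega>. (fst \<omega>, snd \<omega>, \<delta> (snd \<omega>)))"
proof -
  interpret prob_space "TG n" by (rule prob_space_two_group)
  have m: "(\<lambda>\<omega>. (fst \<omega>, snd \<omega>, \<delta> (snd \<omega>))) \<in> TG n \<rightarrow>\<^sub>M law_space n"
    using measurable_compose[OF _ \<delta>, of snd "TG n"] by measurable
  have "law n (\<lambda>x. return (decision_space n) (\<delta> x))
    = TG n \<bind> (\<lambda>\<omega>. return (law_space n) (fst \<omega>, snd \<omega>, \<delta> (snd \<omega>)))"
    unfolding decision_law_eq_bind
  proof (rule bind_cong[OF refl])
    fix \<omega> assume "\<omega> \<in> space (TG n)"
    then have \<omega>: "snd \<omega> \<in> space (obs_space n)" by auto
    have "(\<lambda>d. (fst \<omega>, snd \<omega>, d)) \<in> decision_space n \<rightarrow>\<^sub>M law_space n"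
      using \<omega> by (intro measurable_Pair) auto
    from measurable_compose[OF this return_measurable]
    have "(\<lambda>d. return (law_space n) (fst \<omega>, snd \<omega>, d)) \<in> decision_space n \<rightarrow>\<^sub>M subprob_algebra (law_space n)" .
    then show "return (decision_space n) (\<delta> (snd \<omega>)) \<bind> (\<lambda>d. return (law_space n) (fst \<omega>, snd \<omega>, d))
      = return (law_space n) (fst \<omega>, snd \<omega>, \<delta> (snd \<omega>))"
      by (rule bind_return) (rule measurable_space[OF \<delta> \<omega>])
  qed
  also have "\<dots> = distr (TG n) (law_space n) (\<lambda>\<omega>. (fst \<omega>, snd \<omega>, \<delta> (snd \<omega>)))"
    by (rule bind_return_distr'[OF not_empty m])
  finally show ?thesis .
qed

text \<open>For a deterministic rule the joint law is an image of the law of labels and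
  observations, so deviation probabilities agree and convergence can be shown where the law of large
  numbers is available.\<close>

lemma conv_in_prob_law_return:
  assumes \<delta>: "\<And>n. \<delta> n \<in> obs_space n \<rightarrow>\<^sub>M decision_space n"
    and Y: "\<And>n. Y n \<in> borel_measurable (law_space n)"
    and conv: "conv_in_prob TG (\<lambda>n \<omega>. Y n (fst \<omega>, snd \<omega>, \<delta> n (snd \<omega>))) c"
  shows "conv_in_prob (\<lambda>n. law n (\<lambda>x. return (decision_space n) (\<delta> n x))) Y c"
  unfolding conv_in_prob_def
proof (intro allI impI)
  fix \<epsilon> :: real assume "0 < \<epsilon>"
  have "measure (law n (\<lambda>x. return (decision_space n) (\<delta> n x)))
      {z \<in> space (law n (\<lambda>x. return (decision_space n) (\<delta> n x))). \<epsilon> < \<bar>Y n z - c\<bar>}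
    = measure (TG n) {\<omega> \<in> space (TG n). \<epsilon> < \<bar>Y n (fst \<omega>, snd \<omega>, \<delta> n (snd \<omega>)) - c\<bar>}" for n
  proof -
    have m: "(\<lambda>\<omega>. (fst \<omega>, snd \<omega>, \<delta> n (snd \<omega>))) \<in> TG n \<rightarrow>\<^sub>M law_space n"
      using measurable_compose[OF _ \<delta>[of n], of snd "TG n"] by measurable
    note [measurable] = Y[of n]
    have S: "{z \<in> space (law_space n). \<epsilon> < \<bar>Y n z - c\<bar>} \<in> sets (law_space n)" by measurable
    show ?thesis
      unfolding decision_law_return[OF \<delta>] space_distr measure_distr[OF m S]
      using measurable_space[OF m] by (intro arg_cong[where f="measure (TG n)"]) (auto simp del: space_two_group)
  qed
  then show "(\<lambda>n. measure (law n (\<lambda>x. return (decision_space n) (\<delta> n x)))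
      {z \<in> space (law n (\<lambda>x. return (decision_space n) (\<delta> n x))). \<epsilon> < \<bar>Y n z - c\<bar>}) \<longlonglongrightarrow> 0"
    using conv \<open>0 < \<epsilon>\<close> unfolding conv_in_prob_def by (simp only:)
qed

lemma rej_return:
  assumes \<delta>: "\<delta> \<in> obs_space n \<rightarrow>\<^sub>M decision_space n"
  shows "null_rej n (\<lambda>x. return (decision_space n) (\<delta> x))
      = (\<Sum>i<n. \<integral>\<omega>. of_bool (\<delta> (snd \<omega>) i \<and> \<not> fst \<omega> i) \<partial>TG n)"
    and "alt_rej n (\<lambda>x. return (decision_space n) (\<delta> x))
      = (\<Sum>i<n. \<integral>\<omega>. of_bool (\<delta> (snd \<omega>) i \<and> fst \<omega> i) \<partial>TG n)"
  unfolding null_rej_def alt_rej_def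
  by (intro sum.cong refl Bochner_Integration.integral_cong; simp add: rej_prob_return[OF \<delta>] mem_Times_iff)+

definition region_decision :: "real set \<Rightarrow> nat \<Rightarrow> (nat \<Rightarrow> real) \<Rightarrow> nat \<Rightarrow> bool" where
  "region_decision S n x = (\<lambda>i\<in>{..<n}. x i \<in> S)"

lemma measurable_region_decision:
  assumes [measurable]: "S \<in> sets borel"
  shows "region_decision S n \<in> obs_space n \<rightarrow>\<^sub>M decision_space n"
proof (rule measurable_decision)
  fix i assume i: "i < n"
  have [measurable]: "(\<lambda>x. x i) \<in> obs_space n \<rightarrow>\<^sub>M borel"
    using i by (intro measurable_component_singleton) simp
  show "Measurable.pred (obs_space n) (\<lambda>x. region_decision S n x i)"
    using i by (simp add: region_decision_def)
qed (simp add: region_decision_def)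

lemma rej_region_decision:
  assumes S [measurable]: "S \<in> sets borel"
  shows "null_rej n (\<lambda>x. return (decision_space n) (region_decision S n x)) = n * pair_prob (\<lambda>b x. \<not> b \<and> x \<in> S)"
    and "alt_rej n (\<lambda>x. return (decision_space n) (region_decision S n x)) = n * pair_prob (\<lambda>b x. b \<and> x \<in> S)"
proof -
  have "(\<integral>\<omega>. of_bool (region_decision S n (snd \<omega>) i \<and> \<not> fst \<omega> i) \<partial>TG n) = pair_prob (\<lambda>b x. \<not> b \<and> x \<in> S)"
    "(\<integral>\<omega>. of_bool (region_decision S n (snd \<omega>) i \<and> fst \<omega> i) \<partial>TG n) = pair_prob (\<lambda>b x. b \<and> x \<in> S)"
    if "i < n" for i
    using that expectation_of_bool_ball[of "\<lambda>b x. \<not> b \<and> x \<in> S" "{i}" n]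
      expectation_of_bool_ball[of "\<lambda>b x. b \<and> x \<in> S" "{i}" n]
    by (simp_all add: region_decision_def conj_commute)
  then show "null_rej n (\<lambda>x. return (decision_space n) (region_decision S n x)) = n * pair_prob (\<lambda>b x. \<not> b \<and> x \<in> S)"
    "alt_rej n (\<lambda>x. return (decision_space n) (region_decision S n x)) = n * pair_prob (\<lambda>b x. b \<and> x \<in> S)"
    unfolding rej_return[OF measurable_region_decision[OF S]] by simp_all
qed

lemma neyman_pearson_rule:
  assumes K: "K \<in> decision_rules n" and S [measurable]: "S \<in> sets borel"
    and *: "\<And>x. x \<in> S \<Longrightarrow> \<kappa> * (1 - posterior x) \<le> posterior x"
      "\<And>x. x \<notin> S \<Longrightarrow> posterior x \<le> \<kappa> * (1 - posterior x)"
  shows "alt_rej n K - \<kappa> * null_rej n K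
    \<le> n * (pair_prob (\<lambda>b x. b \<and> x \<in> S) - \<kappa> * pair_prob (\<lambda>b x. \<not> b \<and> x \<in> S))"
proof -
  \<comment> \<open>The bounds on rejection probabilities hold inside the observation space;
    truncation extends them to every \<open>x\<close>, as the one-coordinate inequality demands,
    without changing the integrals.\<close>
  define h where "h i x = max 0 (min 1 (rej_prob n K i x))" for i x
  have h_eq: "rej_prob n K i x = h i x" if "x \<in> space (obs_space n)" for i x
    using rej_prob_bounds[OF K that, of i] by (simp add: h_def)
  have "alt_rej n K - \<kappa> * null_rej n K
    = (\<Sum>i<n. (\<integral>\<omega>. rej_prob n K i (snd \<omega>) * of_bool (fst \<omega> i) \<partial>TG n)
        - \<kappa> * (\<integral>\<omega>. rej_prob n K i (snd \<omega>) * of_bool (\<not> fst \<omega> i) \<partial>TG n))"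
    unfolding alt_rej_def null_rej_def sum_distrib_left sum_subtractf ..
  also have "\<dots> \<le> (\<Sum>i<n. pair_prob (\<lambda>b x. b \<and> x \<in> S) - \<kappa> * pair_prob (\<lambda>b x. \<not> b \<and> x \<in> S))"
  proof (rule sum_mono)
    fix i assume "i \<in> {..<n}"
    then have i: "i < n" by simp
    have e: "(\<integral>\<omega>. rej_prob n K i (snd \<omega>) * of_bool (fst \<omega> i) \<partial>TG n) = (\<integral>\<omega>. h i (snd \<omega>) * of_bool (fst \<omega> i) \<partial>TG n)"
      "(\<integral>\<omega>. rej_prob n K i (snd \<omega>) * of_bool (\<not> fst \<omega> i) \<partial>TG n) = (\<integral>\<omega>. h i (snd \<omega>) * of_bool (\<not> fst \<omega> i) \<partial>TG n)"
      by (intro Bochner_Integration.integral_cong refl; simp add: h_eq mem_Times_iff)+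
    have hm: "h i \<in> borel_measurable (obs_space n)"
      unfolding h_def[abs_def] using measurable_rej_prob[OF K] by measurable
    show "(\<integral>\<omega>. rej_prob n K i (snd \<omega>) * of_bool (fst \<omega> i) \<partial>TG n)
        - \<kappa> * (\<integral>\<omega>. rej_prob n K i (snd \<omega>) * of_bool (\<not> fst \<omega> i) \<partial>TG n)
      \<le> pair_prob (\<lambda>b x. b \<and> x \<in> S) - \<kappa> * pair_prob (\<lambda>b x. \<not> b \<and> x \<in> S)"
      unfolding e by (rule neyman_pearson[OF i hm _ _ S *]) (simp_all add: h_def)
  qed
  finally show ?thesis by simp
qed

text \<open>Let a rule have null and alternative rejections \<open>a\<close> and \<open>c\<close>
  per hypothesis. The level bounds \<open>a\<close> by a multiple of \<open>c\<close>; with the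
  Neyman-Pearson inequality and the first slope condition this forces \<open>c \<le> q1\<close>. The
  second slope condition is what \<open>ratio_mono_of_slope\<close> needs to compare the quotients.
  Equality in \<open>level\<close> makes the rule for \<open>S\<close> admissible, so the infimum is
  attained, at a value in which \<open>n\<close> does not occur.\<close>

lemma mFNR_opt_eq:
  assumes n: "1 \<le> n" and S: "S \<in> sets borel" and \<kappa>: "0 < \<kappa>"
    and NP: "\<And>x. x \<in> S \<Longrightarrow> \<kappa> * (1 - posterior x) \<le> posterior x"
      "\<And>x. x \<notin> S \<Longrightarrow> posterior x \<le> \<kappa> * (1 - posterior x)"
    and \<alpha>: "0 < \<alpha>" "\<alpha> < 1 - \<pi>1"
    and q0: "q0 = pair_prob (\<lambda>b x. \<not> b \<and> x \<in> S)" and q1: "q1 = pair_prob (\<lambda>b x. b \<and> x \<in> S)"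
    and level: "q0 = \<alpha> * (q0 + q1)"
    and slope: "\<kappa> * q0 < q1" "\<pi>1 - q1 \<le> \<kappa> * (1 - \<pi>1 - q0)"
  shows "mFNR_opt \<pi>1 f0 f1 n \<alpha> = (\<pi>1 - q1) / (1 - (q0 + q1))"
proof -
  define KS where "KS = (\<lambda>x. return (decision_space n) (region_decision S n x))"
  have KS: "KS \<in> decision_rules n"
    unfolding KS_def by (rule return_in_decision_rules[OF measurable_region_decision[OF S]])
  have rej_KS: "null_rej n KS = n * q0" "alt_rej n KS = n * q1"
    unfolding KS_def q0 q1 by (rule rej_region_decision[OF S])+
  have q_nonneg: "0 \<le> q0" "0 \<le> q1" by (simp_all add: q0 q1 pair_prob_nonneg)
  have q_le: "q0 \<le> 1 - \<pi>1" "q1 \<le> \<pi>1"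
    using rej_bounds(3,4)[OF KS] n unfolding rej_KS by simp_all
  have q1_pos: "0 < q1" using slope(1) q_nonneg \<kappa> by (meson le_less_trans less_eq_real_def mult_nonneg_nonneg)
  \<comment> \<open>Rejecting every null would give a marginal false discovery rate of at least
    \<open>1 - \<pi>1\<close>, above \<alpha>. Hence some nulls are accepted and the denominator of
    the claimed value is positive.\<close>
  have q0_lt: "q0 < 1 - \<pi>1"
  proof (rule ccontr)
    assume "\<not> ?thesis"
    then have eq: "q0 = 1 - \<pi>1" using q_le by simp
    have "\<alpha> * (q0 + q1) < (1 - \<pi>1) * (q0 + q1)"
      using \<alpha> q_nonneg q1_pos by (intro mult_strict_right_mono) auto
    also have "\<dots> \<le> (1 - \<pi>1) * 1" using q_le \<pi>1 eq by (intro mult_left_mono) auto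
    finally show False using level eq by simp
  qed
  have bound: "(\<pi>1 - q1) / (1 - (q0 + q1)) \<le> mFNR \<pi>1 f0 f1 n K"
    if K: "K \<in> decision_rules n" and le: "mFDR \<pi>1 f0 f1 n K \<le> \<alpha>" for K
  proof -
    define a where "a = null_rej n K / n"
    define c where "c = alt_rej n K / n"
    have na: "null_rej n K = n * a" "alt_rej n K = n * c" using n by (simp_all add: a_def c_def)
    have ac: "0 \<le> a" "0 \<le> c" using rej_bounds[OF K] n by (simp_all add: a_def c_def)
    have ac': "a \<le> 1 - \<pi>1" "c \<le> \<pi>1"
      using rej_bounds(3,4)[OF K] n unfolding na by simp_all
    have mFDR: "mFDR \<pi>1 f0 f1 n K = a / (a + c)"
      using n by (simp add: mFDR_eq[OF K] na distrib_left[symmetric])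
    have mFNR: "mFNR \<pi>1 f0 f1 n K = (\<pi>1 - c) / (1 - (a + c))"
    proof -
      have "mFNR \<pi>1 f0 f1 n K = (n * (\<pi>1 - c)) / (n * (1 - (a + c)))"
        by (simp add: mFNR_eq[OF K] na algebra_simps)
      then show ?thesis using n by simp
    qed
    have level_K: "a \<le> \<alpha> * (a + c)"
    proof (cases "a + c = 0")
      case False
      then show ?thesis using le ac unfolding mFDR by (simp add: field_simps)
    qed (use ac in auto)
    have NPK: "c - \<kappa> * a \<le> q1 - \<kappa> * q0"
    proof -
      have "n * (c - \<kappa> * a) \<le> n * (q1 - \<kappa> * q0)"
        using neyman_pearson_rule[OF K S NP] unfolding na q0[symmetric] q1[symmetric]
        by (simp add: algebra_simps)
      then show ?thesis using n by simp
    qed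
    \<comment> \<open>The odds of \<alpha>: the level constraint becomes
      \<open>a \<le> r * c\<close>, with equality for the rule on \<open>S\<close>.\<close>
    define r where "r = \<alpha> / (1 - \<alpha>)"
    have \<alpha>1: "\<alpha> < 1" using \<alpha> \<pi>1 by simp
    have a_le: "a \<le> r * c" and q0_eq: "q0 = r * q1"
      using level_K level \<alpha>1 by (simp_all add: r_def field_simps)
    have "(1 - \<kappa> * r) * c \<le> (1 - \<kappa> * r) * q1"
    proof -
      have "(1 - \<kappa> * r) * c \<le> c - \<kappa> * a"
        using mult_left_mono[OF a_le less_imp_le[OF \<kappa>]] by (simp add: algebra_simps)
      also have "\<dots> \<le> (1 - \<kappa> * r) * q1" using NPK by (simp add: q0_eq algebra_simps)
      finally show ?thesis .
    qed
    moreover have "0 < 1 - \<kappa> * r"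
    proof -
      have "0 < (1 - \<kappa> * r) * q1" using slope(1) by (simp add: q0_eq algebra_simps)
      then show ?thesis using q1_pos by (simp add: zero_less_mult_iff)
    qed
    ultimately have c_le: "c \<le> q1" by simp
    \<comment> \<open>If everything were rejected, the marginal false discovery rate would be
      \<open>1 - \<pi>1\<close>, above \<alpha>.\<close>
    have ac_lt: "a + c < 1"
    proof (rule ccontr)
      assume "\<not> ?thesis"
      then have "a = 1 - \<pi>1" "a + c = 1" using ac' by auto
      then show False using level_K \<alpha> by simp
    qed
    have "(\<pi>1 - q1) / ((\<pi>1 - q1) + (1 - \<pi>1 - q0)) \<le> (\<pi>1 - c) / ((\<pi>1 - c) + (1 - \<pi>1 - a))"
    proof (rule ratio_mono_of_slope[where \<kappa>=\<kappa>])
      show "\<pi>1 - q1 + \<kappa> * (1 - \<pi>1 - a - (1 - \<pi>1 - q0)) \<le> \<pi>1 - c"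
        using NPK by (simp add: algebra_simps)
    qed (use ac ac' ac_lt q_le q0_lt slope c_le in auto)
    then show ?thesis unfolding mFNR by (simp add: algebra_simps)
  qed
  have mem: "mFDR \<pi>1 f0 f1 n KS \<le> \<alpha>"
  proof -
    have "mFDR \<pi>1 f0 f1 n KS = q0 / (q0 + q1)"
      using n by (simp add: mFDR_eq[OF KS] rej_KS distrib_left[symmetric])
    also have "\<dots> = \<alpha>" using level q1_pos q_nonneg by (simp add: field_simps)
    finally show ?thesis by simp
  qed
  have val: "mFNR \<pi>1 f0 f1 n KS = (\<pi>1 - q1) / (1 - (q0 + q1))"
  proof -
    have "mFNR \<pi>1 f0 f1 n KS = (n * (\<pi>1 - q1)) / (n * (1 - (q0 + q1)))"
      by (simp add: mFNR_eq[OF KS] rej_KS algebra_simps)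
    then show ?thesis using n by simp
  qed
  show ?thesis
    unfolding mFNR_opt_def
  proof (rule cInf_eq_minimum)
    show "(\<pi>1 - q1) / (1 - (q0 + q1)) \<in> mFNR \<pi>1 f0 f1 n ` {K \<in> decision_rules n. mFDR \<pi>1 f0 f1 n K \<le> \<alpha>}"
      using KS mem val by (intro image_eqI[where x=KS]) auto
  qed (use bound in auto)
qed

end

section \<open>Decreasing alternatives\<close>

locale decreasing_alternative = two_group_model \<pi>1 "indicator {0<..<1}" f1
  for \<pi>1 :: real and f1 :: "real \<Rightarrow> real" +
  assumes f1_zero: "\<And>x. x \<notin> {0<..<1} \<Longrightarrow> f1 x = 0"
    and f1_strict: "strict_antimono_on {0<..<1} f1"
begin

definition F1 :: "real \<Rightarrow> real" where "F1 = cdf (obs_law True)"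
text \<open>The distribution function of the mixture on the unit interval only: the uniform part is
  written as a linear function, which cancels in the chord inequalities.\<close>

definition Fmix :: "real \<Rightarrow> real" where "Fmix t = (1 - \<pi>1) * t + \<pi>1 * F1 t"

lemma f1_less: "0 < s \<Longrightarrow> s < t \<Longrightarrow> t < 1 \<Longrightarrow> f1 t < f1 s"
  using f1_strict by (auto simp: monotone_on_def)

text \<open>A zero inside the interval would force negative values to its right, by strict
  decrease.\<close>

lemma f1_pos:
  assumes "0 < t" "t < 1"
  shows "0 < f1 t"
  using f1_less[of t "(t + 1) / 2"] dens_nonneg(2)[of "(t + 1) / 2"] assms by simp

lemma real_distribution_obs_law: "real_distribution (obs_law b)"
  using prob_space_obs_law by (simp add: real_distribution_def real_distribution_axioms_def)

lemma isCont_cdf_obs_law: "isCont (cdf (obs_law b)) x"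
proof -
  interpret real_distribution "obs_law b" by (rule real_distribution_obs_law)
  have "emeasure (obs_law b) {x} = (\<integral>\<^sup>+y. ennreal ((if b then f1 else indicator {0<..<1}) y) * indicator {x} y \<partial>lborel)"
    unfolding obs_law_def by (rule emeasure_density) auto
  also have "\<dots> = 0"
    by (subst nn_integral_0_iff_AE) (auto intro!: AE_I'[of "{x}"] simp: indicator_def)
  finally show ?thesis by (simp add: isCont_cdf measure_def)
qed

lemma cdf_obs_law_diff:
  assumes "s < t"
  shows "ennreal (cdf (obs_law b) t - cdf (obs_law b) s)
    = (\<integral>\<^sup>+x. ennreal ((if b then f1 else indicator {0<..<1}) x) * indicator {s<..t} x \<partial>lborel)"
proof -
  interpret real_distribution "obs_law b" by (rule real_distribution_obs_law)
  have "ennreal (cdf (obs_law b) t - cdf (obs_law b) s) = emeasure (obs_law b) {s<..t}"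
    using assms by (simp add: cdf_diff_eq emeasure_eq_measure)
  also have "\<dots> = (\<integral>\<^sup>+x. ennreal ((if b then f1 else indicator {0<..<1}) x) * indicator {s<..t} x \<partial>lborel)"
    unfolding obs_law_def by (rule emeasure_density) auto
  finally show ?thesis .
qed

lemma cdf_obs_law_nonpos: "t \<le> 0 \<Longrightarrow> cdf (obs_law b) t = 0"
proof -
  assume "t \<le> 0"
  interpret real_distribution "obs_law b" by (rule real_distribution_obs_law)
  have "emeasure (obs_law b) {..t}
    = (\<integral>\<^sup>+x. ennreal ((if b then f1 else indicator {0<..<1}) x) * indicator {..t} x \<partial>lborel)"
    unfolding obs_law_def by (rule emeasure_density) auto
  also have "\<dots> = (\<integral>\<^sup>+(x::real). 0 \<partial>lborel)"
    by (intro nn_integral_cong) (use \<open>t \<le> 0\<close> f1_zero in \<open>auto simp: indicator_def\<close>)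
  finally show ?thesis by (simp add: cdf_def measure_def)
qed

lemma F1_0: "F1 0 = 0" by (simp add: F1_def cdf_obs_law_nonpos)

lemma F1_1: "F1 1 = 1"
proof -
  interpret real_distribution "obs_law True" by (rule real_distribution_obs_law)
  have "ennreal (F1 1 - F1 0) = (\<integral>\<^sup>+x. ennreal (f1 x) * indicator {0<..1} x \<partial>lborel)"
    unfolding F1_def by (subst cdf_obs_law_diff) auto
  also have "\<dots> = (\<integral>\<^sup>+x. ennreal (f1 x) \<partial>lborel)"
    using f1_zero by (intro nn_integral_cong) (auto simp: indicator_def)
  also have "\<dots> = 1" using dens1 by (simp add: is_density_def)
  finally show ?thesis by (simp add: F1_0)
qed

lemma F0_eq:
  assumes "0 \<le> t" "t \<le> 1"
  shows "cdf (obs_law False) t = t"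
proof (cases "t = 0")
  case False
  then have t: "0 < t" using assms by simp
  interpret real_distribution "obs_law False" by (rule real_distribution_obs_law)
  have "ennreal (cdf (obs_law False) t) = ennreal (cdf (obs_law False) t - cdf (obs_law False) 0)"
    by (simp add: cdf_obs_law_nonpos)
  also have "\<dots> = (\<integral>\<^sup>+x. ennreal (indicator {0<..<1} x) * indicator {0<..t} x \<partial>lborel)"
    using t by (subst cdf_obs_law_diff) auto
  also have "\<dots> = (\<integral>\<^sup>+x. indicator {0<..<t} x \<partial>lborel)"
    using assms by (intro nn_integral_cong_AE AE_I'[of "{t}"]) (auto simp: indicator_def)
  also have "\<dots> = ennreal t" using t by simp
  finally show ?thesis using cdf_nonneg assms by simp
qed (simp add: cdf_obs_law_nonpos)

text \<open>The density on the interval is at least its value at the right end. The left end may be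
  0, where \<open>f1\<close> is 0, since the interval is open there.\<close>

lemma F1_diff_ge:
  assumes "0 \<le> s" "s < t" "t < 1"
  shows "(t - s) * f1 t \<le> F1 t - F1 s"
proof -
  interpret real_distribution "obs_law True" by (rule real_distribution_obs_law)
  have le: "f1 t \<le> f1 x" if "s < x" "x \<le> t" for x
    using f1_less[of x t] that assms by (cases "x = t") auto
  have "ennreal ((t - s) * f1 t) = (\<integral>\<^sup>+x. ennreal (f1 t) * indicator {s<..t} x \<partial>lborel)"
    using assms dens_nonneg[of t] by (simp add: nn_integral_cmult ennreal_mult mult.commute)
  also have "\<dots> \<le> (\<integral>\<^sup>+x. ennreal (f1 x) * indicator {s<..t} x \<partial>lborel)"
    using le by (intro nn_integral_mono) (auto simp: indicator_def intro!: ennreal_leI)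
  also have "\<dots> = ennreal (F1 t - F1 s)"
    unfolding F1_def using assms by (subst cdf_obs_law_diff) auto
  finally show ?thesis
    using cdf_nondecreasing[of s t] assms by (simp add: F1_def)
qed

text \<open>Now the bound is the value at the left end, so \<open>s\<close> is positive, while the
  right end may be 1, where \<open>f1\<close> vanishes.\<close>

lemma F1_diff_le:
  assumes "0 < s" "s < t" "t \<le> 1"
  shows "F1 t - F1 s \<le> (t - s) * f1 s"
proof -
  have le: "f1 x \<le> f1 s" if "s < x" "x \<le> t" for x
    using f1_less[of s x] that assms f1_zero[of x] dens_nonneg[of s] by (cases "x = 1") auto
  have "ennreal (F1 t - F1 s) = (\<integral>\<^sup>+x. ennreal (f1 x) * indicator {s<..t} x \<partial>lborel)"
    unfolding F1_def using assms by (subst cdf_obs_law_diff) auto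
  also have "\<dots> \<le> (\<integral>\<^sup>+x. ennreal (f1 s) * indicator {s<..t} x \<partial>lborel)"
    using le by (intro nn_integral_mono) (auto simp: indicator_def intro!: ennreal_leI)
  also have "\<dots> = ennreal ((t - s) * f1 s)"
    using assms dens_nonneg[of s] by (simp add: nn_integral_cmult ennreal_mult mult.commute)
  finally show ?thesis
    using assms dens_nonneg[of s] by (subst (asm) ennreal_le_iff) auto
qed

text \<open>Strictness comes from the left half of the interval: there the density is at least
  \<open>f1 (t / 2)\<close>, which exceeds \<open>f1 t\<close>.\<close>

lemma F1_gt:
  assumes "0 < t" "t < 1"
  shows "t * f1 t < F1 t"
proof -
  have "t * f1 t < (t / 2) * f1 (t / 2) + (t - t / 2) * f1 t"
    using f1_less[of "t / 2" t] assms by (simp add: field_simps)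
  also have "\<dots> \<le> F1 t"
    using F1_diff_ge[of 0 "t / 2"] F1_diff_ge[of "t / 2" t] assms by (simp add: F1_0)
  finally show ?thesis .
qed

text \<open>Beyond \<open>s\<close> the growth rate is at most \<open>f1 s\<close>, which is below
  the mean rate \<open>F1 s / s\<close> up to \<open>s\<close>, so the mean rate falls
  strictly.\<close>

lemma F1_chord:
  assumes "0 < s" "s < t" "t \<le> 1"
  shows "F1 t * s < F1 s * t"
proof -
  have "s * (F1 t - F1 s) \<le> s * ((t - s) * f1 s)"
    using F1_diff_le[OF assms] assms by (intro mult_left_mono) auto
  also have "\<dots> = (t - s) * (s * f1 s)" by simp
  also have "\<dots> < (t - s) * F1 s" using F1_gt[of s] assms by (intro mult_strict_left_mono) auto
  finally show ?thesis by (simp add: algebra_simps)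
qed

lemma Fmix_chord:
  assumes "0 < s" "s < t" "t \<le> 1"
  shows "Fmix t * s < Fmix s * t"
  using mult_strict_left_mono[OF F1_chord[OF assms] \<pi>1(1)] by (simp add: Fmix_def algebra_simps)

lemma isCont_Fmix: "isCont Fmix t"
  unfolding Fmix_def[abs_def] F1_def using isCont_cdf_obs_law[of t True] by (intro continuous_intros)

text \<open>As the density decreases, \<open>Fmix t0\<close> is at least \<open>t0\<close> times the
  mixture density at \<open>t0\<close>, hence above \<open>\<rho> * t0\<close>; at 1 it is 1, below
  \<rho>. The intermediate value theorem gives the crossing, which is not at 1.\<close>

lemma threshold_exists:
  assumes \<rho>: "1 < \<rho>" and t0: "0 < t0" "t0 < 1" "\<rho> < 1 - \<pi>1 + \<pi>1 * f1 t0"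
  obtains t where "0 < t" "t < 1" "Fmix t = \<rho> * t"
proof -
  have "t0 * \<rho> < t0 * (1 - \<pi>1 + \<pi>1 * f1 t0)" using t0 by simp
  also have "\<dots> = (1 - \<pi>1) * t0 + \<pi>1 * (t0 * f1 t0)" by (simp add: algebra_simps)
  also have "\<dots> \<le> Fmix t0"
    unfolding Fmix_def using F1_gt[of t0] t0 \<pi>1 by (intro add_left_mono mult_left_mono) auto
  finally have h0: "0 < Fmix t0 - \<rho> * t0" by (simp add: mult.commute)
  have h1: "Fmix 1 - \<rho> * 1 < 0" using \<rho> by (simp add: Fmix_def F1_1)
  have "\<exists>t\<ge>t0. t \<le> 1 \<and> Fmix t - \<rho> * t = 0"
    using h0 h1 t0 isCont_Fmix by (intro IVT2) (auto intro!: continuous_intros)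
  then obtain t where t: "t0 \<le> t" "t \<le> 1" "Fmix t - \<rho> * t = 0" by blast
  then have "t \<noteq> 1" using h1 by auto
  then show thesis using that[of t] t t0 by auto
qed

lemma cdf_ratio_less:
  assumes "Fmix t = \<rho> * t" "0 < s" "s < t" "t \<le> 1"
  shows "\<rho> * s < Fmix s"
proof -
  have "(\<rho> * s) * t < Fmix s * t" using Fmix_chord[of s t] assms by (simp add: mult_ac)
  then show ?thesis using assms by simp
qed

lemma cdf_ratio_greater:
  assumes "Fmix t = \<rho> * t" "0 < t" "t < u" "u \<le> 1"
  shows "Fmix u < \<rho> * u"
proof -
  have "Fmix u * t < (\<rho> * u) * t" using Fmix_chord[of t u] assms by (simp add: mult_ac)
  then show ?thesis using assms by simp
qed

text \<open>\<kappa> is the posterior odds at \<open>t\<close>. Inside the unit interval both sides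
  have the same denominator and the comparison reduces to \<open>f1 x\<close> against
  \<open>f1 t\<close>. Outside it the posterior is 0, so the region has to leave out all
  \<open>x \<le> 0\<close>.\<close>

lemma posterior_threshold:
  assumes t: "0 < t" "t < 1"
  defines "\<kappa> \<equiv> \<pi>1 * f1 t / (1 - \<pi>1)"
  shows "x \<in> {0<..t} \<Longrightarrow> \<kappa> * (1 - posterior x) \<le> posterior x"
    and "x \<notin> {0<..t} \<Longrightarrow> posterior x \<le> \<kappa> * (1 - posterior x)"
proof -
  have post: "posterior x = \<pi>1 * f1 x / (\<pi>1 * f1 x + (1 - \<pi>1))"
    "\<kappa> * (1 - posterior x) = \<pi>1 * f1 t / (\<pi>1 * f1 x + (1 - \<pi>1))" if "0 < x" "x < 1"
  proof -
    have d: "0 < \<pi>1 * f1 x + (1 - \<pi>1)" using f1_pos[OF that] \<pi>1 by (simp add: add_pos_pos)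
    show p: "posterior x = \<pi>1 * f1 x / (\<pi>1 * f1 x + (1 - \<pi>1))"
      using that by (simp add: posterior_def)
    show "\<kappa> * (1 - posterior x) = \<pi>1 * f1 t / (\<pi>1 * f1 x + (1 - \<pi>1))"
      unfolding p \<kappa>_def using d \<pi>1 by (simp add: divide_simps)
  qed
  have mono: "\<pi>1 * f1 a / (\<pi>1 * f1 x + (1 - \<pi>1)) \<le> \<pi>1 * f1 b / (\<pi>1 * f1 x + (1 - \<pi>1))" if "f1 a \<le> f1 b" for a b
    using that \<pi>1 dens_nonneg(2)[of x] by (intro divide_right_mono mult_left_mono) auto
  show "\<kappa> * (1 - posterior x) \<le> posterior x" if "x \<in> {0<..t}"
  proof -
    have "f1 t \<le> f1 x" using f1_less[of x t] that t by (cases "x = t") auto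
    then show ?thesis using mono[of t x] post that t by simp
  qed
  show "posterior x \<le> \<kappa> * (1 - posterior x)" if "x \<notin> {0<..t}"
  proof (cases "0 < x \<and> x < 1")
    case True
    then have "f1 x \<le> f1 t" using f1_less[of t x] that t by auto
    then show ?thesis using mono[of x t] post True by simp
  next
    case False
    then have "posterior x = 0" using f1_zero[of x] by (simp add: posterior_def)
    then show ?thesis using f1_pos[OF t] \<pi>1 by (simp add: \<kappa>_def)
  qed
qed

lemma pair_prob_le:
  "pair_prob (\<lambda>b x. B b \<and> x \<le> s) = \<pi>1 * of_bool (B True) * F1 s
     + (1 - \<pi>1) * of_bool (B False) * cdf (obs_law False) s"
proof -
  have "measure (obs_law b) {x. B b \<and> x \<le> s} = of_bool (B b) * cdf (obs_law b) s" for b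
    by (cases "B b") (simp_all add: cdf_def atMost_def)
  then show ?thesis by (simp add: pair_prob_def F1_def)
qed

text \<open>No mass lies at or below 0, so the region of the optimality argument and the half-line
  of the counts have equal probabilities.\<close>

lemma pair_prob_Ioc:
  assumes "0 < t"
  shows "pair_prob (\<lambda>b x. B b \<and> x \<in> {0<..t}) = pair_prob (\<lambda>b x. B b \<and> x \<le> t)"
proof -
  have "measure (obs_law b) {0<..t} = measure (obs_law b) {..t}" for b
  proof -
    interpret real_distribution "obs_law b" by (rule real_distribution_obs_law)
    show ?thesis using cdf_diff_eq[OF assms] cdf_obs_law_nonpos[of 0 b] by (simp add: cdf_def)
  qed
  then have "measure (obs_law b) {x. B b \<and> x \<in> {0<..t}} = measure (obs_law b) {x. B b \<and> x \<le> t}" for b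
    by (cases "B b") (simp_all add: atMost_def greaterThanAtMost_def greaterThan_def Collect_conj_eq)
  then show ?thesis by (simp add: pair_prob_def)
qed

end

text \<open>Monotonicity turns a value near the supremum at one point into a lower bound on
  everything to its left. Extended reals admit an unbounded density.\<close>

lemma Lim_at_right_antimono:
  fixes f :: "real \<Rightarrow> real"
  assumes "0 < b" and mono: "\<And>x y. 0 < x \<Longrightarrow> x \<le> y \<Longrightarrow> y < b \<Longrightarrow> f y \<le> f x"
  shows "Lim (at_right 0) (\<lambda>x. ereal (f x)) = (SUP x\<in>{0<..<b}. ereal (f x))"
proof (rule tendsto_Lim)
  show "((\<lambda>x. ereal (f x)) \<longlongrightarrow> (SUP x\<in>{0<..<b}. ereal (f x))) (at_right 0)"
  proof (rule order_tendstoI)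
    fix a assume "a < (SUP x\<in>{0<..<b}. ereal (f x))"
    then obtain y where y: "0 < y" "y < b" "a < ereal (f y)" by (auto simp: less_SUP_iff)
    have "eventually (\<lambda>x. x \<in> {0<..<y}) (at_right (0::real))"
      using y(1) by (rule eventually_at_right_real)
    then show "eventually (\<lambda>x. a < ereal (f x)) (at_right 0)"
    proof eventually_elim
      case (elim x)
      then have "f y \<le> f x" using mono[of x y] y by auto
      then show ?case using y(3) by (meson ereal_less_eq(3) less_le_trans)
    qed
  next
    fix a assume a: "(SUP x\<in>{0<..<b}. ereal (f x)) < a"
    have "eventually (\<lambda>x. x \<in> {0<..<b}) (at_right (0::real))"
      using assms(1) by (rule eventually_at_right_real)
    then show "eventually (\<lambda>x. ereal (f x) < a) (at_right 0)"
      by eventually_elim (use a in \<open>meson SUP_upper le_less_trans\<close>)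
  qed
qed simp

section \<open>Asymptotics of the Benjamini-Hochberg rule\<close>

text \<open>\<open>Z\<close> has to agree with \<phi> of \<open>X\<close> and \<open>Y\<close> only
  near the limit point and for large \<open>n\<close>. This suits FDP and FNP, where the maximum
  with 1 in the denominator is inactive there.\<close>

lemma conv_in_prob_continuous:
  fixes X Y Z :: "nat \<Rightarrow> 'a \<Rightarrow> real" and \<phi> :: "real \<times> real \<Rightarrow> real"
  assumes N: "\<And>n. prob_space (N n)"
    and X: "\<And>n. X n \<in> borel_measurable (N n)" "conv_in_prob N X x"
    and Y: "\<And>n. Y n \<in> borel_measurable (N n)" "conv_in_prob N Y y"
    and Z: "\<And>n. Z n \<in> borel_measurable (N n)"
    and \<phi>: "isCont \<phi> (x, y)"
    and d: "0 < d"
    and eq: "eventually (\<lambda>n. \<forall>\<omega>\<in>space (N n). \<bar>X n \<omega> - x\<bar> \<le> d \<longrightarrow> \<bar>Y n \<omega> - y\<bar> \<le> d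
      \<longrightarrow> Z n \<omega> = \<phi> (X n \<omega>, Y n \<omega>)) sequentially"
  shows "conv_in_prob N Z (\<phi> (x, y))"
  unfolding conv_in_prob_iff_whp[OF Z]
proof (intro allI impI)
  fix \<epsilon> :: real assume "0 < \<epsilon>"
  then obtain \<delta> where \<delta>: "0 < \<delta>" "\<And>p. dist p (x, y) < \<delta> \<Longrightarrow> dist (\<phi> p) (\<phi> (x, y)) < \<epsilon>"
    using \<phi> by (auto simp: continuous_at_eps_delta)
  \<comment> \<open>Two coordinate errors of at most \<open>\<delta> / 3\<close> keep the distance
    below \<delta>; the minimum with \<open>d\<close> makes \<open>eq\<close> applicable.\<close>
  define e where "e = min d (\<delta> / 3)"
  have e: "0 < e" using d \<delta> by (simp add: e_def)
  have close: "\<bar>\<phi> (a, b) - \<phi> (x, y)\<bar> \<le> \<epsilon>" if "\<bar>a - x\<bar> \<le> e" "\<bar>b - y\<bar> \<le> e" for a b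
  proof -
    have "dist (a, b) (x, y) \<le> \<bar>a - x\<bar> + \<bar>b - y\<bar>"
      unfolding dist_prod_def dist_real_def fst_conv snd_conv
      using sqrt_sum_squares_le_sum_abs[of "\<bar>a - x\<bar>" "\<bar>b - y\<bar>"] by simp
    also have "\<dots> \<le> e + e" using that by simp
    also have "\<dots> < \<delta>" using \<delta> by (simp add: e_def)
    finally show ?thesis using \<delta>(2)[of "(a, b)"] by (simp add: dist_real_def)
  qed
  have "whp N (\<lambda>n \<omega>. \<bar>X n \<omega> - x\<bar> \<le> e \<and> \<bar>Y n \<omega> - y\<bar> \<le> e)"
    using X(2) Y(2) e unfolding conv_in_prob_iff_whp[OF X(1)] conv_in_prob_iff_whp[OF Y(1)]
    by (intro whp_conj N) auto
  then show "whp N (\<lambda>n \<omega>. \<bar>Z n \<omega> - \<phi> (x, y)\<bar> \<le> \<epsilon>)"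
  proof (rule whp_mono[OF N])
    fix n
    note [measurable] = Z[of n]
    show "Measurable.pred (N n) (\<lambda>\<omega>. \<bar>Z n \<omega> - \<phi> (x, y)\<bar> \<le> \<epsilon>)" by measurable
  next
    show "\<forall>\<^sub>F n in sequentially. \<forall>\<omega>\<in>space (N n). \<bar>X n \<omega> - x\<bar> \<le> e \<and> \<bar>Y n \<omega> - y\<bar> \<le> e
      \<longrightarrow> \<bar>Z n \<omega> - \<phi> (x, y)\<bar> \<le> \<epsilon>"
      using eq by eventually_elim (use close in \<open>auto simp: e_def\<close>)
  qed
qed

lemma half_le:
  fixes x b :: real
  assumes "\<bar>x - b\<bar> \<le> b / 2"
  shows "b / 2 \<le> x"
  using abs_le_D2[OF assms] by simp

lemma half_gap_le_compl:
  fixes x b :: real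
  assumes "\<bar>x - b\<bar> \<le> (1 - b) / 2"
  shows "(1 - b) / 2 \<le> 1 - x"
  using abs_le_D1[OF assms] by (simp add: field_simps)

text \<open>The form without order statistics involves finitely many \<open>k\<close> and counts at
  fixed critical values, each a finite sum of indicators.\<close>

lemma measurable_BH_decision:
  assumes "0 < \<pi>0" "0 < \<alpha>"
  shows "BH_decision \<pi>0 \<alpha> n \<in> obs_space n \<rightarrow>\<^sub>M decision_space n"
proof (rule measurable_decision)
  fix i assume i: "i < n"
  have [measurable]: "(\<lambda>x. x j) \<in> obs_space n \<rightarrow>\<^sub>M borel" if "j < n" for j
    using that by (intro measurable_component_singleton) simp
  have le: "k \<le> count_le n x c \<longleftrightarrow> real k \<le> (\<Sum>j<n. if x j \<le> c then 1 else 0)" for k x c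
  proof -
    have "(\<Sum>j<n. if x j \<le> c then 1 else 0 :: real) = real (card {j. j < n \<and> x j \<le> c})"
      by (simp add: sum.If_cases Int_def)
    then show ?thesis by (simp add: count_le_def)
  qed
  have [measurable]: "Measurable.pred (obs_space n) (\<lambda>x. k \<le> count_le n x c)" for k c
    unfolding le by measurable
  show "Measurable.pred (obs_space n) (\<lambda>x. BH_decision \<pi>0 \<alpha> n x i)"
    unfolding BH_decision_iff[OF assms(1) less_imp_le[OF assms(2)] i] using i by measurable
qed (simp add: BH_decision_def)

context decreasing_alternative
begin

lemma count_le_eq: "real (count_le n (snd \<omega>) t) = count_pairs n (\<lambda>b x. x \<le> t) \<omega>"
  by (simp add: count_le_def count_pairs_def Int_def)

lemma pair_prob_le_Fmix: "0 \<le> t \<Longrightarrow> t \<le> 1 \<Longrightarrow> pair_prob (\<lambda>b x. x \<le> t) = Fmix t"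
  using pair_prob_le[of "\<lambda>_. True" t] by (simp add: F0_eq Fmix_def)

section \<open>The rejection set squeezed around the crossing point \<open>t\<close>\<close>

context
  fixes \<alpha> t :: real
  assumes \<alpha>: "0 < \<alpha>" "\<alpha> < 1 - \<pi>1" and t: "0 < t" "t < 1"
    and threshold: "Fmix t = (1 - \<pi>1) / \<alpha> * t"
begin

abbreviation "\<rho> \<equiv> (1 - \<pi>1) / \<alpha>"
abbreviation "bh n \<equiv> BH_decision (1 - \<pi>1) \<alpha> n"

lemma \<rho>_gt_1: "1 < \<rho>" using \<alpha> by simp

lemma bh_measurable: "bh n \<in> obs_space n \<rightarrow>\<^sub>M decision_space n"
  using \<pi>1 \<alpha> by (intro measurable_BH_decision) auto

lemma pred_bh [measurable]: "Measurable.pred (TG_space n) (\<lambda>\<omega>. bh n (snd \<omega>) i)"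
proof -
  have "(\<lambda>d. d i) \<in> decision_space n \<rightarrow>\<^sub>M count_space UNIV" by simp
  from measurable_compose[OF measurable_compose[OF measurable_snd bh_measurable] this]
  show ?thesis .
qed

text \<open>\<open>Fmix s\<close> exceeds \<open>\<rho> * s\<close> by a fixed \<open>e\<close>, so
  the law of large numbers at this single point meets the criterion of
  \<open>BH_decision_lower\<close>.\<close>

lemma bh_lower:
  assumes s: "0 < s" "s < t"
  shows "whp TG (\<lambda>n \<omega>. \<forall>i<n. snd \<omega> i \<le> s \<longrightarrow> bh n (snd \<omega>) i)"
proof -
  define e where "e = Fmix s - \<rho> * s"
  have e: "0 < e" using cdf_ratio_less[OF threshold] s t by (simp add: e_def)
  have "conv_in_prob TG (\<lambda>n \<omega>. count_pairs n (\<lambda>b x. x \<le> s) \<omega> / n) (Fmix s)"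
    using count_pairs_lln[of "\<lambda>b x. x \<le> s"] s t by (simp add: pair_prob_le_Fmix)
  then have "whp TG (\<lambda>n \<omega>. \<bar>count_pairs n (\<lambda>b x. x \<le> s) \<omega> / n - Fmix s\<bar> \<le> e)"
    using e by (subst (asm) conv_in_prob_iff_whp) auto
  then show ?thesis
  proof (rule whp_mono[OF prob_space_two_group])
    show "Measurable.pred (TG n) (\<lambda>\<omega>. \<forall>i<n. snd \<omega> i \<le> s \<longrightarrow> bh n (snd \<omega>) i)" for n
    proof -
      have "(\<forall>i<n. snd \<omega> i \<le> s \<longrightarrow> bh n (snd \<omega>) i) \<longleftrightarrow> (\<forall>i\<in>{..<n}. snd \<omega> i \<le> s \<longrightarrow> bh n (snd \<omega>) i)"
        for \<omega> :: "(nat \<Rightarrow> bool) \<times> (nat \<Rightarrow> real)" by auto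
      then show ?thesis by simp
    qed
    show "\<forall>\<^sub>F n in sequentially. \<forall>\<omega>\<in>space (TG n). \<bar>count_pairs n (\<lambda>b x. x \<le> s) \<omega> / n - Fmix s\<bar> \<le> e
      \<longrightarrow> (\<forall>i<n. snd \<omega> i \<le> s \<longrightarrow> bh n (snd \<omega>) i)"
    proof (intro always_eventually allI ballI impI)
      fix n \<omega> i
      assume *: "\<bar>count_pairs n (\<lambda>b x. x \<le> s) \<omega> / real n - Fmix s\<bar> \<le> e" "i < n" "snd \<omega> i \<le> s"
      have "s * \<rho> \<le> count_le n (snd \<omega>) s / n"
        using *(1) by (simp add: e_def count_le_eq mult.commute abs_le_iff)
      then show "bh n (snd \<omega>) i"
        using * \<pi>1 \<alpha> by (intro BH_decision_lower[where t=s]) auto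
    qed
  qed
qed

text \<open>The criterion must hold at all \<open>v > u\<close> simultaneously. From 1 on it is
  trivial as \<rho> exceeds 1. Before 1 the quotient \<open>Fmix v / v\<close> is at most
  \<open>c\<close>, its value at \<open>u\<close>, and the gap \<open>(\<rho> - c) * v\<close> is at
  least \<open>2 * e\<close>: one \<open>e\<close> pays for the sampling error at the grid points,
  the other for rounding \<open>v\<close> up to the next grid point.\<close>

lemma bh_upper:
  assumes u: "t < u" "u < 1"
  shows "whp TG (\<lambda>n \<omega>. \<forall>i<n. bh n (snd \<omega>) i \<longrightarrow> snd \<omega> i \<le> u)"
proof -
  define c where "c = Fmix u / u"
  have Fu: "Fmix u < \<rho> * u" using cdf_ratio_greater[OF threshold] u t by simp
  have c_less: "c < \<rho>" using Fu u t by (simp add: c_def divide_less_eq)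
  have "0 \<le> F1 u" using real_distribution_obs_law[of True]
    by (simp add: F1_def real_distribution.axioms(1) cdf_def)
  then have c_nonneg: "0 \<le> c" using u t \<pi>1 by (auto simp: c_def Fmix_def)
  have Fmix_le: "Fmix v \<le> c * v" if "u \<le> v" "v \<le> 1" for v
  proof (cases "u = v")
    case False
    then have "Fmix v * u < Fmix u * v" using that u t by (intro Fmix_chord) auto
    then show ?thesis using u t by (simp add: c_def field_simps)
  qed (use u t in \<open>simp add: c_def\<close>)
  define e where "e = (\<rho> - c) * u / 2"
  have e: "0 < e" using c_less u t by (simp add: e_def)
  \<comment> \<open>The numerator \<open>c + 1\<close> makes \<open>c / M < e\<close> strict, which
    bounds the growth of \<open>c * v\<close> over one grid step; the last \<open>+ 1\<close> makes
    \<open>M\<close> positive at once.\<close>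
  define M where "M = nat \<lceil>(c + 1) / e\<rceil> + 1"
  have M: "0 < M" by (simp add: M_def)
  have cM: "c / M < e"
  proof -
    have "(c + 1) / e \<le> real M" unfolding M_def using real_nat_ceiling_ge[of "(c + 1) / e"] by simp
    then have "c + 1 \<le> e * M" using e by (simp add: divide_le_eq mult.commute)
    then have "c < e * M" by simp
    then show ?thesis using M by (simp add: divide_less_eq)
  qed
  have "whp TG (\<lambda>n \<omega>. \<forall>k\<in>{..M}. \<bar>count_pairs n (\<lambda>b x. x \<le> real k / M) \<omega> / n - Fmix (real k / M)\<bar> \<le> e)"
  proof (rule whp_ball_finite[OF prob_space_two_group])
    fix k assume "k \<in> {..M}"
    then have k: "real k / M \<le> 1" using M by simp
    have "conv_in_prob TG (\<lambda>n \<omega>. count_pairs n (\<lambda>b x. x \<le> real k / M) \<omega> / n) (Fmix (real k / M))"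
      using count_pairs_lln[of "\<lambda>b x. x \<le> real k / M"] k by (simp add: pair_prob_le_Fmix)
    then show "whp TG (\<lambda>n \<omega>. \<bar>count_pairs n (\<lambda>b x. x \<le> real k / M) \<omega> / n - Fmix (real k / M)\<bar> \<le> e)"
      using e by (subst (asm) conv_in_prob_iff_whp) auto
  qed simp
  then show ?thesis
  proof (rule whp_mono[OF prob_space_two_group])
    show "Measurable.pred (TG n) (\<lambda>\<omega>. \<forall>i<n. bh n (snd \<omega>) i \<longrightarrow> snd \<omega> i \<le> u)" for n
    proof -
      have "(\<forall>i<n. bh n (snd \<omega>) i \<longrightarrow> snd \<omega> i \<le> u) \<longleftrightarrow> (\<forall>i\<in>{..<n}. bh n (snd \<omega>) i \<longrightarrow> snd \<omega> i \<le> u)"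
        for \<omega> :: "(nat \<Rightarrow> bool) \<times> (nat \<Rightarrow> real)" by auto
      then show ?thesis by simp
    qed
    show "\<forall>\<^sub>F n in sequentially. \<forall>\<omega>\<in>space (TG n).
      (\<forall>k\<in>{..M}. \<bar>count_pairs n (\<lambda>b x. x \<le> real k / M) \<omega> / n - Fmix (real k / M)\<bar> \<le> e)
      \<longrightarrow> (\<forall>i<n. bh n (snd \<omega>) i \<longrightarrow> snd \<omega> i \<le> u)"
    proof (intro always_eventually allI ballI impI)
      fix n \<omega> i
      assume grid: "\<forall>k\<in>{..M}. \<bar>count_pairs n (\<lambda>b x. x \<le> real k / M) \<omega> / n - Fmix (real k / M)\<bar> \<le> e"
        and i: "i < n" "bh n (snd \<omega>) i"
      have "count_le n (snd \<omega>) v / n < v * \<rho>" if v: "u < v" for v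
      proof (cases "v < 1")
        case True
        \<comment> \<open>Rounding up can only increase the count, and \<open>v < 1\<close> keeps
          \<open>k\<close> within the grid.\<close>
        define k where "k = nat \<lceil>v * M\<rceil>"
        have vM: "0 < v * M" using v u t M by simp
        have k1: "v * M \<le> real k" unfolding k_def by (rule real_nat_ceiling_ge)
        have k2: "real k < v * M + 1" unfolding k_def using vM by linarith
        have kM: "k \<le> M"
        proof -
          have "v * M < real M" using True M by simp
          then have "\<lceil>v * M\<rceil> \<le> int M" by (simp add: ceiling_le_iff)
          then show ?thesis unfolding k_def by (simp only: nat_le_iff)
        qed
        have vk: "v \<le> real k / M" "real k / M < v + 1 / M"
          using k1 k2 M by (simp_all add: field_simps)
        have "count_le n (snd \<omega>) v / n \<le> count_le n (snd \<omega>) (real k / M) / n"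
          using count_le_mono[OF vk(1)] by (intro divide_right_mono) auto
        also have "\<dots> \<le> Fmix (real k / M) + e"
        proof -
          have "\<bar>count_pairs n (\<lambda>b x. x \<le> real k / M) \<omega> / n - Fmix (real k / M)\<bar> \<le> e"
            using grid kM by simp
          then show ?thesis unfolding count_le_eq abs_le_iff by linarith
        qed
        also have "\<dots> \<le> c * (real k / M) + e"
          using vk v kM M by (intro add_right_mono Fmix_le) auto
        also have "\<dots> \<le> c * (v + 1 / M) + e"
          using vk c_nonneg by (intro add_right_mono mult_left_mono) auto
        also have "\<dots> = c * v + c / M + e" by (simp add: algebra_simps)
        also have "\<dots> < c * v + e + e" using cM by simp
        also have "\<dots> = c * v + (\<rho> - c) * u" by (simp add: e_def)
        also have "\<dots> \<le> c * v + (\<rho> - c) * v" using c_less v by (intro add_left_mono mult_left_mono) auto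
        also have "\<dots> = v * \<rho>" by (simp add: algebra_simps)
        finally show ?thesis .
      next
        case False
        have "count_le n (snd \<omega>) v / n \<le> 1" using count_le_le[of n "snd \<omega>" v] i by (simp add: divide_le_eq)
        also have "\<dots> < \<rho>" by (rule \<rho>_gt_1)
        also have "\<dots> \<le> v * \<rho>" using False \<rho>_gt_1 mult_right_mono[of 1 v \<rho>] by simp
        finally show ?thesis .
      qed
      then show "snd \<omega> i \<le> u"
        using i \<pi>1 \<alpha> by (intro BH_decision_upper[of "1 - \<pi>1" \<alpha> i n "snd \<omega>" u]) auto
    qed
  qed
qed

text \<open>\<open>B\<close> selects the labels that count: \<open>Not\<close> gives false
  discoveries, the identity true discoveries, the constant \<open>True\<close> all
  rejections.\<close>

definition bh_count :: "nat \<Rightarrow> (bool \<Rightarrow> bool) \<Rightarrow> (nat \<Rightarrow> bool) \<times> (nat \<Rightarrow> real) \<Rightarrow> real" where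
  "bh_count n B \<omega> = (\<Sum>i<n. of_bool (bh n (snd \<omega>) i \<and> B (fst \<omega> i)))"

lemma measurable_bh_count [measurable]: "bh_count n B \<in> borel_measurable (TG_space n)"
proof -
  have "Measurable.pred (TG_space n) (\<lambda>\<omega>. B (fst \<omega> i))" for i
    by (rule measurable_compose[OF measurable_label]) simp
  then show ?thesis unfolding bh_count_def[abs_def] of_bool_def by measurable
qed

text \<open>With high probability the count lies between those for the thresholds \<open>s\<close>
  and \<open>u\<close>, whose limits are near that for \<open>t\<close> because the distribution
  functions have no jumps. Half of \<epsilon> is spent on continuity, half on the law of large
  numbers.\<close>

lemma bh_count_conv:
  "conv_in_prob TG (\<lambda>n \<omega>. bh_count n B \<omega> / n) (pair_prob (\<lambda>b x. B b \<and> x \<le> t))"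
proof (subst conv_in_prob_iff_whp, measurable, intro allI impI)
  fix \<epsilon> :: real assume \<epsilon>: "0 < \<epsilon>"
  define q where "q s = pair_prob (\<lambda>b x. B b \<and> x \<le> s)" for s
  have "isCont q t"
    unfolding q_def[abs_def] pair_prob_le F1_def using isCont_cdf_obs_law by (intro continuous_intros)
  then obtain \<delta> where \<delta>: "0 < \<delta>" "\<And>s. \<bar>s - t\<bar> < \<delta> \<Longrightarrow> \<bar>q s - q t\<bar> < \<epsilon> / 2"
    using \<epsilon> unfolding continuous_at_eps_delta dist_real_def by (meson half_gt_zero)
  \<comment> \<open>Small enough for continuity on both sides, with \<open>s\<close> kept above 0
    and \<open>u\<close> below 1.\<close>
  define h where "h = min (\<delta> / 2) (min (t / 2) ((1 - t) / 2))"
  define s where "s = t - h"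
  define u where "u = t + h"
  have h: "0 < h" "h < \<delta>" "h < t" "h < 1 - t" using \<delta>(1) t unfolding h_def min_def by (simp_all; linarith)+
  have s: "0 < s" "s < t" "\<bar>q s - q t\<bar> < \<epsilon> / 2" using h \<delta>(2)[of s] by (auto simp: s_def)
  have u: "t < u" "u < 1" "\<bar>q u - q t\<bar> < \<epsilon> / 2" using h \<delta>(2)[of u] by (auto simp: u_def)
  have lln: "whp TG (\<lambda>n \<omega>. \<bar>count_pairs n (\<lambda>b x. B b \<and> x \<le> v) \<omega> / n - q v\<bar> \<le> \<epsilon> / 2)" for v
  proof -
    have m: "Measurable.pred borel (\<lambda>x. B b \<and> x \<le> v)" for b by measurable
    have "conv_in_prob TG (\<lambda>n \<omega>. count_pairs n (\<lambda>b x. B b \<and> x \<le> v) \<omega> / n) (q v)"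
      unfolding q_def by (rule count_pairs_lln[of "\<lambda>b x. B b \<and> x \<le> v", OF m])
    then show ?thesis
      using half_gt_zero[OF \<epsilon>] m by (subst (asm) conv_in_prob_iff_whp) (measurable, blast)
  qed
  have "whp TG (\<lambda>n \<omega>. ((\<forall>i<n. snd \<omega> i \<le> s \<longrightarrow> bh n (snd \<omega>) i) \<and> (\<forall>i<n. bh n (snd \<omega>) i \<longrightarrow> snd \<omega> i \<le> u))
      \<and> \<bar>count_pairs n (\<lambda>b x. B b \<and> x \<le> s) \<omega> / n - q s\<bar> \<le> \<epsilon> / 2
      \<and> \<bar>count_pairs n (\<lambda>b x. B b \<and> x \<le> u) \<omega> / n - q u\<bar> \<le> \<epsilon> / 2)"
    using s u by (intro whp_conj prob_space_two_group bh_lower bh_upper lln)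
  then have "whp TG (\<lambda>n \<omega>. \<bar>bh_count n B \<omega> / n - q t\<bar> \<le> \<epsilon>)"
  proof (rule whp_mono[OF prob_space_two_group])
    show "\<forall>\<^sub>F n in sequentially. \<forall>\<omega>\<in>space (TG n).
      ((\<forall>i<n. snd \<omega> i \<le> s \<longrightarrow> bh n (snd \<omega>) i) \<and> (\<forall>i<n. bh n (snd \<omega>) i \<longrightarrow> snd \<omega> i \<le> u))
      \<and> \<bar>count_pairs n (\<lambda>b x. B b \<and> x \<le> s) \<omega> / n - q s\<bar> \<le> \<epsilon> / 2
      \<and> \<bar>count_pairs n (\<lambda>b x. B b \<and> x \<le> u) \<omega> / n - q u\<bar> \<le> \<epsilon> / 2
      \<longrightarrow> \<bar>bh_count n B \<omega> / n - q t\<bar> \<le> \<epsilon>"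
    proof (intro always_eventually allI ballI impI, elim conjE)
      fix n \<omega>
      assume *: "\<forall>i<n. snd \<omega> i \<le> s \<longrightarrow> bh n (snd \<omega>) i" "\<forall>i<n. bh n (snd \<omega>) i \<longrightarrow> snd \<omega> i \<le> u"
        and cs: "\<bar>count_pairs n (\<lambda>b x. B b \<and> x \<le> s) \<omega> / real n - q s\<bar> \<le> \<epsilon> / 2"
        and cu: "\<bar>count_pairs n (\<lambda>b x. B b \<and> x \<le> u) \<omega> / real n - q u\<bar> \<le> \<epsilon> / 2"
      have "count_pairs n (\<lambda>b x. B b \<and> x \<le> s) \<omega> \<le> bh_count n B \<omega>"
        "bh_count n B \<omega> \<le> count_pairs n (\<lambda>b x. B b \<and> x \<le> u) \<omega>"
        unfolding count_pairs_def bh_count_def using * by (intro sum_mono; auto)+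
      then have "count_pairs n (\<lambda>b x. B b \<and> x \<le> s) \<omega> / n \<le> bh_count n B \<omega> / n"
        "bh_count n B \<omega> / n \<le> count_pairs n (\<lambda>b x. B b \<and> x \<le> u) \<omega> / n"
        by (intro divide_right_mono; simp)+
      then show "\<bar>bh_count n B \<omega> / n - q t\<bar> \<le> \<epsilon>"
        using cs cu s(3) u(3) by linarith
    qed
  qed measurable
  then show "whp TG (\<lambda>n \<omega>. \<bar>bh_count n B \<omega> / n - pair_prob (\<lambda>b x. B b \<and> x \<le> t)\<bar> \<le> \<epsilon>)"
    by (simp add: q_def)
qed

lemma bh_count_bounds: "0 \<le> bh_count n B \<omega>" "bh_count n B \<omega> \<le> n"
proof -
  show "0 \<le> bh_count n B \<omega>" unfolding bh_count_def by (intro sum_nonneg) simp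
  have "bh_count n B \<omega> \<le> (\<Sum>i<n. 1)" unfolding bh_count_def by (intro sum_mono) simp
  then show "bh_count n B \<omega> \<le> n" by simp
qed

lemma expectation_bh_count:
  "(\<lambda>n. (\<integral>\<omega>. bh_count n B \<omega> \<partial>TG n) / n) \<longlonglongrightarrow> pair_prob (\<lambda>b x. B b \<and> x \<le> t)"
proof -
  have "(\<lambda>n. \<integral>\<omega>. bh_count n B \<omega> / n \<partial>TG n) \<longlonglongrightarrow> pair_prob (\<lambda>b x. B b \<and> x \<le> t)"
  proof (rule conv_in_prob_expectation[OF prob_space_two_group _ _ bh_count_conv])
    show "\<bar>bh_count n B \<omega> / n\<bar> \<le> 1" for n \<omega>
      using bh_count_bounds[of n B \<omega>] by (cases "n = 0") (simp_all add: divide_le_eq_1)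
  qed measurable
  then show ?thesis by simp
qed

lemma BH_eq: "BH (1 - \<pi>1) \<alpha> n = (\<lambda>x. return (decision_space n) (bh n x))"
  by (rule ext) (simp add: BH_def)

lemma BH_rule: "BH (1 - \<pi>1) \<alpha> n \<in> decision_rules n"
  unfolding BH_eq by (rule return_in_decision_rules[OF bh_measurable])

lemma BH_rej:
  "null_rej n (BH (1 - \<pi>1) \<alpha> n) = (\<integral>\<omega>. bh_count n Not \<omega> \<partial>TG n)"
  "alt_rej n (BH (1 - \<pi>1) \<alpha> n) = (\<integral>\<omega>. bh_count n (\<lambda>b. b) \<omega> \<partial>TG n)"
proof -
  interpret prob_space "TG n" for n by (rule prob_space_two_group)
  have "integrable (TG n) (\<lambda>\<omega>. of_bool (bh n (snd \<omega>) i \<and> B (fst \<omega> i)) :: real)" for B i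
  proof (rule integrable_const_bound[where B=1])
    have "Measurable.pred (TG_space n) (\<lambda>\<omega>. B (fst \<omega> i))"
      by (rule measurable_compose[OF measurable_label]) simp
    then show "(\<lambda>\<omega>. of_bool (bh n (snd \<omega>) i \<and> B (fst \<omega> i)) :: real) \<in> borel_measurable (TG n)"
      unfolding of_bool_def by measurable
  qed simp
  then have "(\<integral>\<omega>. bh_count n B \<omega> \<partial>TG n)
      = (\<Sum>i<n. \<integral>\<omega>. of_bool (bh n (snd \<omega>) i \<and> B (fst \<omega> i)) \<partial>TG n)" for B
    unfolding bh_count_def by (intro Bochner_Integration.integral_sum) blast
  then show "null_rej n (BH (1 - \<pi>1) \<alpha> n) = (\<integral>\<omega>. bh_count n Not \<omega> \<partial>TG n)"
    "alt_rej n (BH (1 - \<pi>1) \<alpha> n) = (\<integral>\<omega>. bh_count n (\<lambda>b. b) \<omega> \<partial>TG n)"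
    unfolding BH_eq rej_return[OF bh_measurable] by simp_all
qed

section \<open>Limits of the four error rates\<close>

abbreviation "q0 \<equiv> (1 - \<pi>1) * t"
abbreviation "q1 \<equiv> \<pi>1 * F1 t"

lemma pair_prob_threshold:
  "pair_prob (\<lambda>b x. \<not> b \<and> x \<le> t) = q0" "pair_prob (\<lambda>b x. b \<and> x \<le> t) = q1"
  using pair_prob_le[of Not t] pair_prob_le[of "\<lambda>b. b" t] t by (simp_all add: F0_eq)

text \<open>This is the crossing equation multiplied by \<alpha>, as
  \<open>q0 + q1 = Fmix t\<close>.\<close>

lemma mFDR_level_threshold: "q0 = \<alpha> * (q0 + q1)"
  using threshold \<alpha> by (simp add: Fmix_def field_simps)

lemma q_bounds: "0 < q0" "0 < q1" "q0 + q1 < 1" "F1 t \<le> 1"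
proof -
  show "0 < q0" using t \<pi>1 by simp
  have "0 < t * f1 t" using f1_pos t by simp
  then show "0 < q1" using F1_gt[OF t] \<pi>1 by simp
  show F1: "F1 t \<le> 1"
    using real_distribution_obs_law[of True]
    by (simp add: F1_def cdf_def real_distribution.axioms(1) prob_space.prob_le_1)
  have "\<pi>1 * F1 t \<le> \<pi>1 * 1" using F1 \<pi>1 by (intro mult_left_mono) auto
  moreover have "(1 - \<pi>1) * t < (1 - \<pi>1) * 1" using t \<pi>1 by (intro mult_strict_left_mono) auto
  ultimately show "q0 + q1 < 1" by simp
qed

text \<open>The slope conditions compare mean densities with \<open>f1 t\<close>: the mean of
  \<open>f1\<close> up to \<open>t\<close> exceeds it, and the mean from \<open>t\<close> to 1 is at
  most it.\<close>

lemma mFNR_opt_threshold: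
  assumes "1 \<le> m"
  shows "mFNR_opt \<pi>1 (indicator {0<..<1}) f1 m \<alpha> = (\<pi>1 - q1) / (1 - (q0 + q1))"
proof (rule mFNR_opt_eq[where S="{0<..t}" and \<kappa>="\<pi>1 * f1 t / (1 - \<pi>1)"])
  show "q0 = pair_prob (\<lambda>b x. \<not> b \<and> x \<in> {0<..t})" "q1 = pair_prob (\<lambda>b x. b \<and> x \<in> {0<..t})"
    using pair_prob_Ioc[OF t(1), of Not] pair_prob_Ioc[OF t(1), of "\<lambda>b. b"] pair_prob_threshold
    by simp_all
  show "0 < \<pi>1 * f1 t / (1 - \<pi>1)" using f1_pos t \<pi>1 by simp
  show "\<pi>1 * f1 t / (1 - \<pi>1) * q0 < q1"
  proof -
    have "\<pi>1 * f1 t / (1 - \<pi>1) * q0 = \<pi>1 * (t * f1 t)" using \<pi>1 by simp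
    then show ?thesis using F1_gt[OF t] \<pi>1 by (simp add: mult.commute)
  qed
  have "\<pi>1 - q1 = \<pi>1 * (F1 1 - F1 t)" by (simp add: F1_1 algebra_simps)
  also have "\<dots> \<le> \<pi>1 * ((1 - t) * f1 t)"
    using F1_diff_le[of t 1] t \<pi>1 by (intro mult_left_mono) auto
  also have "\<dots> = \<pi>1 * f1 t / (1 - \<pi>1) * (1 - \<pi>1 - q0)" using \<pi>1 by (simp add: field_simps)
  finally show "\<pi>1 - q1 \<le> \<pi>1 * f1 t / (1 - \<pi>1) * (1 - \<pi>1 - q0)" .
qed (use assms \<alpha> mFDR_level_threshold posterior_threshold[OF t] in auto)

lemma mFDR_BH: "(\<lambda>n. mFDR \<pi>1 (indicator {0<..<1}) f1 n (BH (1 - \<pi>1) \<alpha> n)) \<longlonglongrightarrow> \<alpha>"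
proof -
  let ?a = "\<lambda>n. (\<integral>\<omega>. bh_count n Not \<omega> \<partial>TG n) / n" and ?c = "\<lambda>n. (\<integral>\<omega>. bh_count n (\<lambda>b. b) \<omega> \<partial>TG n) / n"
  have "?a \<longlonglongrightarrow> q0" "?c \<longlonglongrightarrow> q1"
    using expectation_bh_count[of Not] expectation_bh_count[of "\<lambda>b. b"] by (simp_all add: pair_prob_threshold)
  then have "(\<lambda>n. ?a n / (?a n + ?c n)) \<longlonglongrightarrow> q0 / (q0 + q1)"
    using q_bounds by (intro tendsto_intros) auto
  moreover have "q0 / (q0 + q1) = \<alpha>" using mFDR_level_threshold q_bounds by (simp add: divide_eq_eq)
  moreover have "\<forall>\<^sub>F n in sequentially. ?a n / (?a n + ?c n)
      = mFDR \<pi>1 (indicator {0<..<1}) f1 n (BH (1 - \<pi>1) \<alpha> n)"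
    using eventually_gt_at_top[of "0::nat"]
    by eventually_elim (simp add: mFDR_eq[OF BH_rule] BH_rej add_divide_distrib[symmetric])
  ultimately show ?thesis by (simp add: tendsto_cong)
qed

lemma mFNR_BH:
  "(\<lambda>n. mFNR \<pi>1 (indicator {0<..<1}) f1 n (BH (1 - \<pi>1) \<alpha> n)) \<longlonglongrightarrow> (\<pi>1 - q1) / (1 - (q0 + q1))"
proof -
  let ?a = "\<lambda>n. (\<integral>\<omega>. bh_count n Not \<omega> \<partial>TG n) / n" and ?c = "\<lambda>n. (\<integral>\<omega>. bh_count n (\<lambda>b. b) \<omega> \<partial>TG n) / n"
  have "?a \<longlonglongrightarrow> q0" "?c \<longlonglongrightarrow> q1"
    using expectation_bh_count[of Not] expectation_bh_count[of "\<lambda>b. b"] by (simp_all add: pair_prob_threshold)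
  then have "(\<lambda>n. (\<pi>1 - ?c n) / (1 - (?a n + ?c n))) \<longlonglongrightarrow> (\<pi>1 - q1) / (1 - (q0 + q1))"
    using q_bounds by (intro tendsto_intros) auto
  moreover have "\<forall>\<^sub>F n in sequentially. (\<pi>1 - ?c n) / (1 - (?a n + ?c n))
      = mFNR \<pi>1 (indicator {0<..<1}) f1 n (BH (1 - \<pi>1) \<alpha> n)"
    using eventually_gt_at_top[of "0::nat"]
  proof eventually_elim
    case (elim n)
    have "(\<pi>1 - ?c n) / (1 - (?a n + ?c n)) = (n * (\<pi>1 - ?c n)) / (n * (1 - (?a n + ?c n)))"
      using elim by simp
    also have "n * (\<pi>1 - ?c n) = n * \<pi>1 - (\<integral>\<omega>. bh_count n (\<lambda>b. b) \<omega> \<partial>TG n)"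
      using elim by (simp add: algebra_simps)
    also have "n * (1 - (?a n + ?c n)) = n - ((\<integral>\<omega>. bh_count n Not \<omega> \<partial>TG n) + (\<integral>\<omega>. bh_count n (\<lambda>b. b) \<omega> \<partial>TG n))"
      using elim by (simp add: algebra_simps)
    finally show ?case by (simp add: mFNR_eq[OF BH_rule] BH_rej)
  qed
  ultimately show ?thesis by (simp add: tendsto_cong)
qed

lemma measurable_FDP: "(\<lambda>(\<theta>, x, d). FDP n \<theta> d) \<in> borel_measurable (law_space n)"
  and measurable_FNP: "(\<lambda>(\<theta>, x, d). FNP n \<theta> d) \<in> borel_measurable (law_space n)"
proof -
  have [measurable]: "Measurable.pred (law_space n) (\<lambda>z. fst z i)" for i
    by (rule measurable_compose[OF measurable_fst]) simp
  have [measurable]: "Measurable.pred (law_space n) (\<lambda>z. snd (snd z) i)" for i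
    by (rule measurable_compose[OF measurable_compose[OF measurable_snd measurable_snd]]) simp
  show "(\<lambda>(\<theta>, x, d). FDP n \<theta> d) \<in> borel_measurable (law_space n)"
    "(\<lambda>(\<theta>, x, d). FNP n \<theta> d) \<in> borel_measurable (law_space n)"
    unfolding case_prod_unfold FDP_def FNP_def of_bool_def by measurable
qed

lemma measurable_bh_joint: "(\<lambda>\<omega>. (fst \<omega>, snd \<omega>, bh n (snd \<omega>))) \<in> TG n \<rightarrow>\<^sub>M law_space n"
  using measurable_compose[OF _ bh_measurable, of snd "TG n"] by measurable

lemma bh_count_all: "conv_in_prob TG (\<lambda>n \<omega>. bh_count n (\<lambda>_. True) \<omega> / n) (q0 + q1)"
  using bh_count_conv[of "\<lambda>_. True"] pair_prob_le_Fmix[of t] t by (simp add: Fmix_def)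

text \<open>Once the rejection proportion is within half of its limit, there are at least
  \<open>n * ((q0 + q1) / 2)\<close> rejections, so at least one for large \<open>n\<close>. The
  maximum in the denominator then drops out and FDP is a continuous function of two converging
  proportions.\<close>

lemma FDP_BH:
  "conv_in_prob (\<lambda>n. law n (BH (1 - \<pi>1) \<alpha> n)) (\<lambda>n (\<theta>, x, d). FDP n \<theta> d) \<alpha>"
  unfolding BH_eq
proof (rule conv_in_prob_law_return[OF bh_measurable measurable_FDP])
  have "conv_in_prob TG (\<lambda>n \<omega>. case (fst \<omega>, snd \<omega>, bh n (snd \<omega>)) of (\<theta>, x, d) \<Rightarrow> FDP n \<theta> d)
    ((\<lambda>p. fst p / snd p) (q0, q0 + q1))"
  proof (rule conv_in_prob_continuous[OF prob_space_two_group _ _ _ bh_count_all])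
    show "conv_in_prob TG (\<lambda>n \<omega>. bh_count n Not \<omega> / n) q0"
      using bh_count_conv[of Not] by (simp add: pair_prob_threshold)
    show "(\<lambda>\<omega>. case (fst \<omega>, snd \<omega>, bh n (snd \<omega>)) of (\<theta>, x, d) \<Rightarrow> FDP n \<theta> d) \<in> borel_measurable (TG n)" for n
      by (rule measurable_compose[OF measurable_bh_joint measurable_FDP])
    show "isCont (\<lambda>p. fst p / snd p) (q0, q0 + q1)"
      using q_bounds by (intro continuous_intros) auto
    show "0 < (q0 + q1) / 2" using q_bounds by simp
    show "\<forall>\<^sub>F n in sequentially. \<forall>\<omega>\<in>space (TG n). \<bar>bh_count n Not \<omega> / n - q0\<bar> \<le> (q0 + q1) / 2
      \<longrightarrow> \<bar>bh_count n (\<lambda>_. True) \<omega> / n - (q0 + q1)\<bar> \<le> (q0 + q1) / 2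
      \<longrightarrow> (case (fst \<omega>, snd \<omega>, bh n (snd \<omega>)) of (\<theta>, x, d) \<Rightarrow> FDP n \<theta> d)
        = (\<lambda>p. fst p / snd p) (bh_count n Not \<omega> / n, bh_count n (\<lambda>_. True) \<omega> / n)"
      using eventually_gt_at_top[of "nat \<lceil>2 / (q0 + q1)\<rceil>"]
    proof eventually_elim
      case (elim n)
      have n: "2 / (q0 + q1) < n" using elim by linarith
      then have n0: "0 < n" using q_bounds by (cases "n = 0") (auto simp: field_simps)
      have n2: "1 \<le> n * ((q0 + q1) / 2)" using n q_bounds by (simp add: field_simps)
      show ?case
      proof (intro ballI impI)
        fix \<omega>
        assume "\<bar>bh_count n (\<lambda>_. True) \<omega> / n - (q0 + q1)\<bar> \<le> (q0 + q1) / 2"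
        then have "(q0 + q1) / 2 \<le> bh_count n (\<lambda>_. True) \<omega> / n"
          by (rule half_le)
        then have "n * ((q0 + q1) / 2) \<le> bh_count n (\<lambda>_. True) \<omega>" using n0 by (simp add: field_simps)
        then have R: "1 \<le> bh_count n (\<lambda>_. True) \<omega>" using n2 by linarith
        have "FDP n (fst \<omega>) (bh n (snd \<omega>)) = bh_count n Not \<omega> / max 1 (bh_count n (\<lambda>_. True) \<omega>)"
          unfolding FDP_def bh_count_def
          by (intro arg_cong2[where f="(/)"] arg_cong2[where f=max] sum.cong refl) auto
        then show "(case (fst \<omega>, snd \<omega>, bh n (snd \<omega>)) of (\<theta>, x, d) \<Rightarrow> FDP n \<theta> d)
          = (\<lambda>p. fst p / snd p) (bh_count n Not \<omega> / n, bh_count n (\<lambda>_. True) \<omega> / n)"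
          using R n0 by simp
      qed
    qed
  qed measurable
  moreover have "q0 / (q0 + q1) = \<alpha>" using mFDR_level_threshold q_bounds by (simp add: divide_eq_eq)
  ultimately show "conv_in_prob TG (\<lambda>n \<omega>. case (fst \<omega>, snd \<omega>, bh n (snd \<omega>)) of (\<theta>, x, d) \<Rightarrow> FDP n \<theta> d) \<alpha>"
    by simp
qed

lemma FNP_BH:
  "conv_in_prob (\<lambda>n. law n (BH (1 - \<pi>1) \<alpha> n)) (\<lambda>n (\<theta>, x, d). FNP n \<theta> d) ((\<pi>1 - q1) / (1 - (q0 + q1)))"
  unfolding BH_eq
proof (rule conv_in_prob_law_return[OF bh_measurable measurable_FNP])
  \<comment> \<open>Proportion of missed alternatives: all alternatives less the rejected ones, each
    with a limit of its own.\<close>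
  define X where "X n \<omega> = (count_pairs n (\<lambda>b _. b) \<omega> - bh_count n (\<lambda>b. b) \<omega>) / n" for n \<omega>
  have Xm: "X n \<in> borel_measurable (TG n)" for n unfolding X_def[abs_def] by measurable
  have X: "conv_in_prob TG X ((\<lambda>p. fst p - snd p) (\<pi>1, q1))"
  proof (rule conv_in_prob_continuous[OF prob_space_two_group _ _ _ _ Xm])
    show "conv_in_prob TG (\<lambda>n \<omega>. count_pairs n (\<lambda>b _. b) \<omega> / n) \<pi>1"
      using count_pairs_lln[of "\<lambda>b _. b"] by (simp add: pair_prob_label)
    show "conv_in_prob TG (\<lambda>n \<omega>. bh_count n (\<lambda>b. b) \<omega> / n) q1"
      using bh_count_conv[of "\<lambda>b. b"] by (simp add: pair_prob_threshold)
    show "isCont (\<lambda>p. fst p - snd p) (\<pi>1, q1)" by (intro continuous_intros)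
    show "(0::real) < 1" by simp
  qed (auto simp: X_def diff_divide_distrib)
  have "conv_in_prob TG (\<lambda>n \<omega>. case (fst \<omega>, snd \<omega>, bh n (snd \<omega>)) of (\<theta>, x, d) \<Rightarrow> FNP n \<theta> d)
    ((\<lambda>p. fst p / (1 - snd p)) (\<pi>1 - q1, q0 + q1))"
  proof (rule conv_in_prob_continuous[OF prob_space_two_group Xm _ _ bh_count_all])
    show "conv_in_prob TG X (\<pi>1 - q1)" using X by simp
    show "(\<lambda>\<omega>. case (fst \<omega>, snd \<omega>, bh n (snd \<omega>)) of (\<theta>, x, d) \<Rightarrow> FNP n \<theta> d) \<in> borel_measurable (TG n)" for n
      by (rule measurable_compose[OF measurable_bh_joint measurable_FNP])
    show "isCont (\<lambda>p. fst p / (1 - snd p)) (\<pi>1 - q1, q0 + q1)"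
      using q_bounds by (intro continuous_intros) auto
    show "0 < (1 - (q0 + q1)) / 2" using q_bounds by simp
    show "\<forall>\<^sub>F n in sequentially. \<forall>\<omega>\<in>space (TG n). \<bar>X n \<omega> - (\<pi>1 - q1)\<bar> \<le> (1 - (q0 + q1)) / 2
      \<longrightarrow> \<bar>bh_count n (\<lambda>_. True) \<omega> / n - (q0 + q1)\<bar> \<le> (1 - (q0 + q1)) / 2
      \<longrightarrow> (case (fst \<omega>, snd \<omega>, bh n (snd \<omega>)) of (\<theta>, x, d) \<Rightarrow> FNP n \<theta> d)
        = (\<lambda>p. fst p / (1 - snd p)) (X n \<omega>, bh_count n (\<lambda>_. True) \<omega> / n)"
      using eventually_gt_at_top[of "nat \<lceil>2 / (1 - (q0 + q1))\<rceil>"]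
    proof eventually_elim
      case (elim n)
      \<comment> \<open>The limiting proportion of accepted hypotheses; \<open>n * (g / 2)\<close>
        is at least 1 for these \<open>n\<close>, so again the maximum drops out.\<close>
      define g where "g = 1 - (q0 + q1)"
      have g: "0 < g" using q_bounds by (simp add: g_def)
      have n: "2 / g < n" using elim unfolding g_def[symmetric] by linarith
      then have n0: "0 < n" using g by (cases "n = 0") (auto simp: field_simps)
      have n2: "1 \<le> n * (g / 2)" using n g by (simp add: field_simps)
      show ?case
      proof (intro ballI impI)
        fix \<omega>
        assume "\<bar>bh_count n (\<lambda>_. True) \<omega> / n - (q0 + q1)\<bar> \<le> (1 - (q0 + q1)) / 2"
        then have "g / 2 \<le> 1 - bh_count n (\<lambda>_. True) \<omega> / n"
          unfolding g_def by (rule half_gap_le_compl)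
        then have "n * (g / 2) \<le> n * (1 - bh_count n (\<lambda>_. True) \<omega> / n)"
          by (intro mult_left_mono) auto
        also have "\<dots> = n - bh_count n (\<lambda>_. True) \<omega>" using n0 by (simp add: algebra_simps)
        finally have R: "1 \<le> n - bh_count n (\<lambda>_. True) \<omega>" using n2 by linarith
        have "(\<Sum>i<n. (1 - of_bool (bh n (snd \<omega>) i)) * of_bool (fst \<omega> i))
            = count_pairs n (\<lambda>b _. b) \<omega> - bh_count n (\<lambda>b. b) \<omega>"
          unfolding count_pairs_def bh_count_def sum_subtractf[symmetric] by (intro sum.cong) auto
        moreover have "(\<Sum>i<n. 1 - of_bool (bh n (snd \<omega>) i)) = n - bh_count n (\<lambda>_. True) \<omega>"
          unfolding bh_count_def by (simp only: sum_subtractf) simp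
        ultimately have "FNP n (fst \<omega>) (bh n (snd \<omega>)) = (count_pairs n (\<lambda>b _. b) \<omega> - bh_count n (\<lambda>b. b) \<omega>)
            / (n - bh_count n (\<lambda>_. True) \<omega>)"
          unfolding FNP_def using R by (simp only: max_absorb2)
        also have "\<dots> = X n \<omega> / ((n - bh_count n (\<lambda>_. True) \<omega>) / n)"
          unfolding X_def using n0 by simp
        also have "(n - bh_count n (\<lambda>_. True) \<omega>) / n = 1 - bh_count n (\<lambda>_. True) \<omega> / n"
          using n0 by (simp add: diff_divide_distrib)
        finally show "(case (fst \<omega>, snd \<omega>, bh n (snd \<omega>)) of (\<theta>, x, d) \<Rightarrow> FNP n \<theta> d)
          = (\<lambda>p. fst p / (1 - snd p)) (X n \<omega>, bh_count n (\<lambda>_. True) \<omega> / n)"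
          by simp
      qed
    qed
  qed measurable
  then show "conv_in_prob TG (\<lambda>n \<omega>. case (fst \<omega>, snd \<omega>, bh n (snd \<omega>)) of (\<theta>, x, d) \<Rightarrow> FNP n \<theta> d)
    ((\<pi>1 - q1) / (1 - (q0 + q1)))"
    by simp
qed

end

end

lemma is_density_uniform: "is_density (indicator {0<..<1})"
  by (auto simp: is_density_def ennreal_indicator)

text \<open>By monotonicity the limit is the supremum \<open>L\<close> of \<open>f\<close>. If
  \<open>f\<close> stayed at or below \<open>c / \<alpha>\<close>, then \<open>L\<close> would be
  finite with the same bound, so \<open>\<alpha> \<le> c / L\<close>. An infinite \<open>L\<close>
  makes the quotient 0, and \<alpha> is positive in that case too.\<close>

lemma exceeds_of_ratio_less_Lim:
  fixes f :: "real \<Rightarrow> real"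
  assumes c: "0 < c" and f_pos: "\<And>x. 0 < x \<Longrightarrow> x < 1 \<Longrightarrow> 0 < f x"
    and mono: "\<And>x y. 0 < x \<Longrightarrow> x \<le> y \<Longrightarrow> y < 1 \<Longrightarrow> f y \<le> f x"
    and less: "ereal c / Lim (at_right 0) (\<lambda>x. ereal (f x)) < ereal \<alpha>"
  shows "0 < \<alpha>" and "\<exists>x. 0 < x \<and> x < 1 \<and> c / \<alpha> < f x"
proof -
  define L where "L = (SUP x\<in>{0<..<1}. ereal (f x))"
  have lim: "Lim (at_right 0) (\<lambda>x. ereal (f x)) = L"
    unfolding L_def by (rule Lim_at_right_antimono) (use mono in auto)
  have "ereal (f (1/2)) \<le> L" unfolding L_def by (rule SUP_upper) simp
  then have L: "0 < L" using f_pos[of "1/2"] by (auto intro: less_le_trans[of _ "ereal (f (1/2))"])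
  show \<alpha>: "0 < \<alpha>"
    using less L c unfolding lim by (cases L) (auto simp: divide_less_eq intro: less_trans[OF divide_pos_pos])
  show "\<exists>x. 0 < x \<and> x < 1 \<and> c / \<alpha> < f x"
  proof (rule ccontr)
    assume "\<not> ?thesis"
    then have "f x \<le> c / \<alpha>" if "0 < x" "x < 1" for x
      using that by (meson not_less)
    then have "L \<le> ereal (c / \<alpha>)" unfolding L_def by (intro SUP_least) simp
    with L obtain l where l: "L = ereal l" "0 < l" "l \<le> c / \<alpha>" by (cases L) auto
    then have "\<alpha> \<le> c / l" using \<alpha> by (simp add: field_simps)
    then show False using less l unfolding lim by simp
  qed
qed

theorem proposition3:
  fixes \<pi>0 \<pi>1 \<alpha> :: real and f0 f1 f W :: "real \<Rightarrow> real"
  assumes "0 < \<pi>0" "\<pi>0 < 1" "0 < \<pi>1" "\<pi>1 < 1" "\<pi>0 + \<pi>1 = 1"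
    and f0: "f0 = indicator {0<..<1}"
    and f1: "is_density f1" "\<And>x. x \<notin> {0<..<1} \<Longrightarrow> f1 x = 0" "strict_antimono_on {0<..<1} f1"
    and f: "\<And>x. f x = \<pi>0 * f0 x + \<pi>1 * f1 x"
    and W: "\<And>x. W x = \<pi>0 * f0 x / f x"
    and W_continuous: "\<And>n i. i < n \<Longrightarrow>
          continuous_on UNIV (cdf (distr (two_group \<pi>1 f0 f1 n) borel (\<lambda>(\<theta>, x). W (x i))))"
    and \<alpha>: "ereal \<pi>0 / Lim (at_right 0) (\<lambda>x. ereal (f x)) < ereal \<alpha>" "\<alpha> < \<pi>0"
  shows "(\<lambda>n. mFDR \<pi>1 f0 f1 n (BH \<pi>0 \<alpha> n)) \<longlonglongrightarrow> \<alpha>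
    \<and> (\<forall>m\<ge>1. (\<lambda>n. mFNR \<pi>1 f0 f1 n (BH \<pi>0 \<alpha> n)) \<longlonglongrightarrow> mFNR_opt \<pi>1 f0 f1 m \<alpha>)
    \<and> conv_in_prob (\<lambda>n. decision_law \<pi>1 f0 f1 n (BH \<pi>0 \<alpha> n))
           (\<lambda>n (\<theta>, x, d). FDP n \<theta> d) \<alpha>
    \<and> (\<forall>m\<ge>1. conv_in_prob (\<lambda>n. decision_law \<pi>1 f0 f1 n (BH \<pi>0 \<alpha> n))
           (\<lambda>n (\<theta>, x, d). FNP n \<theta> d) (mFNR_opt \<pi>1 f0 f1 m \<alpha>))"
proof -
  have \<pi>0: "\<pi>0 = 1 - \<pi>1" using assms(5) by simp
  interpret decreasing_alternative \<pi>1 f1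
    using assms(3,4) f1 is_density_uniform by unfold_locales auto
  have f_eq: "f x = 1 - \<pi>1 + \<pi>1 * f1 x" if "0 < x" "x < 1" for x
    using that by (simp add: f f0 \<pi>0)
  have f_pos: "0 < f x" if "0 < x" "x < 1" for x
    using f_eq[OF that] f1_pos[OF that] assms(3,4) by (simp add: add_pos_pos)
  have f_mono: "f y \<le> f x" if "0 < x" "x \<le> y" "y < 1" for x y
    using f1_less[of x y] that assms(3) by (cases "x = y") (auto simp: f_eq)
  note ratio = exceeds_of_ratio_less_Lim[OF assms(1) f_pos f_mono \<alpha>(1)]
  have \<alpha>_pos: "0 < \<alpha>" by (rule ratio)
  have \<alpha>_less: "\<alpha> < 1 - \<pi>1" using \<alpha>(2) \<pi>0 by simp
  obtain t0 where t0: "0 < t0" "t0 < 1" "\<pi>0 / \<alpha> < f t0" using ratio(2) by blast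
  have "1 < (1 - \<pi>1) / \<alpha>" using \<alpha>_pos \<alpha>_less by simp
  \<comment> \<open>The lower bound on \<alpha> supplies the point \<open>t0\<close>, the upper
    bound the inequality \<open>1 < (1 - \<pi>1) / \<alpha>\<close>.\<close>
  then obtain t where t: "0 < t" "t < 1" "Fmix t = (1 - \<pi>1) / \<alpha> * t"
    by (rule threshold_exists[of _ t0]) (use t0 f_eq[of t0] \<pi>0 in auto)
  note setting = \<alpha>_pos \<alpha>_less t
  show ?thesis
    unfolding f0 \<pi>0
    using mFDR_BH[OF setting] mFNR_BH[OF setting] FDP_BH[OF setting] FNP_BH[OF setting]
      mFNR_opt_threshold[OF setting] by simp
qed

end
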